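(* Let $a:[0,1]\to\mathbb R$ be continuous with $a(0)=0$, $a>0$ on $(0,1]$, and suppose there exists $K\in(0,2)$ such that the function $x\mapsto\frac{x^K}{a(x)}$ is non decreasing near $x=0$. Consider the problem $$\begin{cases}y_{tt}+a(x)y_{xxxx}=0, & (t,x)\in(0,+\infty)\times(0,1),\\ y(t,0)=y(t,1)=0,\ y_x(t,0)=y_x(t,1)=0, & t\in(0,+\infty),\\ y(0,x)=y^0_T(x),\ y_t(0,x)=y^1_T(x), & x\in(0,1).\end{cases}$$ If $(y^0_T,y^1_T)\in\mathcal H_0$, then there exists a unique mild solution $$y\in C^1([0,+\infty);L^2_{\frac1a}(0,1))\cap C([0,+\infty);H^2_{\frac1a}(0,1))$$ of this problem, and it depends continuously on the initial data $(y^0_T,y^1_T)\in\mathcal H_0$. Moreover, if $(y^0_T,y^1_T)\in D(\mathcal A)$, then the solution $y$ is classical, in the sense that $$y\in C^2([0,+\infty);L^2_{\frac1a}(0,1))\cap C^1([0,+\infty);H^2_{\frac1a}(0,1))\cap C([0,+\infty);D(A))$$ and the equation $y_{tt}+ay_{xxxx}=0$ holds for all $t\ge0$.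
   Context: Spaces: $L^2_{\frac1a}(0,1):=\{u\in L^2(0,1):\int_0^1\frac{u^2}{a}dx<\infty\}$ with norm$^2$ $\int_0^1\frac{u^2}{a}dx$; $H^2_{\frac1a}(0,1):=L^2_{\frac1a}(0,1)\cap H^2_0(0,1)$ with norm$^2$ $\|u\|^2_{L^2_{1/a}}+\|u'\|^2_{L^2}+\|u''\|^2_{L^2}$; $\mathcal H_0:=H^2_{\frac1a}(0,1)\times L^2_{\frac1a}(0,1)$ with inner product $\langle(u,v),(\tilde u,\tilde v)\rangle_{\mathcal H_0}=\int_0^1u''\tilde u''dx+\int_0^1\frac{v\tilde v}{a}dx$. Operators: $Au:=au''''$ on $D(A):=\{u\in H^2_{\frac1a}(0,1):au''''\in L^2_{\frac1a}(0,1)\}$ (with the graph norm); $\mathcal A(u,v):=(v,-Au)$ on $D(\mathcal A):=D(A)\times H^2_{\frac1a}(0,1)\subset\mathcal H_0$. The problem is rewritten as the Cauchy problem $\dot{\mathcal U}(t)=\mathcal A\,\mathcal U(t)$, $t\ge0$, $\mathcal U(0)=(y^0_T,y^1_T)$, with $\mathcal U=(y,y_t)$; mild solution means $\mathcal U(t)=S(t)\mathcal U(0)$, where $(S(t))_{t\ge0}$ is the $C_0$-semigroup generated by $\mathcal A$ on $\mathcal H_0$. The subscript $T$ in the data is only notation. *)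

theory Defs
  imports "HOL-Analysis.Analysis" "HOL-Library.Function_Algebras"
begin

instantiation "fun" :: (type, scaleR) scaleR
begin
definition scaleR_fun :: "real \<Rightarrow> ('a \<Rightarrow> 'b) \<Rightarrow> 'a \<Rightarrow> 'b" where
  "scaleR_fun c f = (\<lambda>x. c *\<^sub>R f x)"
instance ..
end

instance "fun" :: (type, real_vector) real_vector
  by standard (auto simp: scaleR_fun_def fun_eq_iff scaleR_add_right scaleR_add_left)


section \<open>Curves and semigroups in spaces of representatives\<close>

text \<open>
  A normed space is given by a linear set \<open>V\<close> of representatives and a seminorm \<open>N\<close> on it; two
  elements are identified when \<open>N (x - y) = 0\<close>. For the function spaces below this is equality
  almost everywhere on \<open>(0,1)\<close>.
\<close>

definition eqv :: "('v::real_vector \<Rightarrow> real) \<Rightarrow> 'v \<Rightarrow> 'v \<Rightarrow> bool" where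
  "eqv N x y \<longleftrightarrow> N (x - y) = 0"

definition has_time_derivative ::
    "'v set \<Rightarrow> ('v::real_vector \<Rightarrow> real) \<Rightarrow> (real \<Rightarrow> 'v) \<Rightarrow> (real \<Rightarrow> 'v) \<Rightarrow> bool" where
  "has_time_derivative V N y z \<longleftrightarrow>
     (\<forall>t\<ge>0. y t \<in> V \<and> z t \<in> V \<and>
        ((\<lambda>s. N ((1 / (s - t)) *\<^sub>R (y s - y t) - z t)) \<longlongrightarrow> 0) (at t within {0..}))"

text \<open>\<open>C_time k V N y\<close> says that \<open>y\<close> is of class \<open>C\<^sup>k\<close> from \<open>[0,\<infinity>)\<close> into \<open>(V, N)\<close>.\<close>

primrec C_time ::
    "nat \<Rightarrow> 'v set \<Rightarrow> ('v::real_vector \<Rightarrow> real) \<Rightarrow> (real \<Rightarrow> 'v) \<Rightarrow> bool" where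
  "C_time 0 V N y \<longleftrightarrow>
     (\<forall>t\<ge>0. y t \<in> V \<and> ((\<lambda>s. N (y s - y t)) \<longlongrightarrow> 0) (at t within {0..}))"
| "C_time (Suc k) V N y \<longleftrightarrow> (\<exists>z. has_time_derivative V N y z \<and> C_time k V N z)"

definition C0_semigroup ::
    "'v set \<Rightarrow> ('v::real_vector \<Rightarrow> real) \<Rightarrow> (real \<Rightarrow> 'v \<Rightarrow> 'v) \<Rightarrow> bool" where
  "C0_semigroup V N S \<longleftrightarrow>
     (\<forall>t\<ge>0. \<forall>x\<in>V. S t x \<in> V) \<and>
     (\<forall>t\<ge>0. \<forall>x\<in>V. \<forall>y\<in>V. eqv N (S t (x + y)) (S t x + S t y)) \<and>
     (\<forall>t\<ge>0. \<forall>c. \<forall>x\<in>V. eqv N (S t (c *\<^sub>R x)) (c *\<^sub>R S t x)) \<and>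
     (\<forall>t\<ge>0. \<exists>C. \<forall>x\<in>V. N (S t x) \<le> C * N x) \<and>
     (\<forall>x\<in>V. eqv N (S 0 x) x) \<and>
     (\<forall>s\<ge>0. \<forall>t\<ge>0. \<forall>x\<in>V. eqv N (S (s + t) x) (S s (S t x))) \<and>
     (\<forall>x\<in>V. ((\<lambda>t. N (S t x - x)) \<longlongrightarrow> 0) (at_right 0))"

text \<open>The generator of \<open>S\<close> is exactly the operator \<open>B\<close> with domain \<open>D\<close>.\<close>

definition generated_by ::
    "'v set \<Rightarrow> ('v::real_vector \<Rightarrow> real) \<Rightarrow> (real \<Rightarrow> 'v \<Rightarrow> 'v) \<Rightarrow> 'v set \<Rightarrow> ('v \<Rightarrow> 'v) \<Rightarrow> bool" where
  "generated_by V N S D B \<longleftrightarrow>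
     (\<forall>x\<in>V. \<forall>w\<in>V.
        ((\<lambda>h. N ((1 / h) *\<^sub>R (S h x - x) - w)) \<longlongrightarrow> 0) (at_right 0) \<longleftrightarrow> x \<in> D \<and> eqv N (B x) w)"


section \<open>Sobolev spaces on the unit interval\<close>

abbreviation M01 :: "real measure" where
  "M01 \<equiv> lebesgue_on {0<..<1}"

definition test_function :: "(real \<Rightarrow> real) \<Rightarrow> bool" where
  "test_function \<phi> \<longleftrightarrow>
     (\<forall>n x. (deriv ^^ n) \<phi> field_differentiable at x) \<and>
     (\<exists>c d. 0 < c \<and> c < d \<and> d < 1 \<and> (\<forall>x. x \<notin> {c..d} \<longrightarrow> \<phi> x = 0))"

definition L1_loc :: "(real \<Rightarrow> real) set" where
  "L1_loc = {u. \<forall>c d. 0 < c \<and> c < d \<and> d < 1 \<longrightarrow> u absolutely_integrable_on {c..d}}"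

definition has_weak_deriv :: "nat \<Rightarrow> (real \<Rightarrow> real) \<Rightarrow> (real \<Rightarrow> real) \<Rightarrow> bool" where
  "has_weak_deriv k u g \<longleftrightarrow>
     u \<in> L1_loc \<and> g \<in> L1_loc \<and>
     (\<forall>\<phi>. test_function \<phi> \<longrightarrow>
        (LINT x|M01. u x * (deriv ^^ k) \<phi> x) = (-1) ^ k * (LINT x|M01. g x * \<phi> x))"

text \<open>Determined only up to equality almost everywhere on \<open>(0,1)\<close>.\<close>

definition weak_deriv :: "nat \<Rightarrow> (real \<Rightarrow> real) \<Rightarrow> real \<Rightarrow> real" where
  "weak_deriv k u = (SOME g. has_weak_deriv k u g)"

definition L2 :: "(real \<Rightarrow> real) set" where
  "L2 = {u. u \<in> borel_measurable M01 \<and> integrable M01 (\<lambda>x. (u x)\<^sup>2)}"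

definition H2 :: "(real \<Rightarrow> real) set" where
  "H2 = {u \<in> L2. (\<exists>g\<in>L2. has_weak_deriv 1 u g) \<and> (\<exists>g\<in>L2. has_weak_deriv 2 u g)}"

text \<open>
  Every element of \<open>H\<^sup>2(0,1)\<close> has a representative in \<open>C\<^sup>1([0,1])\<close>, and its boundary values are
  those of that representative.
\<close>

definition H2_0 :: "(real \<Rightarrow> real) set" where
  "H2_0 = {u \<in> H2. \<exists>w w'.
     (AE x in M01. u x = w x) \<and>
     (\<forall>x\<in>{0..1}. (w has_real_derivative w' x) (at x within {0..1})) \<and>
     continuous_on {0..1} w' \<and>
     w 0 = 0 \<and> w 1 = 0 \<and> w' 0 = 0 \<and> w' 1 = 0}"


section \<open>The weighted spaces and operators\<close>

definition L2w :: "(real \<Rightarrow> real) \<Rightarrow> (real \<Rightarrow> real) set" where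
  "L2w a = {u \<in> L2. integrable M01 (\<lambda>x. (u x)\<^sup>2 / a x)}"

definition norm_L2w :: "(real \<Rightarrow> real) \<Rightarrow> (real \<Rightarrow> real) \<Rightarrow> real" where
  "norm_L2w a u = sqrt (LINT x|M01. (u x)\<^sup>2 / a x)"

definition H2w :: "(real \<Rightarrow> real) \<Rightarrow> (real \<Rightarrow> real) set" where
  "H2w a = L2w a \<inter> H2_0"

definition norm_H2w :: "(real \<Rightarrow> real) \<Rightarrow> (real \<Rightarrow> real) \<Rightarrow> real" where
  "norm_H2w a u = sqrt ((norm_L2w a u)\<^sup>2 + (LINT x|M01. (weak_deriv 1 u x)\<^sup>2)
                                          + (LINT x|M01. (weak_deriv 2 u x)\<^sup>2))"

definition H0 :: "(real \<Rightarrow> real) \<Rightarrow> ((real \<Rightarrow> real) \<times> (real \<Rightarrow> real)) set" where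
  "H0 a = H2w a \<times> L2w a"

definition inner_H0 ::
    "(real \<Rightarrow> real) \<Rightarrow> (real \<Rightarrow> real) \<times> (real \<Rightarrow> real) \<Rightarrow> (real \<Rightarrow> real) \<times> (real \<Rightarrow> real) \<Rightarrow> real" where
  "inner_H0 a U W = (LINT x|M01. weak_deriv 2 (fst U) x * weak_deriv 2 (fst W) x)
                  + (LINT x|M01. snd U x * snd W x / a x)"

definition norm_H0 :: "(real \<Rightarrow> real) \<Rightarrow> (real \<Rightarrow> real) \<times> (real \<Rightarrow> real) \<Rightarrow> real" where
  "norm_H0 a U = sqrt (inner_H0 a U U)"

definition opA :: "(real \<Rightarrow> real) \<Rightarrow> (real \<Rightarrow> real) \<Rightarrow> real \<Rightarrow> real" where
  "opA a u = (\<lambda>x. a x * weak_deriv 4 u x)"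

definition domA :: "(real \<Rightarrow> real) \<Rightarrow> (real \<Rightarrow> real) set" where
  "domA a = {u \<in> H2w a. (\<exists>g. has_weak_deriv 4 u g) \<and> opA a u \<in> L2w a}"

definition graph_norm_A :: "(real \<Rightarrow> real) \<Rightarrow> (real \<Rightarrow> real) \<Rightarrow> real" where
  "graph_norm_A a u = sqrt ((norm_L2w a u)\<^sup>2 + (norm_L2w a (opA a u))\<^sup>2)"

definition op_matA ::
    "(real \<Rightarrow> real) \<Rightarrow> (real \<Rightarrow> real) \<times> (real \<Rightarrow> real) \<Rightarrow> (real \<Rightarrow> real) \<times> (real \<Rightarrow> real)" where
  "op_matA a U = (snd U, - opA a (fst U))"

definition dom_matA :: "(real \<Rightarrow> real) \<Rightarrow> ((real \<Rightarrow> real) \<times> (real \<Rightarrow> real)) set" where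
  "dom_matA a = domA a \<times> H2w a"

text \<open>
  The curve \<open>y\<close> is a mild solution when \<open>\<U>(t) = S(t) (y0, y1)\<close> for \<open>\<U> = (y, y\<^sub>t)\<close>, where \<open>S\<close> is the
  semigroup generated by the matrix operator and \<open>y\<^sub>t\<close> is the time derivative in the weighted \<open>L\<^sup>2\<close>
  space. The boundary conditions are part of \<open>H2_0\<close>.
\<close>

definition mild_solution ::
    "(real \<Rightarrow> real) \<Rightarrow> (real \<Rightarrow> real) \<Rightarrow> (real \<Rightarrow> real) \<Rightarrow> (real \<Rightarrow> real \<Rightarrow> real) \<Rightarrow> bool" where
  "mild_solution a y0 y1 y \<longleftrightarrow>
     (\<exists>S yt. C0_semigroup (H0 a) (norm_H0 a) S \<and>
        generated_by (H0 a) (norm_H0 a) S (dom_matA a) (op_matA a) \<and>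
        has_time_derivative (L2w a) (norm_L2w a) y yt \<and>
        (\<forall>t\<ge>0. (y t, yt t) \<in> H0 a \<and> eqv (norm_H0 a) (y t, yt t) (S t (y0, y1))))"

end

(* The theorem is the Lumer-Phillips theorem for the matrix operator on the energy space; the
   semigroup is the limit of the implicit Euler scheme with step 2^-n.

   For the range condition, the Riesz theorem solves u + c A u = f weakly. The delicate point is
   Green's formula on D(A), because u'''' is only locally integrable there. If w in D(A) solves
   w + c A w = 0, then |w(x)| <= C x, so w'''' = -w / (c a) is integrable up to 0 since K < 2; all
   boundary terms vanish and w = 0. Hence D(A) consists of the solutions of the variational
   problems, for which Green's formula is the weak formulation.

   For data U outside D, write U = X - B X with X = (x1, x2) in D, where B is the matrix operator.
   The first component of S(t) U is the difference of the two components of S(t) X, hence still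
   differentiable in the weighted L^2 space.

   Another semigroup with the same generator is a priori bounded only for each fixed time, and the
   uniform boundedness principle gives the continuity of its orbits from the left; dissipativity
   then shows that the two semigroups agree. *)

theory Submission
  imports Defs "HOL-Probability.Discrete_Topology"
begin

section \<open>Contraction semigroups\<close>

text \<open>The spaces are sets of functions with a seminorm, so limits, solutions and semigroup
  laws hold only up to null functions. To work with genuine norms, \<open>emb\<close> sends a vector
  to the functional it represents, restricted to the unit ball; every space becomes a subspace of a
  Banach space of bounded functions, in which the semigroup is built from norm estimates alone.
  Dyadic steps are used because a step of length 2k can be compared with two steps of length k on
  the domain of the square of the operator; the errors then form a geometric series, and no integral
  of a vector valued function enters. On the analytic side everything is reduced to primitives: up
  to null sets, \<open>H2_0\<close> consists of the double primitives of those g in L2 that are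
  orthogonal to 1 and x. This gives its completeness, the bound of u by a multiple of x near 0, and
  the disappearance of boundary terms in Green's formula for integrable fourth derivatives. For the
  matrix operator the resolvent equation with step h reduces to u + h^2 A u = f1 + h f2, so one
  scalar elliptic problem carries the range condition.\<close>

lemma euler_square:
  fixes u v w :: "'e::real_vector"
  shows "(u - k *\<^sub>R v) - k *\<^sub>R (v - k *\<^sub>R w) = (u - (2 * k) *\<^sub>R v) + k\<^sup>2 *\<^sub>R w"
proof -
  have two: "(2 * k) *\<^sub>R v = k *\<^sub>R v + k *\<^sub>R v"
    by (simp only: mult_2 scaleR_left_distrib)
  have sq: "k\<^sup>2 *\<^sub>R w = k *\<^sub>R k *\<^sub>R w" by (simp add: power2_eq_square)
  show ?thesis unfolding two sq scaleR_diff_right by simp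
qed

text \<open>\<open>H\<close> and \<open>D\<close> are subspaces of a Banach type because the energy
  space is only available as a closed image inside a larger space of bounded functions.
  Dissipativity enters as a lower bound for 1 - h A, which together with \<open>range\<close> makes
  the resolvents contractions defined on all of \<open>H\<close>.\<close>

locale m_dissipative =
  fixes H D :: "'e::banach set" and A :: "'e \<Rightarrow> 'e"
  assumes subspace_H: "subspace H" and closed_H: "closed H"
    and subspace_D: "subspace D" and D_subset: "D \<subseteq> H"
    and A_in: "x \<in> D \<Longrightarrow> A x \<in> H"
    and A_add: "x \<in> D \<Longrightarrow> y \<in> D \<Longrightarrow> A (x + y) = A x + A y"
    and A_scale: "x \<in> D \<Longrightarrow> A (c *\<^sub>R x) = c *\<^sub>R A x"
    and dissipative: "x \<in> D \<Longrightarrow> 0 \<le> h \<Longrightarrow> norm x \<le> norm (x - h *\<^sub>R A x)"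
    and range: "f \<in> H \<Longrightarrow> 0 < h \<Longrightarrow> \<exists>x\<in>D. x - h *\<^sub>R A x = f"
    and dense: "H \<subseteq> closure D"
begin

lemma A_diff: "x \<in> D \<Longrightarrow> y \<in> D \<Longrightarrow> A (x - y) = A x - A y"
  using A_add[of x "(-1) *\<^sub>R y"] A_scale[of y "-1"] subspace_scale[OF subspace_D, of y "-1"] by simp

lemma H_diff: "x \<in> H \<Longrightarrow> y \<in> H \<Longrightarrow> x - y \<in> H"
  and D_diff: "x \<in> D \<Longrightarrow> y \<in> D \<Longrightarrow> x - y \<in> D"
  using subspace_diff subspace_H subspace_D by auto

lemma H_scale: "x \<in> H \<Longrightarrow> c *\<^sub>R x \<in> H"
  and D_scale: "x \<in> D \<Longrightarrow> c *\<^sub>R x \<in> D"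
  and H_add: "x \<in> H \<Longrightarrow> y \<in> H \<Longrightarrow> x + y \<in> H"
  and D_add: "x \<in> D \<Longrightarrow> y \<in> D \<Longrightarrow> x + y \<in> D"
  using subspace_scale subspace_add subspace_H subspace_D by auto

lemma approx_D:
  assumes "x \<in> H" "0 < e"
  obtains z where "z \<in> D" "norm (x - z) < e"
  using assms dense closure_approachable[of x D] by (auto simp: dist_norm norm_minus_commute)

lemma resolvent_inj:
  assumes "x \<in> D" "y \<in> D" "x - h *\<^sub>R A x = y - h *\<^sub>R A y" "0 \<le> h"
  shows "x = y"
proof -
  have "norm (x - y) \<le> norm ((x - y) - h *\<^sub>R A (x - y))"
    using assms by (intro dissipative D_diff)
  also have "(x - y) - h *\<^sub>R A (x - y) = (x - h *\<^sub>R A x) - (y - h *\<^sub>R A y)"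
    using assms by (simp add: A_diff algebra_simps)
  finally show ?thesis using assms(3) by simp
qed

section \<open>Resolvents and their powers\<close>

definition J :: "real \<Rightarrow> 'e \<Rightarrow> 'e" where
  "J h f = (THE x. x \<in> D \<and> x - h *\<^sub>R A x = f)"

lemma J_unique: "x \<in> D \<Longrightarrow> x - h *\<^sub>R A x = f \<Longrightarrow> 0 < h \<Longrightarrow> J h f = x"
  unfolding J_def by (rule the_equality) (auto intro: resolvent_inj)

lemma J_in_D: "f \<in> H \<Longrightarrow> 0 < h \<Longrightarrow> J h f \<in> D"
  and J_eq: "f \<in> H \<Longrightarrow> 0 < h \<Longrightarrow> J h f - h *\<^sub>R A (J h f) = f"
  using range[of f h] J_unique[of _ h f] by auto

lemma J_in_H: "f \<in> H \<Longrightarrow> 0 < h \<Longrightarrow> J h f \<in> H"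
  using J_in_D D_subset by blast

lemma J_norm: "f \<in> H \<Longrightarrow> 0 < h \<Longrightarrow> norm (J h f) \<le> norm f"
  using dissipative[OF J_in_D, of f h h] J_eq[of f h] by simp

lemma J_add:
  assumes "f \<in> H" "g \<in> H" "0 < h" shows "J h (f + g) = J h f + J h g"
proof (intro J_unique D_add J_in_D assms)
  have "J h f + J h g - h *\<^sub>R A (J h f + J h g) = (J h f - h *\<^sub>R A (J h f)) + (J h g - h *\<^sub>R A (J h g))"
    using assms by (simp add: A_add J_in_D algebra_simps)
  then show "J h f + J h g - h *\<^sub>R A (J h f + J h g) = f + g" using assms by (simp only: J_eq)
qed

lemma J_scale:
  assumes "f \<in> H" "0 < h" shows "J h (c *\<^sub>R f) = c *\<^sub>R J h f"
proof (intro J_unique D_scale J_in_D assms)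
  have "c *\<^sub>R J h f - h *\<^sub>R A (c *\<^sub>R J h f) = c *\<^sub>R (J h f - h *\<^sub>R A (J h f))"
    using assms by (simp add: A_scale J_in_D algebra_simps)
  then show "c *\<^sub>R J h f - h *\<^sub>R A (c *\<^sub>R J h f) = c *\<^sub>R f" using assms by (simp add: J_eq)
qed

lemma J_diff:
  assumes "f \<in> H" "g \<in> H" "0 < h" shows "J h (f - g) = J h f - J h g"
  using J_add[of f "(-1) *\<^sub>R g" h] J_scale[of g h "-1"] assms H_scale[of g "-1"] by simp

text \<open>The resolvent equation reads A (J h x) = (J h x - x) / h, and for \<open>x\<close> in
  \<open>D\<close> the right-hand side is again in \<open>D\<close>: resolvents gain one power of
  the domain. Applying A to the equation then shows that they commute with A.\<close>

lemma J_D: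
  assumes "x \<in> D" "0 < h"
  shows "A (J h x) \<in> D" "A (J h x) = J h (A x)"
proof -
  have xH: "x \<in> H" using assms D_subset by blast
  have eq: "A (J h x) = (1 / h) *\<^sub>R (J h x - x)"
  proof -
    have "h *\<^sub>R A (J h x) = J h x - x" using J_eq[OF xH assms(2)] by (metis diff_diff_eq2 add_diff_cancel_left')
    then have "(1 / h) *\<^sub>R (h *\<^sub>R A (J h x)) = (1 / h) *\<^sub>R (J h x - x)" by simp
    then show ?thesis using assms(2) by simp
  qed
  show *: "A (J h x) \<in> D" unfolding eq
    by (intro D_scale D_diff J_in_D xH assms)
  have "A (J h x) - h *\<^sub>R A (A (J h x)) = A (J h x - h *\<^sub>R A (J h x))"
    using * J_in_D[OF xH assms(2)] by (simp add: A_diff A_scale D_scale)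
  also have "\<dots> = A x" by (simp add: J_eq xH assms)
  finally show "A (J h x) = J h (A x)" using J_unique[OF * _ assms(2)] by metis
qed

lemma J_minus_id: "x \<in> D \<Longrightarrow> 0 < h \<Longrightarrow> J h x - x = h *\<^sub>R J h (A x)"
  using J_eq[of x h] J_D(2)[of x h] D_subset by (auto simp: algebra_simps subset_iff)

lemma J_near_id:
  assumes "x \<in> D" "0 < h" shows "norm (J h x - x) \<le> h * norm (A x)"
  using J_minus_id[OF assms] J_norm[of "A x" h] assms A_in by (simp add: mult_left_mono)

lemma iter_in_H: "x \<in> H \<Longrightarrow> 0 < h \<Longrightarrow> (J h ^^ n) x \<in> H"
  by (induction n) (auto simp: J_in_H)

lemma iter_norm: "x \<in> H \<Longrightarrow> 0 < h \<Longrightarrow> norm ((J h ^^ n) x) \<le> norm x"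
  by (induction n) (auto simp: iter_in_H intro: order_trans[OF J_norm])

lemma iter_add:
  "x \<in> H \<Longrightarrow> y \<in> H \<Longrightarrow> 0 < h \<Longrightarrow> (J h ^^ n) (x + y) = (J h ^^ n) x + (J h ^^ n) y"
  by (induction n) (auto simp: iter_in_H J_add)

lemma iter_diff:
  "x \<in> H \<Longrightarrow> y \<in> H \<Longrightarrow> 0 < h \<Longrightarrow> (J h ^^ n) (x - y) = (J h ^^ n) x - (J h ^^ n) y"
  by (induction n) (auto simp: iter_in_H J_diff)

lemma iter_scale: "x \<in> H \<Longrightarrow> 0 < h \<Longrightarrow> (J h ^^ n) (c *\<^sub>R x) = c *\<^sub>R (J h ^^ n) x"
  by (induction n) (auto simp: iter_in_H J_scale)

lemma iter_dist:
  assumes "x \<in> H" "y \<in> H" "0 < h"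
  shows "norm ((J h ^^ n) x - (J h ^^ n) y) \<le> norm (x - y)"
  using iter_norm[of "x - y" h n] iter_diff[of x y h n] assms H_diff by simp

text \<open>Contractivity moves the comparison of two late iterates back to time zero. With
  \<open>k\<close> = 1 this pays for the off-by-one differences between step counts produced by
  rounding.\<close>

lemma iter_shift:
  assumes "x \<in> H" "0 < h"
  shows "norm ((J h ^^ (n + k)) x - (J h ^^ n) x) \<le> norm ((J h ^^ k) x - x)"
  using iter_dist[of "(J h ^^ k) x" x h n] assms iter_in_H by (simp add: funpow_add)

lemma iter_near_id:
  assumes "x \<in> D" "0 < h"
  shows "norm ((J h ^^ n) x - x) \<le> n * h * norm (A x)"
proof (induction n)
  case (Suc n)
  have xH: "x \<in> H" using assms D_subset by blast
  have "norm ((J h ^^ Suc n) x - x) \<le> norm ((J h ^^ (n + 1)) x - (J h ^^ n) x) + norm ((J h ^^ n) x - x)"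
    using norm_triangle_ineq[of "(J h ^^ (n + 1)) x - (J h ^^ n) x" "(J h ^^ n) x - x"] by simp
  also have "\<dots> \<le> h * norm (A x) + n * h * norm (A x)"
    using iter_shift[OF xH assms(2), of n 1] J_near_id[OF assms] Suc by simp
  finally show ?case by (simp add: algebra_simps)
qed simp

text \<open>Linear growth in time is available on \<open>D\<close> only, so \<open>y\<close> is
  exchanged for a nearby \<open>z\<close>; the exchange is charged twice, once for the iterate and
  once for the vector.\<close>

lemma iter_near_id_approx:
  assumes "y \<in> H" "z \<in> D" "0 < h"
  shows "norm ((J h ^^ n) y - y) \<le> 2 * norm (y - z) + n * h * norm (A z)"
proof -
  have zH: "z \<in> H" using assms D_subset by blast
  have "(J h ^^ n) y - y = ((J h ^^ n) y - (J h ^^ n) z) + ((J h ^^ n) z - z) + (z - y)" by simp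
  then have "norm ((J h ^^ n) y - y) \<le>
      norm ((J h ^^ n) y - (J h ^^ n) z) + norm ((J h ^^ n) z - z) + norm (z - y)"
    by (metis norm_triangle_ineq norm_triangle_le add_mono order_refl)
  then show ?thesis
    using iter_dist[OF assms(1) zH assms(3), of n] iter_near_id[OF assms(2,3), of n]
    by (simp add: norm_minus_commute)
qed

text \<open>The step from m to m + 1 adds h J^(m+1) (A x), which should be h A x. Since A x need not
  lie in \<open>D\<close>, its displacement is estimated through \<open>z\<close> in
  \<open>D\<close>. The bound depends on \<open>n\<close> and \<open>h\<close> only through the
  elapsed time n h, so it survives the limit.\<close>

lemma iter_taylor:
  assumes "x \<in> D" "z \<in> D" "0 < h"
  shows "norm ((J h ^^ n) x - x - (n * h) *\<^sub>R A x)
    \<le> n * h * (2 * norm (A x - z) + n * h * norm (A z))"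
proof -
  have xH: "x \<in> H" using assms D_subset by blast
  have Ax: "A x \<in> H" using assms A_in by blast
  let ?c = "2 * norm (A x - z) + n * h * norm (A z)"
  have "norm ((J h ^^ m) x - x - (m * h) *\<^sub>R A x) \<le> m * h * ?c" if "m \<le> n" for m
    using that
  proof (induction m)
    case (Suc m)
    have "(J h ^^ Suc m) x - (J h ^^ m) x = (J h ^^ m) (J h x - x)"
      using iter_diff[of "J h x" x h m] xH assms(3) J_in_H by (simp add: funpow_swap1)
    also have "\<dots> = h *\<^sub>R (J h ^^ Suc m) (A x)"
      using J_minus_id[OF assms(1,3)] iter_scale[of "J h (A x)" h m h] Ax assms(3) J_in_H
      by (simp add: funpow_swap1)
    finally have step: "(J h ^^ Suc m) x - x - (Suc m * h) *\<^sub>R A x =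
        ((J h ^^ m) x - x - (m * h) *\<^sub>R A x) + h *\<^sub>R ((J h ^^ Suc m) (A x) - A x)"
      by (simp add: algebra_simps)
    have "norm ((J h ^^ Suc m) (A x) - A x) \<le> 2 * norm (A x - z) + Suc m * h * norm (A z)"
      by (rule iter_near_id_approx[OF Ax assms(2,3)])
    also have "\<dots> \<le> ?c" using Suc.prems assms(3)
      by (intro add_left_mono mult_right_mono) (auto simp del: of_nat_Suc)
    finally have "norm (h *\<^sub>R ((J h ^^ Suc m) (A x) - A x)) \<le> h * ?c"
      using assms(3) by (simp del: funpow.simps)
    then have "norm ((J h ^^ Suc m) x - x - (Suc m * h) *\<^sub>R A x) \<le> m * h * ?c + h * ?c"
      unfolding step using Suc by (intro norm_triangle_le add_mono) auto
    then show ?case by (simp add: algebra_simps)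
  qed simp
  from this[of n] show ?thesis by simp
qed

text \<open>For y = J (2k) x the identity (1 - k A)^2 y = (1 - 2k A) y + k^2 A^2 y = x + k^2 A^2 y
  can be inverted by two resolvents of step k, which leaves y - J k (J k x) = k^2 J k (J k (A^2 y)).
  The last vector is bounded because A^2 y = J (2k) (A^2 x).\<close>

lemma halving_step:
  assumes "x \<in> D" "A x \<in> D" "0 < k"
  shows "norm (J (2 * k) x - J k (J k x)) \<le> k\<^sup>2 * norm (A (A x))"
proof -
  let ?y = "J (2 * k) x"
  have xH: "x \<in> H" using assms D_subset by blast
  have k2: "0 < 2 * k" using assms by simp
  have y: "?y \<in> D" "A ?y \<in> D" "A (A ?y) = J (2 * k) (A (A x))"
    using J_in_D[OF xH k2] J_D[OF assms(1) k2] J_D[OF assms(2) k2] by auto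
  have "(?y - k *\<^sub>R A ?y) - k *\<^sub>R A (?y - k *\<^sub>R A ?y) = (?y - (2 * k) *\<^sub>R A ?y) + k\<^sup>2 *\<^sub>R A (A ?y)"
  proof -
    have "A (?y - k *\<^sub>R A ?y) = A ?y - k *\<^sub>R A (A ?y)"
      using y by (simp only: A_diff A_scale D_scale)
    then show ?thesis by (simp only: euler_square)
  qed
  then have fact: "(?y - k *\<^sub>R A ?y) - k *\<^sub>R A (?y - k *\<^sub>R A ?y) = x + k\<^sup>2 *\<^sub>R A (A ?y)"
    by (simp only: J_eq[OF xH k2])
  have H1: "A (A ?y) \<in> H" using y A_in by blast
  have "J k (x + k\<^sup>2 *\<^sub>R A (A ?y)) = ?y - k *\<^sub>R A ?y"
    using fact y assms(3) by (intro J_unique D_diff D_scale) auto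
  then have "J k (J k (x + k\<^sup>2 *\<^sub>R A (A ?y))) = ?y"
    using y assms(3) by (intro J_unique) auto
  then have "J k (J k x) + k\<^sup>2 *\<^sub>R J k (J k (A (A ?y))) = ?y"
    using xH H1 assms(3) by (simp add: J_add J_scale H_scale J_in_H)
  then have "?y - J k (J k x) = k\<^sup>2 *\<^sub>R J k (J k (A (A ?y)))"
    by (metis add_diff_cancel_left')
  also have "norm \<dots> \<le> k\<^sup>2 * norm (A (A ?y))"
    using J_norm[of "J k (A (A ?y))" k] J_norm[of "A (A ?y)" k] H1 assms(3) J_in_H
    by (simp add: mult_left_mono)
  also have "\<dots> \<le> k\<^sup>2 * norm (A (A x))"
    using y(3) J_norm[of "A (A x)" "2 * k"] A_in[OF assms(2)] k2 by (simp add: mult_left_mono)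
  finally show ?thesis .
qed

text \<open>Each double step costs at most k^2 c, and contractions do not amplify earlier errors.
  The bound \<open>c\<close> is kept apart from \<open>x\<close> so that the induction can move on
  to J k (J k x): A A commutes with the resolvents, so its norm can only decrease there.\<close>

lemma halving_iter:
  assumes "x \<in> D" "A x \<in> D" "0 < k" "norm (A (A x)) \<le> c"
  shows "norm ((J (2 * k) ^^ n) x - (J k ^^ (2 * n)) x) \<le> n * k\<^sup>2 * c"
  using assms
proof (induction n arbitrary: x)
  case (Suc n)
  have xH: "x \<in> H" using Suc.prems D_subset by blast
  have k2: "0 < 2 * k" using Suc.prems by simp
  let ?q = "J k (J k x)"
  have q1: "J k x \<in> D" "A (J k x) = J k (A x)" "A (J k x) \<in> D" 
    using J_in_D[OF xH Suc.prems(3)] J_D[OF Suc.prems(1,3)] by auto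
  have AxD: "A (A (J k x)) = J k (A (A x))"
    unfolding q1 using J_D[OF Suc.prems(2,3)] by auto
  have q: "?q \<in> D" "A ?q = J k (A (J k x))" "A ?q \<in> D"
    using J_in_D[of "J k x" k] J_D[OF q1(1) Suc.prems(3)] q1 D_subset Suc.prems(3) by auto
  have AAq: "A (A ?q) = J k (J k (A (A x)))"
    unfolding q(2) using J_D[OF q1(3) Suc.prems(3)] AxD by simp
  have AAx: "A (A x) \<in> H" using A_in[OF Suc.prems(2)] .
  have "norm (A (A ?q)) \<le> norm (A (A x))"
    unfolding AAq using J_norm[of "J k (A (A x))" k] J_norm[of "A (A x)" k] AAx Suc.prems(3) J_in_H
    by fastforce
  then have IH: "norm ((J (2 * k) ^^ n) ?q - (J k ^^ (2 * n)) ?q) \<le> n * k\<^sup>2 * c"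
    using Suc q by auto
  have 1: "norm ((J (2 * k) ^^ n) (J (2 * k) x) - (J (2 * k) ^^ n) ?q) \<le> k\<^sup>2 * c"
  proof -
    have "norm ((J (2 * k) ^^ n) (J (2 * k) x) - (J (2 * k) ^^ n) ?q) \<le> norm (J (2 * k) x - ?q)"
      using J_in_H[OF xH k2] q(1) D_subset k2 by (intro iter_dist) auto
    also have "\<dots> \<le> k\<^sup>2 * norm (A (A x))" by (rule halving_step[OF Suc.prems(1-3)])
    also have "\<dots> \<le> k\<^sup>2 * c" by (rule mult_left_mono[OF Suc.prems(4)]) simp
    finally show ?thesis .
  qed
  have split: "(J (2 * k) ^^ Suc n) x - (J k ^^ (2 * Suc n)) x =
      ((J (2 * k) ^^ n) (J (2 * k) x) - (J (2 * k) ^^ n) ?q)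
      + ((J (2 * k) ^^ n) ?q - (J k ^^ (2 * n)) ?q)"
    by (simp add: funpow_swap1)
  have "norm ((J (2 * k) ^^ Suc n) x - (J k ^^ (2 * Suc n)) x) \<le> k\<^sup>2 * c + n * k\<^sup>2 * c"
    unfolding split by (rule order_trans[OF norm_triangle_ineq add_mono[OF 1 IH]])
  then show ?case by (simp add: algebra_simps)
qed simp


section \<open>The limit of the dyadic Euler scheme\<close>

definition euler :: "nat \<Rightarrow> real \<Rightarrow> 'e \<Rightarrow> 'e" where
  "euler n t x = (J ((1/2) ^ n) ^^ nat \<lfloor>t * 2 ^ n\<rfloor>) x"

definition T :: "real \<Rightarrow> 'e \<Rightarrow> 'e" where
  "T t x = lim (\<lambda>n. euler n t x)"

lemma euler_in_H: "x \<in> H \<Longrightarrow> euler n t x \<in> H"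
  and euler_norm: "x \<in> H \<Longrightarrow> norm (euler n t x) \<le> norm x"
  and euler_add: "x \<in> H \<Longrightarrow> y \<in> H \<Longrightarrow> euler n t (x + y) = euler n t x + euler n t y"
  and euler_scale: "x \<in> H \<Longrightarrow> euler n t (c *\<^sub>R x) = c *\<^sub>R euler n t x"
  and euler_dist: "x \<in> H \<Longrightarrow> y \<in> H \<Longrightarrow> norm (euler n t x - euler n t y) \<le> norm (x - y)"
  by (simp_all add: euler_def iter_in_H iter_norm iter_add iter_scale iter_dist)

lemma grid_time:
  assumes "0 \<le> t"
  shows "real (nat \<lfloor>t * 2 ^ n\<rfloor>) * (1/2) ^ n \<le> t" "t - (1/2) ^ n \<le> real (nat \<lfloor>t * 2 ^ n\<rfloor>) * (1/2) ^ n"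
proof -
  let ?m = "real (nat \<lfloor>t * 2 ^ n\<rfloor>)"
  have "?m = of_int \<lfloor>t * 2 ^ n\<rfloor>" using assms by simp
  then have "?m \<le> t * 2 ^ n" "t * 2 ^ n - 1 \<le> ?m" by linarith+
  then have "?m * (1/2) ^ n \<le> (t * 2 ^ n) * (1/2) ^ n" "(t * 2 ^ n - 1) * (1/2) ^ n \<le> ?m * (1/2) ^ n"
    by (intro mult_right_mono; simp)+
  moreover have "(t * 2 ^ n) * (1/2) ^ n = t" by (simp add: power_one_over)
  ultimately show "?m * (1/2) ^ n \<le> t" "t - (1/2) ^ n \<le> ?m * (1/2) ^ n"
    by (simp_all add: left_diff_distrib)
qed

text \<open>Two sources of error: m halvings cost m k^2 |A A x| with 2 m k at most t, and since the
  floor of 2 s is twice the floor of s or one more, the fine scheme may take one further step,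
  costing k |A x|. The geometric factor makes the differences summable.\<close>

lemma euler_refine:
  assumes "x \<in> D" "A x \<in> D" "0 \<le> t"
  shows "norm (euler n t x - euler (Suc n) t x) \<le> (t * norm (A (A x)) + norm (A x)) * (1/2) ^ n"
proof -
  define k where "k = (1/2 :: real) ^ Suc n"
  have k: "0 < k" "(1/2) ^ n = 2 * k" by (simp_all add: k_def)
  define m where "m = nat \<lfloor>t * 2 ^ n\<rfloor>"
  define m' where "m' = nat \<lfloor>t * 2 ^ Suc n\<rfloor>"
  have xH: "x \<in> H" using assms D_subset by blast
  have "\<lfloor>t * 2 ^ Suc n\<rfloor> = 2 * \<lfloor>t * 2 ^ n\<rfloor> \<or> \<lfloor>t * 2 ^ Suc n\<rfloor> = 2 * \<lfloor>t * 2 ^ n\<rfloor> + 1"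
    by (simp add: algebra_simps) linarith
  moreover have "0 \<le> \<lfloor>t * 2 ^ n\<rfloor>" using assms by simp
  ultimately have "m' = 2 * m \<or> m' = 2 * m + 1" unfolding m_def m'_def by linarith
  then have 1: "norm ((J k ^^ (2 * m)) x - (J k ^^ m') x) \<le> k * norm (A x)"
    using iter_shift[OF xH k(1), of "2 * m" 1] J_near_id[OF assms(1) k(1)] k(1)
    by (auto simp: norm_minus_commute)
  have "real m * (2 * k) \<le> t" using grid_time(1)[OF assms(3), of n] by (simp add: m_def k(2))
  then have half: "real m * (2 * k) * k * norm (A (A x)) \<le> t * k * norm (A (A x))" 
    using k(1) by (intro mult_right_mono) auto
  have 2: "m * k\<^sup>2 * norm (A (A x)) \<le> t * k * norm (A (A x))"
  proof -
    have "real m * (2 * k) * k * norm (A (A x)) = 2 * (m * k\<^sup>2 * norm (A (A x)))"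
      by (simp add: power2_eq_square)
    moreover have "0 \<le> m * k\<^sup>2 * norm (A (A x))" by simp
    ultimately show ?thesis using half by linarith
  qed
  have "norm ((J (2 * k) ^^ m) x - (J k ^^ (2 * m)) x) \<le> t * k * norm (A (A x))"
    using halving_iter[OF assms(1,2) k(1) order_refl, of m] 2 by linarith
  then have "norm ((J (2 * k) ^^ m) x - (J k ^^ m') x) \<le> t * k * norm (A (A x)) + k * norm (A x)"
    using 1 by (rule norm_diff_triangle_le)
  also have "\<dots> \<le> (t * norm (A (A x)) + norm (A x)) * (2 * k)"
    using k(1) assms(3) by (simp add: algebra_simps)
  finally show ?thesis by (simp only: euler_def k(2) m_def m'_def k_def)
qed

text \<open>\<open>J h y\<close> lies in the domain of the square as soon as \<open>y\<close> is in
  \<open>D\<close>, and tends to \<open>y\<close> as \<open>h\<close> tends to 0. The choice of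
  \<open>h\<close> makes h |A y| less than e / 2, the added 1 guarding against A y = 0.\<close>

lemma dense_D2:
  assumes "x \<in> H" "0 < e"
  obtains z where "z \<in> D" "A z \<in> D" "norm (x - z) < e"
proof -
  obtain y where y: "y \<in> D" "norm (x - y) < e / 2"
    using approx_D[of x "e / 2"] assms by auto
  define h where "h = e / (2 * (norm (A y) + 1))"
  have h: "0 < h" using assms by (simp add: h_def add_nonneg_pos)
  have "h * norm (A y) < h * (norm (A y) + 1)" using h by simp
  also have "\<dots> = e / 2" using norm_ge_zero[of "A y"] by (simp add: h_def field_simps add_nonneg_eq_0_iff)
  finally have "norm (J h y - y) < e / 2" using J_near_id[OF y(1) h] by linarith
  then have "norm (x - J h y) < e" using y(2) by norm
  then show ?thesis using that[of "J h y"] J_in_D[of y h] J_D(1)[OF y(1) h] y(1) D_subset h by auto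
qed

text \<open>On the domain of the square the successive differences are dominated by a geometric
  series and telescope. Since all schemes are nonexpansive, the Cauchy property passes from this
  dense set to \<open>H\<close> with an error of a third at each exchange.\<close>

lemma euler_convergent:
  assumes "x \<in> H" "0 \<le> t"
  shows "convergent (\<lambda>n. euler n t x)"
proof -
  have conv: "convergent (\<lambda>n. euler n t z)" if z: "z \<in> D" "A z \<in> D" for z
  proof -
    have "summable (\<lambda>n. (t * norm (A (A z)) + norm (A z)) * (1/2 :: real) ^ n)"
      by (intro summable_mult summable_geometric) simp
    then have "summable (\<lambda>n. euler n t z - euler (Suc n) t z)"
      by (rule summable_comparison_test') (rule euler_refine[OF z assms(2)])
    then have "summable (\<lambda>n. - (euler n t z - euler (Suc n) t z))" by (rule summable_minus)
    then have "summable (\<lambda>n. euler (Suc n) t z - euler n t z)" by simp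
    then have "convergent (\<lambda>n. \<Sum>i<n. euler (Suc i) t z - euler i t z)"
      by (simp add: summable_iff_convergent)
    then have "convergent (\<lambda>n. (\<Sum>i<n. euler (Suc i) t z - euler i t z) + euler 0 t z)"
      by (intro convergent_add convergent_const)
    then show ?thesis by (simp add: sum_lessThan_telescope[of "\<lambda>i. euler i t z"])
  qed
  have "Cauchy (\<lambda>n. euler n t x)"
  proof (rule metric_CauchyI)
    fix e :: real assume e: "0 < e"
    obtain z where z: "z \<in> D" "A z \<in> D" "norm (x - z) < e / 3" using dense_D2[of x "e / 3"] e assms by auto
    have zH: "z \<in> H" using z D_subset by auto
    have "Cauchy (\<lambda>n. euler n t z)" using conv[OF z(1,2)] by (rule convergent_Cauchy)
    then obtain M where M: "\<And>m n. m \<ge> M \<Longrightarrow> n \<ge> M \<Longrightarrow> dist (euler m t z) (euler n t z) < e / 3"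
      using metric_CauchyD[of _ "e / 3"] e by (metis divide_pos_pos zero_less_numeral)
    have "dist (euler m t x) (euler n t x) < e" if "m \<ge> M" "n \<ge> M" for m n
      using M[OF that] euler_dist[OF assms(1) zH, of m t] euler_dist[OF assms(1) zH, of n t] z(3)
      unfolding dist_norm by norm
    then show "\<exists>M. \<forall>m\<ge>M. \<forall>n\<ge>M. dist (euler m t x) (euler n t x) < e" by blast
  qed
  then show ?thesis by (rule Cauchy_convergent)
qed

lemma T_lim: "x \<in> H \<Longrightarrow> 0 \<le> t \<Longrightarrow> (\<lambda>n. euler n t x) \<longlonglongrightarrow> T t x"
  unfolding T_def using euler_convergent convergent_LIMSEQ_iff by blast

lemma T_in_H: "x \<in> H \<Longrightarrow> 0 \<le> t \<Longrightarrow> T t x \<in> H"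
  using closed_sequentially[OF closed_H, of "\<lambda>n. euler n t x"] T_lim euler_in_H by blast

lemma T_norm: "x \<in> H \<Longrightarrow> 0 \<le> t \<Longrightarrow> norm (T t x) \<le> norm x"
  by (rule tendsto_upperbound[OF tendsto_norm[OF T_lim]]) (auto simp: euler_norm)

lemma T_add: "x \<in> H \<Longrightarrow> y \<in> H \<Longrightarrow> 0 \<le> t \<Longrightarrow> T t (x + y) = T t x + T t y"
  using LIMSEQ_unique[OF T_lim[of "x + y" t]] tendsto_add[OF T_lim[of x t] T_lim[of y t]]
  by (simp add: H_add euler_add)

lemma T_scale: "x \<in> H \<Longrightarrow> 0 \<le> t \<Longrightarrow> T t (c *\<^sub>R x) = c *\<^sub>R T t x"
  using LIMSEQ_unique[OF T_lim[of "c *\<^sub>R x" t]] tendsto_scaleR[OF tendsto_const T_lim[of x t], of c]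
  by (simp add: H_scale euler_scale)

lemma T_diff: "x \<in> H \<Longrightarrow> y \<in> H \<Longrightarrow> 0 \<le> t \<Longrightarrow> T t (x - y) = T t x - T t y"
  using T_add[of x "(-1) *\<^sub>R y" t] T_scale[of y t "-1"] H_scale[of y "-1"] by simp

lemma T_0: "x \<in> H \<Longrightarrow> T 0 x = x"
  unfolding T_def by (simp add: euler_def)

lemma J_tendsto_id:
  assumes "x \<in> H"
  shows "(\<lambda>n. J ((1/2) ^ n) x) \<longlonglongrightarrow> x"
proof (rule LIMSEQ_I)
  fix e :: real assume e: "0 < e"
  obtain z where z: "z \<in> D" "norm (x - z) < e / 4" using approx_D[of x "e / 4"] e assms by auto
  have zH: "z \<in> H" using z D_subset by auto
  have "(\<lambda>n. (1/2) ^ n * norm (A z)) \<longlonglongrightarrow> 0 * norm (A z)"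
    by (intro tendsto_mult LIMSEQ_realpow_zero tendsto_const) auto
  then obtain N where N: "\<And>n. n \<ge> N \<Longrightarrow> (1/2) ^ n * norm (A z) < e / 4"
    using LIMSEQ_D[of _ 0 "e / 4"] e by fastforce
  have "norm (J ((1/2) ^ n) x - x) < e" if "n \<ge> N" for n
  proof -
    have "norm (J ((1/2) ^ n) x - x) \<le> 2 * norm (x - z) + (1/2) ^ n * norm (A z)"
      using iter_near_id_approx[OF assms z(1), of "(1/2) ^ n" 1] by simp
    then show ?thesis using N[OF that] z(2) e by linarith
  qed
  then show "\<exists>N. \<forall>n\<ge>N. norm (J ((1/2) ^ n) x - x) < e" by blast
qed

text \<open>At fixed \<open>n\<close> the scheme is not a semigroup: the rounded numbers of steps
  for \<open>s\<close> and \<open>t\<close> can fall one short of the number for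
  \<open>s + t\<close>. The defect is a single step of length 2^-n, which tends to the identity on
  each vector.\<close>

lemma T_semigroup:
  assumes "x \<in> H" "0 \<le> s" "0 \<le> t"
  shows "T (s + t) x = T s (T t x)"
proof -
  have "(\<lambda>n. euler n (s + t) x - euler n s (euler n t x)) \<longlonglongrightarrow> 0"
  proof (rule Lim_null_comparison)
    show "(\<lambda>n. norm (J ((1/2) ^ n) x - x)) \<longlonglongrightarrow> 0"
      using tendsto_norm[OF LIM_zero[OF J_tendsto_id[OF assms(1)]]] by simp
    show "\<forall>\<^sub>F n in sequentially. norm (euler n (s + t) x - euler n s (euler n t x)) \<le> norm (J ((1/2) ^ n) x - x)"
    proof (rule always_eventually, rule allI)
      fix n
      define p q r where "p = nat \<lfloor>s * 2 ^ n\<rfloor>" and "q = nat \<lfloor>t * 2 ^ n\<rfloor>" and "r = nat \<lfloor>(s + t) * 2 ^ n\<rfloor>"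
      have "\<lfloor>(s + t) * 2 ^ n\<rfloor> = \<lfloor>s * 2 ^ n\<rfloor> + \<lfloor>t * 2 ^ n\<rfloor> \<or> \<lfloor>(s + t) * 2 ^ n\<rfloor> = \<lfloor>s * 2 ^ n\<rfloor> + \<lfloor>t * 2 ^ n\<rfloor> + 1"
        by (simp add: algebra_simps) linarith
      moreover have "0 \<le> \<lfloor>s * 2 ^ n\<rfloor>" "0 \<le> \<lfloor>t * 2 ^ n\<rfloor>" using assms by auto
      ultimately have "r = p + q \<or> r = p + q + 1" unfolding p_def q_def r_def by linarith
      then show "norm (euler n (s + t) x - euler n s (euler n t x)) \<le> norm (J ((1/2) ^ n) x - x)"
        using iter_shift[OF assms(1), of "(1/2) ^ n" "p + q" 1]
        unfolding euler_def p_def[symmetric] q_def[symmetric] r_def[symmetric]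
        by (auto simp: funpow_add)
    qed
  qed
  \<comment> \<open>Operator and argument both vary with \<open>n\<close>; nonexpansiveness, uniform
    in \<open>n\<close>, lets the argument be replaced by its limit first.\<close>
  moreover have "(\<lambda>n. euler n s (euler n t x) - euler n s (T t x)) \<longlonglongrightarrow> 0"
  proof (rule Lim_null_comparison)
    show "(\<lambda>n. norm (euler n t x - T t x)) \<longlonglongrightarrow> 0"
      using tendsto_norm[OF LIM_zero[OF T_lim[OF assms(1,3)]]] by simp
  qed (use assms in \<open>auto intro!: always_eventually euler_dist euler_in_H T_in_H\<close>)
  ultimately have "(\<lambda>n. (euler n (s + t) x - euler n s (euler n t x)) + (euler n s (euler n t x) - euler n s (T t x)) + euler n s (T t x)) \<longlonglongrightarrow> 0 + 0 + T s (T t x)"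
    using assms by (intro tendsto_add T_lim T_in_H)
  then have "(\<lambda>n. euler n (s + t) x) \<longlonglongrightarrow> T s (T t x)" by simp
  then show ?thesis using T_lim[of x "s + t"] assms LIMSEQ_unique by auto
qed

section \<open>The generator of the limit semigroup\<close>

lemma T_taylor:
  assumes "x \<in> D" "z \<in> D" "0 \<le> t"
  shows "norm (T t x - x - t *\<^sub>R A x) \<le> t * (2 * norm (A x - z) + t * norm (A z))"
proof -
  let ?r = "\<lambda>n. real (nat \<lfloor>t * 2 ^ n\<rfloor>) * (1/2) ^ n"
  have xH: "x \<in> H" using assms D_subset by auto
  have "(\<lambda>n. t - (1/2 :: real) ^ n) \<longlonglongrightarrow> t - 0"
    by (intro tendsto_diff tendsto_const LIMSEQ_realpow_zero) simp_all
  then have low: "(\<lambda>n. t - (1/2 :: real) ^ n) \<longlonglongrightarrow> t" by simp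
  have r: "?r \<longlonglongrightarrow> t"
    by (rule tendsto_sandwich[OF always_eventually always_eventually low tendsto_const])
      (use grid_time[OF assms(3)] in blast)+
  show ?thesis
  proof (rule tendsto_le[OF _ _ _ ])
    show "(\<lambda>n. norm (euler n t x - x - ?r n *\<^sub>R A x)) \<longlonglongrightarrow> norm (T t x - x - t *\<^sub>R A x)"
      by (intro tendsto_intros T_lim xH assms r)
    show "(\<lambda>n. ?r n * (2 * norm (A x - z) + ?r n * norm (A z))) \<longlonglongrightarrow> t * (2 * norm (A x - z) + t * norm (A z))"
      by (intro tendsto_intros r)
    show "\<forall>\<^sub>F n in sequentially. norm (euler n t x - x - ?r n *\<^sub>R A x) \<le> ?r n * (2 * norm (A x - z) + ?r n * norm (A z))"
      unfolding euler_def by (intro always_eventually allI iter_taylor assms) simp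
  qed simp
qed

lemma T_generator:
  assumes "x \<in> D"
  shows "((\<lambda>h. norm ((1 / h) *\<^sub>R (T h x - x) - A x)) \<longlongrightarrow> 0) (at_right 0)"
proof (rule tendstoI)
  fix e :: real assume e: "0 < e"
  obtain z where z: "z \<in> D" "norm (A x - z) < e / 4"
    using approx_D[of "A x" "e / 4"] e assms A_in by auto
  have "((\<lambda>h. 2 * norm (A x - z) + h * norm (A z)) \<longlongrightarrow> 2 * norm (A x - z) + 0 * norm (A z)) (at_right 0)"
    by (intro tendsto_intros)
  from order_tendstoD(2)[OF this, of e]
  have ev: "\<forall>\<^sub>F h in at_right 0. 2 * norm (A x - z) + h * norm (A z) < e"
    using z(2) e by simp
  show "\<forall>\<^sub>F h in at_right 0. dist (norm ((1 / h) *\<^sub>R (T h x - x) - A x)) 0 < e"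
    using ev eventually_at_right_less[of 0]
  proof eventually_elim
    case (elim h)
    have "(1 / h) *\<^sub>R (T h x - x) - A x = (1 / h) *\<^sub>R (T h x - x - h *\<^sub>R A x)"
      using elim by (simp add: scaleR_diff_right)
    then have "norm ((1 / h) *\<^sub>R (T h x - x) - A x) = norm (T h x - x - h *\<^sub>R A x) / h"
      using elim by simp
    also have "\<dots> \<le> 2 * norm (A x - z) + h * norm (A z)"
      using T_taylor[OF assms z(1), of h] elim by (simp add: field_simps)
    finally show ?case using elim by simp
  qed
qed

lemma T_right_continuous:
  assumes "x \<in> H"
  shows "((\<lambda>h. norm (T h x - x)) \<longlongrightarrow> 0) (at_right 0)"
proof (rule tendstoI)
  fix e :: real assume e: "0 < e"
  obtain z where z: "z \<in> D" "norm (x - z) < e / 4"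
    using approx_D[of x "e / 4"] e assms by auto
  have zH: "z \<in> H" using z D_subset by auto
  have "((\<lambda>h. h * (2 * norm (A z - z) + h * norm (A z)) + h * norm (A z)) \<longlongrightarrow>
     0 * (2 * norm (A z - z) + 0 * norm (A z)) + 0 * norm (A z)) (at_right 0)"
    by (intro tendsto_intros)
  from order_tendstoD(2)[OF this, of "e / 4"]
  have ev: "\<forall>\<^sub>F h in at_right 0. h * (2 * norm (A z - z) + h * norm (A z)) + h * norm (A z) < e / 4"
    using e by simp
  show "\<forall>\<^sub>F h in at_right 0. dist (norm (T h x - x)) 0 < e"
    using ev eventually_at_right_less[of 0]
  proof eventually_elim
    case (elim h)
    have "norm (T h x - T h z) \<le> norm (x - z)"
      using T_norm[of "x - z" h] T_diff[of x z h] assms zH elim H_diff by simp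
    moreover have "norm (h *\<^sub>R A z) = h * norm (A z)" using elim by simp
    moreover have "norm (T h x - x) \<le> norm (T h x - T h z) + norm (T h z - z - h *\<^sub>R A z) + norm (h *\<^sub>R A z) + norm (z - x)"
      using norm_triangle_ineq[of "(T h x - T h z) + (T h z - z - h *\<^sub>R A z) + h *\<^sub>R A z" "z - x"]
        norm_triangle_ineq[of "(T h x - T h z) + (T h z - z - h *\<^sub>R A z)" "h *\<^sub>R A z"]
        norm_triangle_ineq[of "T h x - T h z" "T h z - z - h *\<^sub>R A z"] by simp
    ultimately have "norm (T h x - x) < e"
      using T_taylor[OF z(1) z(1) less_imp_le[OF elim(2)]] elim z(2) e norm_minus_commute[of x z] by linarith
    then show ?case by simp
  qed
qed

text \<open>A generator cannot properly extend \<open>A\<close>, because 1 - A is already onto. Take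
  \<open>y\<close> in \<open>D\<close> with y - A y = x - w; then the orbit of d = x - y has right
  derivative d at 0. An orbit starting like (1 + h) d contradicts contractivity unless d =
  0.\<close>

lemma T_generator_converse:
  assumes "x \<in> H" "w \<in> H"
    and lim: "((\<lambda>h. norm ((1 / h) *\<^sub>R (T h x - x) - w)) \<longlongrightarrow> 0) (at_right 0)"
  shows "x \<in> D" "A x = w"
proof -
  define y where "y = J 1 (x - w)"
  have y: "y \<in> D" "y - A y = x - w"
    using J_in_D[of "x - w" 1] J_eq[of "x - w" 1] assms H_diff by (auto simp: y_def)
  have yH: "y \<in> H" "A y \<in> H" using y D_subset A_in by auto
  define d where "d = x - y"
  have d: "d \<in> H" "d = w - A y" using y assms yH H_diff by (auto simp: d_def algebra_simps)
  have "((\<lambda>h. norm ((1 / h) *\<^sub>R (T h x - x) - w) + norm ((1 / h) *\<^sub>R (T h y - y) - A y)) \<longlongrightarrow> 0 + 0) (at_right 0)"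
    by (intro tendsto_add lim T_generator y)
  note lim2 = this
  have "d = 0"
  proof (rule ccontr)
    assume nz: "d \<noteq> 0"
    from order_tendstoD(2)[OF lim2, of "norm d"]
    have "\<forall>\<^sub>F h in at_right 0. norm ((1 / h) *\<^sub>R (T h x - x) - w) + norm ((1 / h) *\<^sub>R (T h y - y) - A y) < norm d \<and> 0 < h"
      using nz by (intro eventually_conj eventually_at_right_less) auto
    then obtain h where elim: "norm ((1 / h) *\<^sub>R (T h x - x) - w) + norm ((1 / h) *\<^sub>R (T h y - y) - A y) < norm d" "0 < h"
      using eventually_happens'[OF trivial_limit_at_right_real] by blast
    have False
    proof -
      have "(1 / h) *\<^sub>R (T h d - d) - d = ((1 / h) *\<^sub>R (T h x - x) - w) - ((1 / h) *\<^sub>R (T h y - y) - A y)"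
      proof -
        have Td: "T h d = T h x - T h y" unfolding d_def using elim T_diff[of x y h] assms yH by simp
        have "(1 / h) *\<^sub>R (T h d - d) = (1 / h) *\<^sub>R (T h x - x) - (1 / h) *\<^sub>R (T h y - y)"
          unfolding Td scaleR_diff_right unfolding d_def scaleR_diff_right by simp
        then show ?thesis using d(2) by simp
      qed
      then have "norm ((1 / h) *\<^sub>R (T h d - d) - d) < norm d"
        using elim norm_triangle_ineq4[of "(1 / h) *\<^sub>R (T h x - x) - w" "(1 / h) *\<^sub>R (T h y - y) - A y"] by simp
      then have "h * norm ((1 / h) *\<^sub>R (T h d - d) - d) < h * norm d" using elim by simp
      moreover have "h * norm ((1 / h) *\<^sub>R (T h d - d) - d) = norm (T h d - d - h *\<^sub>R d)"
      proof -
        have "h *\<^sub>R ((1 / h) *\<^sub>R (T h d - d) - d) = T h d - d - h *\<^sub>R d"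
          using elim by (simp add: scaleR_diff_right)
        then show ?thesis using elim by (metis norm_scaleR abs_of_pos)
      qed
      moreover have "norm (d + h *\<^sub>R d) = (1 + h) * norm d"
        using elim norm_scaleR[of "1 + h" d] by (simp add: scaleR_left_distrib)
      moreover have "norm (T h d) \<le> norm d" using T_norm d elim by simp
      moreover have "norm (d + h *\<^sub>R d) \<le> norm (T h d) + norm (T h d - d - h *\<^sub>R d)"
        using norm_triangle_ineq4[of "T h d" "T h d - d - h *\<^sub>R d"] by (simp add: add.commute)
      ultimately show False by (simp add: algebra_simps)
    qed
    then show False .
  qed
  then show "x \<in> D" "A x = w" using y by (auto simp: d_def d(2)[symmetric])
qed

end

section \<open>Hilbert spaces of representatives\<close>

lemma subspace_closure:
  fixes S :: "'e::real_normed_vector set"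
  assumes "subspace S" shows "subspace (closure S)"
  unfolding subspace_def
proof (intro conjI ballI allI)
  show "0 \<in> closure S" using assms closure_subset subspace_0 by blast
next
  fix x y assume "x \<in> closure S" "y \<in> closure S"
  then obtain f g where "\<And>n. f n \<in> S" "f \<longlonglongrightarrow> x" "\<And>n. g n \<in> S" "g \<longlonglongrightarrow> y"
    unfolding closure_sequential by blast
  then have "(\<lambda>n. f n + g n) \<longlonglongrightarrow> x + y" "\<And>n. f n + g n \<in> S"
    using assms by (auto intro: tendsto_add subspace_add)
  then show "x + y \<in> closure S" unfolding closure_sequential by (intro exI[of _ "\<lambda>n. f n + g n"]) simp
next
  fix c x assume "x \<in> closure S"
  then obtain f where "\<And>n. f n \<in> S" "f \<longlonglongrightarrow> x" unfolding closure_sequential by blast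
  then have "(\<lambda>n. c *\<^sub>R f n) \<longlonglongrightarrow> c *\<^sub>R x" "\<And>n. c *\<^sub>R f n \<in> S"
    using assms by (auto intro: tendsto_intros subspace_scale)
  then show "c *\<^sub>R x \<in> closure S" unfolding closure_sequential by (intro exI[of _ "\<lambda>n. c *\<^sub>R f n"]) simp
qed

text \<open>The inner product may vanish on nonzero vectors, since vectors are functions and not
  classes. The limits in \<open>complete\<close> are accordingly determined up to null
  vectors.\<close>

locale semi_hilbert =
  fixes V :: "'v::real_vector set" and ip :: "'v \<Rightarrow> 'v \<Rightarrow> real"
  assumes subspace_V: "subspace V"
    and ip_add: "x \<in> V \<Longrightarrow> y \<in> V \<Longrightarrow> z \<in> V \<Longrightarrow> ip (x + y) z = ip x z + ip y z"
    and ip_scale: "x \<in> V \<Longrightarrow> z \<in> V \<Longrightarrow> ip (c *\<^sub>R x) z = c * ip x z"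
    and ip_sym: "x \<in> V \<Longrightarrow> y \<in> V \<Longrightarrow> ip x y = ip y x"
    and ip_nonneg: "x \<in> V \<Longrightarrow> 0 \<le> ip x x"
    and complete: "(\<And>n. X n \<in> V) \<Longrightarrow>
      (\<And>e. 0 < e \<Longrightarrow> \<exists>M. \<forall>m\<ge>M. \<forall>n\<ge>M. sqrt (ip (X m - X n) (X m - X n)) < e) \<Longrightarrow>
      \<exists>x\<in>V. (\<lambda>n. sqrt (ip (X n - x) (X n - x))) \<longlonglongrightarrow> 0"
begin

definition nrm :: "'v \<Rightarrow> real" where "nrm x = sqrt (ip x x)"

lemma V_add: "x \<in> V \<Longrightarrow> y \<in> V \<Longrightarrow> x + y \<in> V"
  and V_scale: "x \<in> V \<Longrightarrow> c *\<^sub>R x \<in> V"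
  and V_diff: "x \<in> V \<Longrightarrow> y \<in> V \<Longrightarrow> x - y \<in> V"
  and V_0: "0 \<in> V"
  using subspace_V by (auto simp: subspace_add subspace_scale subspace_diff subspace_0)

lemma ip_diff: "x \<in> V \<Longrightarrow> y \<in> V \<Longrightarrow> z \<in> V \<Longrightarrow> ip (x - y) z = ip x z - ip y z"
  using ip_add[of x "(-1) *\<^sub>R y" z] ip_scale[of y z "-1"] V_scale[of y "-1"] by simp

lemma ip_add2: "x \<in> V \<Longrightarrow> y \<in> V \<Longrightarrow> z \<in> V \<Longrightarrow> ip z (x + y) = ip z x + ip z y"
  and ip_diff2: "x \<in> V \<Longrightarrow> y \<in> V \<Longrightarrow> z \<in> V \<Longrightarrow> ip z (x - y) = ip z x - ip z y"
  and ip_scale2: "x \<in> V \<Longrightarrow> z \<in> V \<Longrightarrow> ip z (c *\<^sub>R x) = c * ip z x"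
  using ip_add[of x y z] ip_diff[of x y z] ip_scale[of x z c] ip_sym[of _ z] V_add V_diff V_scale by simp_all

lemmas ip_bilinear = ip_add ip_add2 ip_diff ip_diff2 ip_scale ip_scale2 V_add V_diff V_scale

lemma nrm_nonneg: "x \<in> V \<Longrightarrow> 0 \<le> nrm x"
  and nrm_sq: "x \<in> V \<Longrightarrow> (nrm x)\<^sup>2 = ip x x"
  by (simp_all add: nrm_def ip_nonneg)

lemma quadratic_nonneg_linear:
  fixes b c :: real
  assumes "\<And>t. 0 \<le> t * b + t\<^sup>2 * c" "0 \<le> c" shows "b = 0"
proof (rule ccontr)
  assume b: "b \<noteq> 0"
  \<comment> \<open>The denominator c + 1, in place of the minimiser's 2 c, covers c = 0 as well and
    still makes the value negative.\<close>
  let ?t = "- b / (c + 1)"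
  have "?t * b + ?t\<^sup>2 * c = - (b\<^sup>2 / (c + 1)\<^sup>2)"
    using assms(2) by (simp add: field_simps power2_eq_square add_nonneg_eq_0_iff)
  moreover have "0 < b\<^sup>2 / (c + 1)\<^sup>2" using b assms(2) by simp
  ultimately show False using assms(1)[of ?t] by linarith
qed

lemma cauchy_schwarz:
  assumes "x \<in> V" "y \<in> V" shows "\<bar>ip x y\<bar> \<le> nrm x * nrm y"
proof -
  have q: "0 \<le> ip x x + 2 * t * ip x y + t\<^sup>2 * ip y y" for t
    using ip_nonneg[of "x + t *\<^sub>R y"] assms
    by (simp add: ip_bilinear ip_sym[of y x] power2_eq_square algebra_simps)
  have "(ip x y)\<^sup>2 \<le> ip x x * ip y y"
  proof (cases "ip y y = 0")
    case True
    have "ip x y = 0"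
    proof (rule ccontr)
      assume nz: "ip x y \<noteq> 0"
      \<comment> \<open>For a null vector \<open>y\<close> the quadratic degenerates to an affine
        function of t; at this t it takes the value -1.\<close>
      have "2 * (- (ip x x + 1) / (2 * ip x y)) * ip x y = - (ip x x + 1)" using nz by simp
      then show False using q[of "- (ip x x + 1) / (2 * ip x y)"] True by simp
    qed
    then show ?thesis using True by simp
  next
    case False
    then have pos: "0 < ip y y" using ip_nonneg[OF assms(2)] by simp
    have "0 \<le> ip x x + 2 * (- ip x y / ip y y) * ip x y + (- ip x y / ip y y)\<^sup>2 * ip y y" by (rule q)
    also have "\<dots> = ip x x - (ip x y)\<^sup>2 / ip y y" using pos by (simp add: power2_eq_square field_simps)
    finally show ?thesis using pos by (simp add: field_simps)
  qed
  then have "sqrt ((ip x y)\<^sup>2) \<le> sqrt (ip x x * ip y y)" by (rule real_sqrt_le_mono)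
  then show ?thesis by (simp add: nrm_def real_sqrt_mult)
qed

lemma nrm_scale: "x \<in> V \<Longrightarrow> nrm (c *\<^sub>R x) = \<bar>c\<bar> * nrm x"
proof -
  assume x: "x \<in> V"
  have "ip (c *\<^sub>R x) (c *\<^sub>R x) = c\<^sup>2 * ip x x" using x by (simp add: ip_bilinear power2_eq_square)
  then show ?thesis by (simp add: nrm_def real_sqrt_mult)
qed

text \<open>The Riesz map into the bounded functions on \<open>V\<close> turns the seminorm into a norm and the
  quotient by null vectors into an honest subspace of a Banach space.\<close>

definition emb :: "'v \<Rightarrow> 'v discrete \<Rightarrow>\<^sub>C real" where
  "emb x = Bcontfun (\<lambda>w. if of_discrete w \<in> V \<and> nrm (of_discrete w) \<le> 1 then ip x (of_discrete w) else 0)"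

text \<open>The discrete copy of the type is there for this reason: the bounded continuous functions
  on it are all bounded functions, and these form a Banach space.\<close>

lemma continuous_discrete: "continuous_on S (f :: 'v discrete \<Rightarrow> real)"
  by (metis continuous_on_open_vimage continuous_on_subset open_UNIV open_discrete subset_UNIV)

lemma emb_apply:
  assumes "x \<in> V"
  shows "apply_bcontfun (emb x) w =
    (if of_discrete w \<in> V \<and> nrm (of_discrete w) \<le> 1 then ip x (of_discrete w) else 0)"
proof -
  have bound: "norm (if of_discrete w \<in> V \<and> nrm (of_discrete w) \<le> 1 then ip x (of_discrete w) else 0) \<le> nrm x" for w
    using cauchy_schwarz[OF assms, of "of_discrete w"] nrm_nonneg[OF assms]
      mult_left_le[of "nrm (of_discrete w)" "nrm x"] by auto
  have "(\<lambda>w. if of_discrete w \<in> V \<and> nrm (of_discrete w) \<le> 1 then ip x (of_discrete w) else 0) \<in> bcontfun"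
    by (rule bcontfun_normI[OF continuous_discrete bound])
  then show ?thesis unfolding emb_def by (simp add: Bcontfun_inverse)
qed

lemma emb_add: "x \<in> V \<Longrightarrow> y \<in> V \<Longrightarrow> emb (x + y) = emb x + emb y"
  by (rule bcontfun_eqI) (simp add: emb_apply ip_bilinear)

lemma emb_diff: "x \<in> V \<Longrightarrow> y \<in> V \<Longrightarrow> emb (x - y) = emb x - emb y"
  by (rule bcontfun_eqI) (simp add: emb_apply ip_bilinear)

lemma emb_scale: "x \<in> V \<Longrightarrow> emb (c *\<^sub>R x) = c *\<^sub>R emb x"
  by (rule bcontfun_eqI) (simp add: emb_apply ip_bilinear)

lemma norm_emb:
  assumes "x \<in> V" shows "norm (emb x) = nrm x"
proof (rule antisym)
  show "norm (emb x) \<le> nrm x"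
  proof (rule norm_bound)
    show "norm (apply_bcontfun (emb x) w) \<le> nrm x" for w
      using cauchy_schwarz[OF assms, of "of_discrete w"] nrm_nonneg[OF assms]
        mult_left_le[of "nrm (of_discrete w)" "nrm x"] by (auto simp: emb_apply assms)
  qed
  show "nrm x \<le> norm (emb x)"
  proof (cases "nrm x = 0")
    case False
    then have pos: "0 < nrm x" using nrm_nonneg[OF assms] by simp
    \<comment> \<open>The supremum over the unit ball is attained at the normalised vector.\<close>
    let ?w = "(1 / nrm x) *\<^sub>R x"
    have w: "?w \<in> V" "nrm ?w \<le> 1" using assms pos by (simp_all add: V_scale nrm_scale)
    have "ip x ?w = nrm x" using assms pos nrm_sq[OF assms]
      by (simp add: ip_bilinear power2_eq_square field_simps)
    then have "norm (apply_bcontfun (emb x) (discrete ?w)) = nrm x"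
      using w pos by (simp add: emb_apply assms discrete_inverse)
    then show ?thesis using norm_bounded[of "emb x" "discrete ?w"] by simp
  qed simp
qed

lemma emb_eq_iff: "x \<in> V \<Longrightarrow> y \<in> V \<Longrightarrow> emb x = emb y \<longleftrightarrow> nrm (x - y) = 0"
  by (simp only: norm_emb[OF V_diff, symmetric] emb_diff norm_eq_zero right_minus_eq)

lemma eqv_iff: "x \<in> V \<Longrightarrow> y \<in> V \<Longrightarrow> eqv nrm x y \<longleftrightarrow> emb x = emb y"
  by (simp add: eqv_def emb_eq_iff)

lemma nrm_emb: "x \<in> V \<Longrightarrow> nrm x = norm (emb x)"
  by (simp add: norm_emb)

lemma nrm_triangle: "x \<in> V \<Longrightarrow> y \<in> V \<Longrightarrow> nrm (x + y) \<le> nrm x + nrm y"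
  by (simp add: nrm_emb V_add emb_add norm_triangle_ineq)

lemma nrm_minus_commute: "x \<in> V \<Longrightarrow> y \<in> V \<Longrightarrow> nrm (x - y) = nrm (y - x)"
  by (simp add: nrm_emb V_diff emb_diff norm_minus_commute)

lemma complete_nrm:
  assumes "\<And>n. X n \<in> V" "\<And>e. 0 < e \<Longrightarrow> \<exists>M. \<forall>m\<ge>M. \<forall>n\<ge>M. nrm (X m - X n) < e"
  obtains x where "x \<in> V" "(\<lambda>n. nrm (X n - x)) \<longlonglongrightarrow> 0"
  using complete[of X] assms unfolding nrm_def by blast

lemma subspace_emb:
  assumes "subspace W" "W \<subseteq> V" shows "subspace (emb ` W)"
  unfolding subspace_def
proof (intro conjI ballI allI)
  have "emb 0 = 0" using emb_scale[OF V_0, of 0] by simp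
  then show "0 \<in> emb ` W" using subspace_0[OF assms(1)] by (metis image_eqI)
next
  fix u v assume "u \<in> emb ` W" "v \<in> emb ` W"
  then obtain x y where "x \<in> W" "y \<in> W" "u = emb x" "v = emb y" by blast
  then have "u + v = emb (x + y)" "x + y \<in> W"
    using assms emb_add by (auto simp: subset_iff subspace_add)
  then show "u + v \<in> emb ` W" by blast
next
  fix c u assume "u \<in> emb ` W"
  then obtain x where "x \<in> W" "u = emb x" by blast
  then have "c *\<^sub>R u = emb (c *\<^sub>R x)" "c *\<^sub>R x \<in> W"
    using assms emb_scale by (auto simp: subset_iff subspace_scale)
  then show "c *\<^sub>R u \<in> emb ` W" by blast
qed

text \<open>\<open>emb\<close> preserves distances, so completeness of \<open>V\<close> makes the
  image complete and therefore closed.\<close>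

lemma closed_emb: "closed (emb ` V)"
proof (rule complete_imp_closed, rule completeI)
  fix f assume f: "\<forall>n. f n \<in> emb ` V" "Cauchy f"
  then have "\<forall>n. \<exists>x. x \<in> V \<and> f n = emb x" by auto
  then obtain X where X: "\<And>n. X n \<in> V" "\<And>n. f n = emb (X n)" by metis
  have dist: "nrm (X m - X n) = dist (f m) (f n)" for m n
    using X by (simp add: nrm_emb V_diff emb_diff dist_norm)
  obtain x where x: "x \<in> V" "(\<lambda>n. nrm (X n - x)) \<longlonglongrightarrow> 0"
  proof (rule complete_nrm[OF X(1)])
    fix e :: real assume "0 < e"
    then show "\<exists>M. \<forall>m\<ge>M. \<forall>n\<ge>M. nrm (X m - X n) < e"
      using f(2) unfolding Cauchy_def dist by blast
  qed blast
  have "(\<lambda>n. norm (f n - emb x)) \<longlonglongrightarrow> 0"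
    using x X by (simp add: nrm_emb V_diff emb_diff)
  then have "f \<longlonglongrightarrow> emb x" by (simp add: tendsto_norm_zero_iff LIM_zero_iff)
  then show "\<exists>l\<in>emb ` V. f \<longlonglongrightarrow> l" using x(1) by blast
qed

section \<open>Riesz representation and a density criterion\<close>

lemma tendsto_ip:
  assumes "\<forall>\<^sub>F s in G. f s \<in> V" "z \<in> V" "v \<in> V" "((\<lambda>s. nrm (f s - z)) \<longlongrightarrow> 0) G"
  shows "((\<lambda>s. ip v (f s)) \<longlongrightarrow> ip v z) G"
proof (rule LIM_zero_cancel, rule Lim_null_comparison)
  show "((\<lambda>s. nrm v * nrm (f s - z)) \<longlongrightarrow> 0) G"
    using tendsto_mult[OF tendsto_const assms(4), of "nrm v"] by simp
  show "\<forall>\<^sub>F s in G. norm (ip v (f s) - ip v z) \<le> nrm v * nrm (f s - z)"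
    using assms(1)
  proof eventually_elim
    case (elim s)
    then show ?case using cauchy_schwarz[of v "f s - z"] assms by (simp add: ip_bilinear)
  qed
qed

lemma tendsto_nrm:
  assumes "\<forall>\<^sub>F s in G. f s \<in> V" "z \<in> V" "((\<lambda>s. nrm (f s - z)) \<longlongrightarrow> 0) G"
  shows "((\<lambda>s. nrm (f s)) \<longlongrightarrow> nrm z) G"
proof (rule LIM_zero_cancel, rule Lim_null_comparison)
  show "((\<lambda>s. nrm (f s - z)) \<longlongrightarrow> 0) G" by fact
  show "\<forall>\<^sub>F s in G. norm (nrm (f s) - nrm z) \<le> nrm (f s - z)"
    using assms(1)
  proof eventually_elim
    case (elim s)
    then show ?case using norm_triangle_ineq3[of "emb (f s)" "emb z"] assms(2)
      by (simp add: nrm_emb emb_diff V_diff)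
  qed
qed

text \<open>The representing vector minimises ip x x / 2 - F x. The parallelogram identity makes a
  minimising sequence Cauchy, and the first variation at the limit is the required equation; this
  direct argument tolerates null vectors.\<close>

theorem riesz:
  assumes add: "\<And>x y. x \<in> V \<Longrightarrow> y \<in> V \<Longrightarrow> F (x + y) = F x + F y"
    and scale: "\<And>x c. x \<in> V \<Longrightarrow> F (c *\<^sub>R x) = c * F x"
    and bound: "\<And>x. x \<in> V \<Longrightarrow> \<bar>F x\<bar> \<le> C * nrm x"
  obtains u where "u \<in> V" "\<And>v. v \<in> V \<Longrightarrow> ip u v = F v"
proof -
  define q where "q x = ip x x / 2 - F x" for x
  have low: "- (C\<^sup>2 / 2) \<le> q x" if "x \<in> V" for x
  proof -
    have "F x \<le> C * nrm x" using bound[OF that] by linarith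
    moreover have "0 \<le> (nrm x - C)\<^sup>2" by simp
    ultimately show ?thesis
      unfolding q_def using nrm_sq[OF that] by (simp add: power2_eq_square algebra_simps)
  qed
  define m where "m = Inf (q ` V)"
  have bdd: "bdd_below (q ` V)" using low by (intro bdd_belowI2) auto
  have m_le: "m \<le> q x" if "x \<in> V" for x
    unfolding m_def using bdd that by (intro cInf_lower) auto
  have "\<exists>x\<in>V. q x < m + 1 / Suc n" for n
  proof -
    have "Inf (q ` V) < m + 1 / Suc n" by (simp add: m_def)
    then show ?thesis using V_0 cInf_lessD[of "q ` V"] by blast
  qed
  then obtain X where X: "\<And>n. X n \<in> V" "\<And>n. q (X n) < m + 1 / Suc n" by metis
  have F_diff: "F (x - y) = F x - F y" if "x \<in> V" "y \<in> V" for x y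
    using add[of x "(-1) *\<^sub>R y"] scale[of y "-1"] that V_scale[of y "-1"] by simp
  have para: "(nrm (x - y))\<^sup>2 = 4 * (q x + q y - 2 * q ((1/2) *\<^sub>R (x + y)))" if "x \<in> V" "y \<in> V" for x y
    using that unfolding q_def
    by (simp add: nrm_sq ip_bilinear add scale ip_sym[of y x] algebra_simps)
  obtain u where u: "u \<in> V" "(\<lambda>n. nrm (X n - u)) \<longlonglongrightarrow> 0"
  proof (rule complete_nrm[OF X(1)])
    fix e :: real assume e: "0 < e"
    \<comment> \<open>By the parallelogram identity the squared distance of two terms is below 4 (1
      / (M + 1) + 1 / (M + 1)), whence the 8.\<close>
    then obtain M where M: "8 / (e\<^sup>2) < Suc M" using reals_Archimedean2 by (metis less_Suc_eq of_nat_less_iff order_less_trans)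
    have "nrm (X k - X l) < e" if "k \<ge> M" "l \<ge> M" for k l
    proof -
      have "1 / real (Suc k) \<le> 1 / Suc M" "1 / real (Suc l) \<le> 1 / Suc M"
        using that by (auto intro!: divide_left_mono)
      moreover have "1 / Suc M < e\<^sup>2 / 8" using M e by (simp add: field_simps)
      ultimately have "(nrm (X k - X l))\<^sup>2 < e\<^sup>2"
        using para[OF X(1) X(1), of k l] X(2)[of k] X(2)[of l] m_le[of "(1/2) *\<^sub>R (X k + X l)"] X(1)
        by (simp add: V_scale V_add)
      then show ?thesis using e by (intro power2_less_imp_less[of _ e]) auto
    qed
    then show "\<exists>M. \<forall>k\<ge>M. \<forall>l\<ge>M. nrm (X k - X l) < e" by blast
  qed blast
  have "ip u v = F v" if v: "v \<in> V" for v
  proof -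
    \<comment> \<open>The variation is taken at the terms of the sequence, where q exceeds its
      infimum by less than 1 / (n + 1); convergence of the inner products then passes the inequality
      to \<open>u\<close>.\<close>
    have "0 \<le> t * (ip u v - F v) + t\<^sup>2 * (ip v v / 2)" for t
    proof (rule tendsto_le[of sequentially])
      have "(\<lambda>n. ip v (X n)) \<longlonglongrightarrow> ip v u"
        using X(1) u v by (intro tendsto_ip) auto
      then show "(\<lambda>n. t * (ip v (X n) - F v) + t\<^sup>2 * (ip v v / 2)) \<longlonglongrightarrow> t * (ip u v - F v) + t\<^sup>2 * (ip v v / 2)"
        unfolding ip_sym[OF u(1) v] by (intro tendsto_intros)
      show "(\<lambda>n. - (1 / real (Suc n))) \<longlonglongrightarrow> 0"
        using tendsto_minus[OF LIMSEQ_inverse_real_of_nat] by (simp add: inverse_eq_divide)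
      have "- (1 / real (Suc n)) \<le> t * (ip v (X n) - F v) + t\<^sup>2 * (ip v v / 2)" for n
      proof -
        have "q (X n + t *\<^sub>R v) = q (X n) + (t * (ip v (X n) - F v) + t\<^sup>2 * (ip v v / 2))"
          using X(1)[of n] v unfolding q_def
          by (simp add: ip_bilinear add scale ip_sym[of "X n" v] power2_eq_square algebra_simps)
        then show ?thesis using m_le[of "X n + t *\<^sub>R v"] X[of n] v V_add V_scale by fastforce
      qed
      then show "\<forall>\<^sub>F n in sequentially. - (1 / real (Suc n)) \<le> t * (ip v (X n) - F v) + t\<^sup>2 * (ip v v / 2)"
        by simp
    qed simp
    from quadratic_nonneg_linear[OF this] ip_nonneg[OF v] show ?thesis by simp
  qed
  then show ?thesis using that u(1) by blast
qed

text \<open>C is the closure of \<open>W\<close>, enlarged by all null vectors, and a space of the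
  same kind. The Riesz theorem inside C represents the functional \<open>ip x\<close> by some u, the
  projection of \<open>x\<close>. Then x - u is orthogonal to \<open>W\<close>, hence null.\<close>

lemma closure_dense:
  assumes W: "subspace W" "W \<subseteq> V"
    and orth: "\<And>x. x \<in> V \<Longrightarrow> (\<And>w. w \<in> W \<Longrightarrow> ip x w = 0) \<Longrightarrow> nrm x = 0"
    and x: "x \<in> V" and e: "0 < e"
  obtains w where "w \<in> W" "nrm (x - w) < e"
proof -
  define C where "C = {v\<in>V. emb v \<in> closure (emb ` W)}"
  have sub: "subspace (closure (emb ` W))"
    using W by (intro subspace_closure subspace_emb)
  have C_V: "v \<in> V" if "v \<in> C" for v using that by (simp add: C_def)
  interpret C: semi_hilbert C ip
  proof
    show "subspace C"
      unfolding subspace_def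
    proof (intro conjI ballI allI)
      show "0 \<in> C" using subspace_0[OF sub] V_0 emb_scale[OF V_0, of 0] by (simp add: C_def)
    qed (auto simp: C_def V_add V_scale emb_add emb_scale subspace_add[OF sub] subspace_scale[OF sub])
    fix X :: "nat \<Rightarrow> 'v"
    assume X: "\<And>n. X n \<in> C" and cauchy: "\<And>e. 0 < e \<Longrightarrow> \<exists>M. \<forall>m\<ge>M. \<forall>n\<ge>M. sqrt (ip (X m - X n) (X m - X n)) < e"
    obtain y where y: "y \<in> V" "(\<lambda>n. nrm (X n - y)) \<longlonglongrightarrow> 0"
      using complete_nrm[of X] X C_V cauchy unfolding nrm_def by blast
    have "(\<lambda>n. norm (emb (X n) - emb y)) \<longlonglongrightarrow> 0"
      using y X C_V by (simp add: nrm_emb V_diff emb_diff)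
    then have lim: "(\<lambda>n. emb (X n)) \<longlonglongrightarrow> emb y" by (simp add: tendsto_norm_zero_iff LIM_zero_iff)
    have "emb (X n) \<in> closure (emb ` W)" for n using X[of n] by (simp add: C_def)
    then have "emb y \<in> closure (emb ` W)" using lim by (rule closed_sequentially[OF closed_closure])
    then show "\<exists>y\<in>C. (\<lambda>n. sqrt (ip (X n - y) (X n - y))) \<longlonglongrightarrow> 0"
      using y unfolding C_def nrm_def by blast
  qed (auto simp: C_def ip_bilinear ip_sym ip_nonneg)
  have F: "ip x (y + z) = ip x y + ip x z" "ip x (c *\<^sub>R y) = c * ip x y" if "y \<in> C" "z \<in> C" for y z c
    using that x by (simp_all add: ip_bilinear C_V)
  obtain u where u: "u \<in> C" "\<And>v. v \<in> C \<Longrightarrow> ip u v = ip x v"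
  proof (rule C.riesz[of "ip x" "nrm x"])
    show "\<bar>ip x y\<bar> \<le> nrm x * C.nrm y" if "y \<in> C" for y
      using cauchy_schwarz[OF x C_V[OF that]] by (simp add: nrm_def C.nrm_def)
  qed (use F in blast)+
  have "W \<subseteq> C" using W closure_subset[of "emb ` W"] by (auto simp: C_def)
  then have "ip (x - u) w = 0" if "w \<in> W" for w
    using that u(1) u(2)[of w] x C_V ip_diff[of x u w] by (metis diff_self subsetD)
  then have "nrm (x - u) = 0" using orth[of "x - u"] x u C_V V_diff by blast
  then have "emb x = emb u" using x u C_V emb_eq_iff by blast
  then have "emb x \<in> closure (emb ` W)" using u by (simp add: C_def)
  then obtain w where "w \<in> W" "dist (emb w) (emb x) < e"
    using e unfolding closure_approachable by blast
  moreover have "dist (emb w) (emb x) = nrm (x - w)"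
    using \<open>w \<in> W\<close> W(2) x by (auto simp: dist_norm norm_minus_commute nrm_emb emb_diff V_diff subset_iff)
  ultimately show ?thesis using that by simp
qed

end

section \<open>Generation theorem for spaces of representatives\<close>

instance bcontfun :: (metric_space, banach) banach ..

text \<open>Linearity and range are required up to null vectors, because \<open>opA\<close> involves
  a weak derivative picked by choice. \<open>B_cong\<close> lets the operator descend to classes:
  membership in \<open>D\<close> and the class of \<open>B x\<close> depend on the class of
  \<open>x\<close> only.\<close>

locale dissipative_operator = semi_hilbert V ip
  for V :: "'v::real_vector set" and ip +
  fixes D :: "'v set" and B :: "'v \<Rightarrow> 'v"
  assumes subspace_D: "subspace D" and D_V: "D \<subseteq> V"
    and B_in: "x \<in> D \<Longrightarrow> B x \<in> V"
    and B_add: "x \<in> D \<Longrightarrow> y \<in> D \<Longrightarrow> eqv nrm (B (x + y)) (B x + B y)"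
    and B_scale: "x \<in> D \<Longrightarrow> eqv nrm (B (c *\<^sub>R x)) (c *\<^sub>R B x)"
    and B_cong: "x \<in> D \<Longrightarrow> y \<in> V \<Longrightarrow> eqv nrm x y \<Longrightarrow> y \<in> D \<and> eqv nrm (B x) (B y)"
    and B_dissipative: "x \<in> D \<Longrightarrow> ip (B x) x \<le> 0"
    and B_range: "f \<in> V \<Longrightarrow> 0 < h \<Longrightarrow> \<exists>x\<in>D. eqv nrm (x - h *\<^sub>R B x) f"
begin

lemma D_in: "x \<in> D \<Longrightarrow> x \<in> V" using D_V by blast

lemma D_add: "x \<in> D \<Longrightarrow> y \<in> D \<Longrightarrow> x + y \<in> D"
  and D_scale: "x \<in> D \<Longrightarrow> c *\<^sub>R x \<in> D"
  and D_diff: "x \<in> D \<Longrightarrow> y \<in> D \<Longrightarrow> x - y \<in> D"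
  using subspace_D by (auto simp: subspace_add subspace_scale subspace_diff)

lemma emb_B_add: "x \<in> D \<Longrightarrow> y \<in> D \<Longrightarrow> emb (B (x + y)) = emb (B x) + emb (B y)"
  using B_add[of x y] by (simp add: eqv_iff B_in D_add V_add emb_add)

lemma emb_B_scale: "x \<in> D \<Longrightarrow> emb (B (c *\<^sub>R x)) = c *\<^sub>R emb (B x)"
  using B_scale[of x c] by (simp add: eqv_iff B_in D_scale V_scale emb_scale)

lemma emb_B_diff: "x \<in> D \<Longrightarrow> y \<in> D \<Longrightarrow> emb (B (x - y)) = emb (B x) - emb (B y)"
  using emb_B_add[of x "(-1) *\<^sub>R y"] emb_B_scale[of y "-1"] D_scale[of y "-1"] by simp

lemma emb_B_cong: "x \<in> D \<Longrightarrow> y \<in> V \<Longrightarrow> emb x = emb y \<Longrightarrow> y \<in> D \<and> emb (B x) = emb (B y)"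
  using B_cong[of x y] by (auto simp: eqv_iff D_in B_in)

text \<open>The operator induced on the image of \<open>emb\<close>; by \<open>B_cong\<close> the
  value does not depend on the chosen preimage in \<open>D\<close>.\<close>

definition A :: "('v discrete \<Rightarrow>\<^sub>C real) \<Rightarrow> 'v discrete \<Rightarrow>\<^sub>C real" where
  "A e = emb (B (SOME x. x \<in> D \<and> emb x = e))"

lemma A_emb:
  assumes "x \<in> D" shows "A (emb x) = emb (B x)"
proof -
  have "(SOME y. y \<in> D \<and> emb y = emb x) \<in> D \<and> emb (SOME y. y \<in> D \<and> emb y = emb x) = emb x"
    by (rule someI[of _ x]) (simp add: assms)
  then show ?thesis unfolding A_def using emb_B_cong[OF assms] D_in by metis
qed

lemma ip_null: "x \<in> V \<Longrightarrow> y \<in> V \<Longrightarrow> nrm x = 0 \<Longrightarrow> ip x y = 0"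
  using cauchy_schwarz[of x y] by simp

text \<open>If \<open>x\<close> is orthogonal to \<open>D\<close>, solve y - B y = x. Pairing with y
  gives ip y y = ip (B y) y, which is at most 0; so y is null, then so is B y, and hence
  \<open>x\<close>. Density is thus a consequence of range and dissipativity.\<close>

lemma D_dense:
  assumes "x \<in> V" "0 < e" obtains z where "z \<in> D" "nrm (x - z) < e"
proof (rule closure_dense[OF subspace_D D_V _ assms])
  fix x assume x: "x \<in> V" and orth: "\<And>w. w \<in> D \<Longrightarrow> ip x w = 0"
  obtain y where y: "y \<in> D" "eqv nrm (y - 1 *\<^sub>R B y) x" using B_range[OF x, of 1] by auto
  have yV: "y \<in> V" "B y \<in> V" using y D_in B_in by auto
  have emb_x: "emb y - emb (B y) = emb x" using y(2) x yV by (simp add: eqv_iff V_diff emb_diff)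
  have "ip ((y - B y) - x) y = 0"
    using y(2) x yV by (intro ip_null) (auto simp: V_diff eqv_def)
  then have "ip y y = ip (B y) y" using orth[OF y(1)] x yV by (simp add: ip_bilinear)
  then have "ip y y = 0" using B_dissipative[OF y(1)] ip_nonneg[OF yV(1)] by simp
  then have "nrm y = 0" by (simp add: nrm_def)
  then have y0: "emb y = 0" using norm_emb[OF yV(1)] by simp
  also have "0 = emb (0 *\<^sub>R y)" using emb_scale[OF yV(1), of 0] by simp
  finally have "emb (B y) = emb (B (0 *\<^sub>R y))" using emb_B_cong[OF y(1)] V_scale yV by blast
  also have "\<dots> = 0" using emb_B_scale[OF y(1), of 0] by simp
  finally show "nrm x = 0" using emb_x y0 norm_emb[OF x] by simp
qed (use that in blast)

sublocale hy: m_dissipative "emb ` V" "emb ` D" A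
proof
    show "subspace (emb ` V)" by (intro subspace_emb subspace_V order_refl)
    show "closed (emb ` V)" by (rule closed_emb)
    show "subspace (emb ` D)" by (intro subspace_emb subspace_D D_V)
    show "emb ` D \<subseteq> emb ` V" using D_V by blast
    fix e assume "e \<in> emb ` D"
    then obtain x where x: "x \<in> D" "e = emb x" by blast
    then show "A e \<in> emb ` V" by (simp add: A_emb B_in)
    show "A (c *\<^sub>R e) = c *\<^sub>R A e" for c
      using x by (simp add: A_emb emb_scale[symmetric] D_in D_scale emb_B_scale)
    show "A (e + f) = A e + A f" if "f \<in> emb ` D" for f
      using x that by (auto simp: A_emb emb_add[symmetric] D_in D_add emb_B_add)
    show "norm e \<le> norm (e - h *\<^sub>R A e)" if "0 \<le> h" for h
    proof -
      have xV: "x \<in> V" "B x \<in> V" using x D_in B_in by auto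
      \<comment> \<open>Dissipativity in its inner product form gives the cross term of the expanded
        square the favourable sign.\<close>
      have "ip (x - h *\<^sub>R B x) (x - h *\<^sub>R B x) = ip x x - 2 * h * ip (B x) x + h\<^sup>2 * ip (B x) (B x)"
        using xV by (simp add: ip_bilinear ip_sym[of x "B x"] power2_eq_square algebra_simps)
      moreover have "0 \<le> h * - ip (B x) x" "0 \<le> h\<^sup>2 * ip (B x) (B x)"
        using B_dissipative[OF x(1)] that ip_nonneg[OF xV(2)] by (auto intro: mult_nonneg_nonpos)
      ultimately have "ip x x \<le> ip (x - h *\<^sub>R B x) (x - h *\<^sub>R B x)" by simp
      then have "nrm x \<le> nrm (x - h *\<^sub>R B x)" by (simp add: nrm_def)
      then show ?thesis using x xV by (simp add: A_emb nrm_emb V_scale V_diff emb_diff emb_scale)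
    qed
  next
    fix f h assume "f \<in> emb ` V" "0 < (h::real)"
    then obtain y where y: "y \<in> V" "f = emb y" by blast
    obtain x where x: "x \<in> D" "eqv nrm (x - h *\<^sub>R B x) y" using B_range[OF y(1) \<open>0 < h\<close>] by blast
    then have "emb x - h *\<^sub>R A (emb x) = f"
      using y by (simp add: eqv_iff A_emb V_scale V_diff emb_diff emb_scale D_in B_in)
    then show "\<exists>x\<in>emb ` D. x - h *\<^sub>R A x = f" using x(1) by blast
  next
    show "emb ` V \<subseteq> closure (emb ` D)"
    proof
      fix f assume "f \<in> emb ` V"
      then obtain x where x: "x \<in> V" "f = emb x" by blast
      have "\<exists>y\<in>emb ` D. dist y f < e" if e: "0 < e" for e
      proof -
        obtain z where z: "z \<in> D" "nrm (x - z) < e" using D_dense[OF x(1) e] .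
        then have "dist (emb z) f < e"
          using x by (simp add: dist_norm norm_minus_commute nrm_emb emb_diff V_diff D_in)
        then show ?thesis using z(1) by blast
      qed
      then show "f \<in> closure (emb ` D)" by (simp add: closure_approachable)
    qed
qed

text \<open>\<open>S t x\<close> is a representative of the class \<open>hy.T t (emb x)\<close>,
  chosen separately for each t and x. The semigroup laws and linearity therefore hold modulo null
  vectors, in the form used by \<open>C0_semigroup\<close>.\<close>

theorem semigroup_exists:
  obtains S where "C0_semigroup V nrm S" "generated_by V nrm S D B"
proof -
  define S where "S t x = (SOME y. y \<in> V \<and> emb y = hy.T t (emb x))" for t x
  have S: "S t x \<in> V" "emb (S t x) = hy.T t (emb x)" if "x \<in> V" "0 \<le> t" for t x
  proof -
    have "\<exists>y. y \<in> V \<and> emb y = hy.T t (emb x)" using hy.T_in_H[of "emb x" t] that by auto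
    then show "S t x \<in> V" "emb (S t x) = hy.T t (emb x)"
      unfolding S_def using someI_ex[of "\<lambda>y. y \<in> V \<and> emb y = hy.T t (emb x)"] by auto
  qed
  have "C0_semigroup V nrm S"
    unfolding C0_semigroup_def
  proof (intro conjI ballI allI impI)
    fix x assume x: "x \<in> V"
    have "((\<lambda>t. norm (hy.T t (emb x) - emb x)) \<longlongrightarrow> 0) (at_right 0)"
      using x by (intro hy.T_right_continuous) auto
    then show "((\<lambda>t. nrm (S t x - x)) \<longlongrightarrow> 0) (at_right 0)"
    proof (rule Lim_transform_eventually)
      show "\<forall>\<^sub>F t in at_right 0. norm (hy.T t (emb x) - emb x) = nrm (S t x - x)"
        using eventually_at_right_less[of 0]
        by eventually_elim (use x in \<open>simp add: S nrm_emb V_diff emb_diff\<close>)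
    qed
  next
    fix t :: real assume t: "0 \<le> t"
    show "\<exists>C. \<forall>x\<in>V. nrm (S t x) \<le> C * nrm x"
    proof (intro exI ballI)
      fix x assume "x \<in> V"
      then show "nrm (S t x) \<le> 1 * nrm x" using t hy.T_norm[of "emb x" t] by (simp add: S nrm_emb)
    qed
  qed (auto simp: S eqv_iff V_add V_scale emb_add emb_scale hy.T_add hy.T_scale hy.T_0 hy.T_semigroup)
  moreover have "generated_by V nrm S D B"
    unfolding generated_by_def
  proof (intro ballI)
    fix x w assume x: "x \<in> V" and w: "w \<in> V"
    have ev: "\<forall>\<^sub>F h in at_right 0. nrm ((1 / h) *\<^sub>R (S h x - x) - w) = norm ((1 / h) *\<^sub>R (hy.T h (emb x) - emb x) - emb w)"
      using eventually_at_right_less[of 0]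
      by eventually_elim (use x w in \<open>simp add: S nrm_emb V_diff V_scale emb_scale emb_diff\<close>)
    have "((\<lambda>h. nrm ((1 / h) *\<^sub>R (S h x - x) - w)) \<longlongrightarrow> 0) (at_right 0) \<longleftrightarrow>
        ((\<lambda>h. norm ((1 / h) *\<^sub>R (hy.T h (emb x) - emb x) - emb w)) \<longlongrightarrow> 0) (at_right 0)"
      by (rule tendsto_cong[OF ev])
    also have "\<dots> \<longleftrightarrow> x \<in> D \<and> eqv nrm (B x) w"
    proof
      assume lim: "((\<lambda>h. norm ((1 / h) *\<^sub>R (hy.T h (emb x) - emb x) - emb w)) \<longlongrightarrow> 0) (at_right 0)"
      have "emb x \<in> emb ` D" "A (emb x) = emb w"
        using hy.T_generator_converse[OF _ _ lim] x w by auto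
      then obtain y where y: "y \<in> D" "emb y = emb x" by auto
      then have xD: "x \<in> D" using emb_B_cong x by blast
      then show "x \<in> D \<and> eqv nrm (B x) w" using \<open>A (emb x) = emb w\<close> w by (simp add: A_emb eqv_iff B_in)
    next
      assume "x \<in> D \<and> eqv nrm (B x) w"
      then show "((\<lambda>h. norm ((1 / h) *\<^sub>R (hy.T h (emb x) - emb x) - emb w)) \<longlongrightarrow> 0) (at_right 0)"
        using hy.T_generator[of "emb x"] w by (auto simp: A_emb eqv_iff B_in)
    qed
    finally show "((\<lambda>h. nrm ((1 / h) *\<^sub>R (S h x - x) - w)) \<longlongrightarrow> 0) (at_right 0) \<longleftrightarrow> x \<in> D \<and> eqv nrm (B x) w" .
  qed
  ultimately show ?thesis by (rule that)
qed

end

section \<open>Uniform boundedness\<close>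

context semi_hilbert
begin

lemma nrm_zero: "nrm 0 = 0"
  using nrm_scale[OF V_0, of 0] by simp

text \<open>The Baire argument carried out directly in a complete seminormed space. If the family
  were unbounded on every ball, balls could be nested so that throughout the ball with index n + 1
  some \<open>p i\<close> is at least n; their common point contradicts
  \<open>pointwise\<close>.\<close>

theorem uniform_boundedness:
  fixes p :: "'i \<Rightarrow> 'v \<Rightarrow> real"
  assumes add: "\<And>i x y. x \<in> V \<Longrightarrow> y \<in> V \<Longrightarrow> p i (x + y) \<le> p i x + p i y"
    and scale: "\<And>i x c. x \<in> V \<Longrightarrow> p i (c *\<^sub>R x) = \<bar>c\<bar> * p i x"
    and bound: "\<And>i. \<exists>C. \<forall>x\<in>V. p i x \<le> C * nrm x"
    and pointwise: "\<And>x. x \<in> V \<Longrightarrow> \<exists>K. \<forall>i. p i x \<le> K"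
  shows "\<exists>K. \<forall>i. \<forall>x\<in>V. p i x \<le> K * nrm x"
proof -
  have diff: "p i (x - y) \<le> p i x + p i y" if "x \<in> V" "y \<in> V" for i x y
    using add[of x "(-1) *\<^sub>R y" i] scale[of y i "-1"] that V_scale[of y "-1"] by simp
  have "\<exists>x\<in>V. \<exists>r>0. \<exists>K. \<forall>i. \<forall>y\<in>V. nrm (y - x) \<le> r \<longrightarrow> p i y \<le> K"
  proof (rule ccontr)
    assume "\<not> ?thesis"
    then have big: "\<exists>i. \<exists>y\<in>V. nrm (y - x) \<le> r \<and> K < p i y" if "x \<in> V" "0 < r" for x r K
      using that by (meson not_le)
    define Q where "Q n a b \<longleftrightarrow> snd b \<le> snd a / 2 \<and> nrm (fst b - fst a) \<le> snd a / 2 \<and>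
      (\<exists>i. \<forall>y\<in>V. nrm (y - fst b) \<le> snd b \<longrightarrow> real n \<le> p i y)" for n :: nat and a b :: "'v \<times> real"
    have "\<exists>f. \<forall>n. (fst (f n) \<in> V \<and> 0 < snd (f n)) \<and> Q n (f n) (f (Suc n))"
    proof (rule dependent_nat_choice)
      show "\<exists>a :: 'v \<times> real. fst a \<in> V \<and> 0 < snd a" using V_0 by (intro exI[of _ "(0, 1)"]) simp
    next
      fix a :: "'v \<times> real" and n assume a: "fst a \<in> V \<and> 0 < snd a"
      obtain i y where y: "y \<in> V" "nrm (y - fst a) \<le> snd a / 2" "real n + 1 < p i y"
        using big[of "fst a" "snd a / 2" "real n + 1"] a by auto
      obtain C where C: "\<And>x. x \<in> V \<Longrightarrow> p i x \<le> C * nrm x" using bound[of i] by blast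
      \<comment> \<open>On a ball of radius 1 / (|C| + 1) the function \<open>p i\<close> drops by
        at most 1, so the value n + 1 exceeded at the centre leaves at least n on the whole
        ball.\<close>
      define r where "r = min (snd a / 2) (1 / (\<bar>C\<bar> + 1))"
      have r: "0 < r" "r \<le> snd a / 2" "r \<le> 1 / (\<bar>C\<bar> + 1)" using a by (auto simp: r_def)
      have "real n \<le> p i z" if z: "z \<in> V" "nrm (z - y) \<le> r" for z
      proof -
        have "p i (y - z) \<le> C * nrm (y - z)" using C y z V_diff by simp
        also have "\<dots> \<le> \<bar>C\<bar> * r"
          using z y nrm_minus_commute[of y z] nrm_nonneg[of "y - z"] V_diff[of y z] by (intro mult_mono) auto
        also have "\<dots> \<le> \<bar>C\<bar> * (1 / (\<bar>C\<bar> + 1))" using r by (intro mult_left_mono) auto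
        also have "\<dots> \<le> 1" by (simp add: field_simps)
        finally have "p i (y - z) \<le> 1" .
        moreover have "p i y \<le> p i (y - z) + p i z" using add[of "y - z" z i] V_diff y z by simp
        ultimately show ?thesis using y(3) by linarith
      qed
      then show "\<exists>b. (fst b \<in> V \<and> 0 < snd b) \<and> Q n a b"
        using r y by (intro exI[of _ "(y, r)"]) (auto simp: Q_def)
    qed
    then obtain f where f: "\<And>n. fst (f n) \<in> V" "\<And>n. 0 < snd (f n)" "\<And>n. Q n (f n) (f (Suc n))" by blast
    define X where "X n = fst (f n)" for n
    define r where "r n = snd (f n)" for n
    have X: "\<And>n. X n \<in> V" "\<And>n. 0 < r n" "\<And>n. r (Suc n) \<le> r n / 2" "\<And>n. nrm (X (Suc n) - X n) \<le> r n / 2"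
      and large: "\<And>n. \<exists>i. \<forall>y\<in>V. nrm (y - X (Suc n)) \<le> r (Suc n) \<longrightarrow> real n \<le> p i y"
      using f unfolding Q_def X_def r_def by auto
    \<comment> \<open>Nestedness in metric form: the closed ball around \<open>X (n + k)\<close>
      lies in the one around \<open>X n\<close>.\<close>
    have "nrm (X (n + k) - X n) + r (n + k) \<le> r n" for n k
    proof (induction k)
      case 0
      show ?case by (simp add: nrm_zero)
    next
      case (Suc k)
      have "nrm (X (n + Suc k) - X n) \<le> nrm (X (Suc (n + k)) - X (n + k)) + nrm (X (n + k) - X n)"
        using nrm_triangle[of "X (Suc (n + k)) - X (n + k)" "X (n + k) - X n"] X(1) V_diff by simp
      then show ?case using X(3)[of "n + k"] X(4)[of "n + k"] Suc by simp
    qed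
    then have near: "nrm (X m - X n) \<le> r n" if "n \<le> m" for m n
      using that X(2)[of m] by (metis add.commute add_le_imp_le_left le_add_diff_inverse less_imp_le order_trans add_increasing2 add_decreasing2 le_add_same_cancel1)
    have r_le: "r n \<le> r 0 * (1/2) ^ n" for n
    proof (induction n)
      case (Suc n)
      then show ?case using X(3)[of n] by simp
    qed simp
    have "(\<lambda>n. r 0 * (1/2) ^ n) \<longlonglongrightarrow> r 0 * 0"
      by (intro tendsto_mult tendsto_const LIMSEQ_realpow_zero) simp_all
    then have r0: "(\<lambda>n. r 0 * (1/2) ^ n) \<longlonglongrightarrow> 0" by simp
    obtain x where x: "x \<in> V" "(\<lambda>n. nrm (X n - x)) \<longlonglongrightarrow> 0"
    proof (rule complete_nrm[OF X(1)])
      fix e :: real assume e: "0 < e"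
      then obtain M where M: "r 0 * (1/2) ^ M < e / 2"
        using order_tendstoD(2)[OF r0, of "e / 2"] by (auto simp: eventually_sequentially)
      have "nrm (X k - X l) < e" if "k \<ge> M" "l \<ge> M" for k l
      proof -
        have "nrm (X k - X l) \<le> nrm (X k - X M) + nrm (X M - X l)"
          using nrm_triangle[of "X k - X M" "X M - X l"] X(1) V_diff by simp
        then show ?thesis
          using near[OF that(1)] near[OF that(2)] nrm_minus_commute[of "X M" "X l"] X(1) r_le[of M] M by simp
      qed
      then show "\<exists>M. \<forall>k\<ge>M. \<forall>l\<ge>M. nrm (X k - X l) < e" by blast
    qed blast
    have "nrm (x - X n) \<le> 0 + r n" for n
    proof (rule tendsto_le[of sequentially "\<lambda>m. nrm (X m - x) + r n" "0 + r n" "\<lambda>m. nrm (x - X n)"])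
      show "(\<lambda>m. nrm (X m - x) + r n) \<longlonglongrightarrow> 0 + r n" by (intro tendsto_add x(2) tendsto_const)
      show "\<forall>\<^sub>F m in sequentially. nrm (x - X n) \<le> nrm (X m - x) + r n"
        unfolding eventually_sequentially
      proof (intro exI allI impI)
        fix m assume "n \<le> m"
        have "nrm (x - X n) \<le> nrm (x - X m) + nrm (X m - X n)"
          using nrm_triangle[of "x - X m" "X m - X n"] X(1) x V_diff by simp
        then show "nrm (x - X n) \<le> nrm (X m - x) + r n"
          using near[OF \<open>n \<le> m\<close>] nrm_minus_commute[of x "X m"] X(1) x by simp
      qed
    qed auto
    then have x_near: "nrm (x - X n) \<le> r n" for n by simp
    obtain K where K: "\<And>i. p i x \<le> K" using pointwise[OF x(1)] by blast
    obtain n where "K < real n" using reals_Archimedean2 by blast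
    moreover obtain i where "real n \<le> p i x" using large[of n] x(1) x_near[of "Suc n"] by blast
    ultimately show False using K[of i] by linarith
  qed
  \<comment> \<open>A vector of length r is the difference of two points of the ball, one of them
    the centre \<open>x\<close>, which gives the constant 2 K / r.\<close>
  then obtain x r K where x: "x \<in> V" "0 < r" and K: "\<And>i y. y \<in> V \<Longrightarrow> nrm (y - x) \<le> r \<Longrightarrow> p i y \<le> K"
    by blast
  have "p i w \<le> 2 * K / r * nrm w" if w: "w \<in> V" for i w
  proof (cases "nrm w = 0")
    case True
    then show ?thesis using bound[of i] w by auto
  next
    case False
    then have pos: "0 < nrm w" using nrm_nonneg[OF w] by simp
    define c where "c = r / nrm w"
    have c: "0 < c" "c * nrm w = r" using pos x by (simp_all add: c_def)
    have "nrm ((x + c *\<^sub>R w) - x) \<le> r" using c w by (simp add: nrm_scale)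
    then have "p i (x + c *\<^sub>R w) \<le> K" using x w by (intro K) (auto simp: V_add V_scale)
    moreover have "nrm (x - x) \<le> r" using x by (simp add: nrm_zero)
    then have "p i x \<le> K" using x by (intro K) auto
    moreover have "p i (c *\<^sub>R w) \<le> p i (x + c *\<^sub>R w) + p i x"
      using diff[of "x + c *\<^sub>R w" x i] x w by (simp add: V_add V_scale)
    ultimately have "c * p i w \<le> 2 * K" using scale[OF w, of i c] c by simp
    then have "p i w \<le> 2 * K / c" using c by (simp add: field_simps)
    then show ?thesis by (simp add: c_def)
  qed
  then show ?thesis by blast
qed

end

section \<open>Arbitrary semigroups with a prescribed generator\<close>

lemma tendsto_two_sided:
  fixes f :: "real \<Rightarrow> real"
  assumes "(g \<longlongrightarrow> 0) (at_right 0)" "0 < d"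
    and "\<And>s. 0 \<le> s \<Longrightarrow> s \<noteq> t \<Longrightarrow> \<bar>s - t\<bar> < d \<Longrightarrow> 0 \<le> f s \<and> f s \<le> g \<bar>s - t\<bar>"
  shows "(f \<longlongrightarrow> 0) (at t within {0..})"
proof (rule Lim_null_comparison)
  have ev: "\<forall>\<^sub>F s in at t within {0..}. 0 \<le> s \<and> s \<noteq> t \<and> \<bar>s - t\<bar> < d"
    using assms(2) by (auto simp: eventually_at dist_real_def intro!: exI[of _ d])
  show "\<forall>\<^sub>F s in at t within {0..}. norm (f s) \<le> g \<bar>s - t\<bar>"
    using ev by eventually_elim (use assms(3) in force)
  have "((\<lambda>s. \<bar>s - t\<bar>) \<longlongrightarrow> \<bar>t - t\<bar>) (at t within {0..})" by (intro tendsto_intros)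
  \<comment> \<open>The semigroup axioms provide limits from the right at 0; through the distance to
    \<open>t\<close> they yield limits at \<open>t\<close> from both sides.\<close>
  then have "filterlim (\<lambda>s. \<bar>s - t\<bar>) (at_right 0) (at t within {0..})"
    unfolding filterlim_at using ev by (auto elim: eventually_mono)
  then show "((\<lambda>s. g \<bar>s - t\<bar>) \<longlongrightarrow> 0) (at t within {0..})"
    by (rule filterlim_compose[OF assms(1)])
qed

text \<open>\<open>mild_solution\<close> admits any C0-semigroup with the given generator, not just
  the constructed one, and its operators are a priori bounded for each time separately. The
  properties of orbits are therefore derived for an arbitrary \<open>S\<close>.\<close>

locale generated_semigroup = dissipative_operator V ip D B
  for V :: "'v::real_vector set" and ip and D and B +
  fixes S :: "real \<Rightarrow> 'v \<Rightarrow> 'v"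
  assumes C0: "C0_semigroup V nrm S" and generated: "generated_by V nrm S D B"
begin

lemma S_in: "0 \<le> t \<Longrightarrow> x \<in> V \<Longrightarrow> S t x \<in> V"
  using C0 by (simp add: C0_semigroup_def)

lemma emb_S_add: "0 \<le> t \<Longrightarrow> x \<in> V \<Longrightarrow> y \<in> V \<Longrightarrow> emb (S t (x + y)) = emb (S t x) + emb (S t y)"
proof -
  assume *: "0 \<le> t" "x \<in> V" "y \<in> V"
  then have "eqv nrm (S t (x + y)) (S t x + S t y)" using C0 by (simp add: C0_semigroup_def)
  then show ?thesis using * eqv_iff[of "S t (x + y)" "S t x + S t y"] by (simp add: S_in V_add emb_add)
qed

lemma emb_S_scale: "0 \<le> t \<Longrightarrow> x \<in> V \<Longrightarrow> emb (S t (c *\<^sub>R x)) = c *\<^sub>R emb (S t x)"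
proof -
  assume *: "0 \<le> t" "x \<in> V"
  then have "eqv nrm (S t (c *\<^sub>R x)) (c *\<^sub>R S t x)" using C0 by (simp add: C0_semigroup_def)
  then show ?thesis using * eqv_iff[of "S t (c *\<^sub>R x)" "c *\<^sub>R S t x"] by (simp add: S_in V_scale emb_scale)
qed

lemma emb_S_diff: "0 \<le> t \<Longrightarrow> x \<in> V \<Longrightarrow> y \<in> V \<Longrightarrow> emb (S t (x - y)) = emb (S t x) - emb (S t y)"
  using emb_S_add[of t x "(-1) *\<^sub>R y"] emb_S_scale[of t y "-1"] V_scale[of y "-1"] by simp

lemma emb_S_0: "x \<in> V \<Longrightarrow> emb (S 0 x) = emb x"
proof -
  assume *: "x \<in> V"
  then have "eqv nrm (S 0 x) x" using C0 by (simp add: C0_semigroup_def)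
  then show ?thesis using * eqv_iff[of "S 0 x" x] by (simp add: S_in)
qed

lemma emb_S_plus: "0 \<le> s \<Longrightarrow> 0 \<le> t \<Longrightarrow> x \<in> V \<Longrightarrow> emb (S (s + t) x) = emb (S s (S t x))"
proof -
  assume *: "0 \<le> s" "0 \<le> t" "x \<in> V"
  then have "eqv nrm (S (s + t) x) (S s (S t x))" using C0 by (simp add: C0_semigroup_def)
  then show ?thesis using * eqv_iff[of "S (s + t) x" "S s (S t x)"] by (simp add: S_in)
qed

lemma S_bound:
  assumes "0 \<le> t" obtains C where "0 \<le> C" "\<And>x. x \<in> V \<Longrightarrow> nrm (S t x) \<le> C * nrm x"
proof -
  obtain C where C: "\<And>x. x \<in> V \<Longrightarrow> nrm (S t x) \<le> C * nrm x"
  proof -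
    have "\<exists>C. \<forall>x\<in>V. nrm (S t x) \<le> C * nrm x" using C0 assms by (simp add: C0_semigroup_def)
    then show ?thesis using that by blast
  qed
  have "nrm (S t x) \<le> max C 0 * nrm x" if "x \<in> V" for x
    using C[OF that] mult_right_mono[of C "max C 0" "nrm x"] nrm_nonneg[OF that] by linarith
  then show ?thesis using that[of "max C 0"] by simp
qed

text \<open>Linearity up to null vectors and boundedness of the single operator \<open>S t\<close>
  make it respect classes.\<close>

lemma emb_S_cong: "0 \<le> t \<Longrightarrow> x \<in> V \<Longrightarrow> y \<in> V \<Longrightarrow> emb x = emb y \<Longrightarrow> emb (S t x) = emb (S t y)"
proof -
  assume *: "0 \<le> t" "x \<in> V" "y \<in> V" "emb x = emb y"
  obtain C where C: "\<And>x. x \<in> V \<Longrightarrow> nrm (S t x) \<le> C * nrm x" using S_bound[OF *(1)] by blast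
  have "norm (emb (S t (x - y))) \<le> C * norm (emb (x - y))"
    using C[of "x - y"] * by (simp add: nrm_emb S_in V_diff)
  then show ?thesis using * by (simp add: emb_diff emb_S_diff)
qed

lemma S_right: "x \<in> V \<Longrightarrow> ((\<lambda>t. nrm (S t x - x)) \<longlongrightarrow> 0) (at_right 0)"
  using C0 by (simp add: C0_semigroup_def)

text \<open>Otherwise there are times h n tending to 0 at which the operator norm exceeds n. Each
  orbit is bounded along these times by right continuity at 0, so the uniform boundedness principle
  contradicts the growth.\<close>

lemma S_bounded_initially:
  obtains d M where "0 < d" "0 \<le> M" "\<And>h x. 0 \<le> h \<Longrightarrow> h \<le> d \<Longrightarrow> x \<in> V \<Longrightarrow> nrm (S h x) \<le> M * nrm x"
proof -
  have "\<exists>d>0. \<exists>M\<ge>0. \<forall>h x. 0 \<le> h \<and> h \<le> d \<and> x \<in> V \<longrightarrow> nrm (S h x) \<le> M * nrm x"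
  proof (rule ccontr)
    assume neg: "\<not> ?thesis"
    have "\<exists>h x. 0 \<le> h \<and> h \<le> 1 / Suc n \<and> x \<in> V \<and> real n * nrm x < nrm (S h x)" for n
    proof (rule ccontr)
      assume "\<not> ?thesis"
      then have "\<forall>h x. 0 \<le> h \<and> h \<le> 1 / Suc n \<and> x \<in> V \<longrightarrow> nrm (S h x) \<le> real n * nrm x" by (meson not_le)
      moreover have "0 < 1 / real (Suc n)" "0 \<le> real n" by simp_all
      ultimately show False using neg by blast
    qed
    then obtain h y where h: "\<And>n. 0 \<le> h n" "\<And>n. h n \<le> 1 / Suc n"
      and y: "\<And>n. y n \<in> V" "\<And>n. real n * nrm (y n) < nrm (S (h n) (y n))" by metis
    have h0: "h \<longlonglongrightarrow> 0"
    proof (rule tendsto_sandwich[OF always_eventually always_eventually tendsto_const])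
      show "(\<lambda>n. 1 / real (Suc n)) \<longlonglongrightarrow> 0" using LIMSEQ_inverse_real_of_nat by (simp add: inverse_eq_divide)
    qed (use h in blast)+
    have "\<exists>K. \<forall>n. \<forall>x\<in>V. nrm (S (h n) x) \<le> K * nrm x"
    proof (rule uniform_boundedness)
      fix n x y c assume x: "x \<in> V"
      show "nrm (S (h n) (x + y)) \<le> nrm (S (h n) x) + nrm (S (h n) y)" if "y \<in> V"
        using x that h(1) by (simp add: nrm_emb S_in V_add emb_S_add norm_triangle_ineq)
      show "nrm (S (h n) (c *\<^sub>R x)) = \<bar>c\<bar> * nrm (S (h n) x)"
        using x h(1) by (simp add: nrm_emb S_in V_scale emb_S_scale)
    next
      show "\<exists>C. \<forall>x\<in>V. nrm (S (h n) x) \<le> C * nrm x" for n using S_bound[OF h(1)[of n]] by metis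
    next
      fix x assume x: "x \<in> V"
      \<comment> \<open>Some \<open>h n\<close> may be 0, so the limit from the right is first
        completed to continuity at 0 within the nonnegative reals.\<close>
      have "((\<lambda>t. nrm (S t x - x)) \<longlongrightarrow> nrm (S 0 x - x)) (at_right 0)"
        using S_right[OF x] x emb_S_0[OF x] by (simp add: nrm_emb[of "S 0 x - x"] V_diff S_in emb_diff)
      then have "((\<lambda>t. nrm (S t x - x)) \<circ> h) \<longlonglongrightarrow> nrm (S 0 x - x)"
        using h0 h(1) continuous_within_sequentially[of 0 "{0..}" "\<lambda>t. nrm (S t x - x)"]
        by (simp add: continuous_within at_within_Ici_at_right)
      then have "Bseq ((\<lambda>t. nrm (S t x - x)) \<circ> h)" by (intro convergent_imp_Bseq convergentI)
      then obtain K where K: "\<And>n. norm (nrm (S (h n) x - x)) \<le> K" unfolding Bseq_def by auto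
      have "nrm (S (h n) x) \<le> K + nrm x" for n
        using nrm_triangle[of "S (h n) x - x" x] K[of n] x h(1) by (simp add: V_diff S_in)
      then show "\<exists>K. \<forall>n. nrm (S (h n) x) \<le> K" by blast
    qed
    then obtain K where K: "\<And>n x. x \<in> V \<Longrightarrow> nrm (S (h n) x) \<le> K * nrm x" by blast
    obtain n where "K < real n" using reals_Archimedean2 by blast
    then have "K * nrm (y n) \<le> real n * nrm (y n)" using nrm_nonneg[OF y(1)] by (intro mult_right_mono) auto
    then show False using K[OF y(1), of n n] y(2)[of n] by linarith
  qed
  then show ?thesis using that by blast
qed

text \<open>Times near \<open>t\<close> are reached by one fixed operator at a time s0 slightly
  before \<open>t\<close> (or at 0), followed by a time of at most d, to which the initial bound
  applies. The part to the left of \<open>t\<close> is what left continuity of the orbits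
  requires.\<close>

lemma S_bounded_near:
  assumes "0 \<le> t"
  obtains d K where "0 < d" "0 \<le> K" "\<And>s x. 0 \<le> s \<Longrightarrow> \<bar>s - t\<bar> < d \<Longrightarrow> x \<in> V \<Longrightarrow> nrm (S s x) \<le> K * nrm x"
proof -
  obtain d M where d: "0 < d" "0 \<le> M" "\<And>h x. 0 \<le> h \<Longrightarrow> h \<le> d \<Longrightarrow> x \<in> V \<Longrightarrow> nrm (S h x) \<le> M * nrm x"
    using S_bounded_initially by metis
  define s0 where "s0 = max 0 (t - d / 2)"
  have s0: "0 \<le> s0" by (simp add: s0_def)
  obtain C where C: "0 \<le> C" "\<And>x. x \<in> V \<Longrightarrow> nrm (S s0 x) \<le> C * nrm x" using S_bound[OF s0] by metis
  have "nrm (S s x) \<le> (M * C) * nrm x" if s: "0 \<le> s" "\<bar>s - t\<bar> < d / 2" and x: "x \<in> V" for s x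
  proof -
    have h: "0 \<le> s - s0" "s - s0 \<le> d" using s d(1) assms unfolding s0_def by linarith+
    have "emb (S s x) = emb (S (s - s0) (S s0 x))" using emb_S_plus[OF h(1) s0 x] by simp
    then have "nrm (S s x) = nrm (S (s - s0) (S s0 x))"
      using nrm_emb s h s0 x S_in by metis
    also have "\<dots> \<le> M * nrm (S s0 x)" using d(3)[OF h] S_in s0 x by blast
    also have "\<dots> \<le> M * (C * nrm x)" using C(2)[OF x] d(2) by (intro mult_left_mono)
    finally show ?thesis by simp
  qed
  then show ?thesis using that[of "d / 2" "M * C"] d C by simp
qed

text \<open>The earlier of the two times is factored out. To the left of \<open>t\<close> the outer
  operator \<open>S s\<close> varies with s, so this identity has to be combined with a locally
  uniform bound.\<close>

lemma S_increment:
  assumes "0 \<le> s" "0 \<le> t" "x \<in> V"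
  shows "nrm (S s x - S t x) = nrm (S (min s t) (S \<bar>s - t\<bar> x - x))"
proof -
  have *: "nrm (S (r + h) x - S r x) = nrm (S r (S h x - x))" if "0 \<le> r" "0 \<le> h" for r h
    using that assms(3) by (simp add: nrm_emb V_diff S_in emb_diff emb_S_diff emb_S_plus)
  show ?thesis
  proof (cases "t \<le> s")
    case True
    then show ?thesis using *[of t "s - t"] assms by simp
  next
    case False
    then show ?thesis using *[of s "t - s"] assms nrm_minus_commute[of "S s x" "S t x"] by (simp add: S_in)
  qed
qed

lemma S_continuous:
  assumes "x \<in> V" "0 \<le> t"
  shows "((\<lambda>s. nrm (S s x - S t x)) \<longlongrightarrow> 0) (at t within {0..})"
proof -
  obtain d K where d: "0 < d" "0 \<le> K" "\<And>s x. 0 \<le> s \<Longrightarrow> \<bar>s - t\<bar> < d \<Longrightarrow> x \<in> V \<Longrightarrow> nrm (S s x) \<le> K * nrm x"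
    using S_bounded_near[OF assms(2)] by metis
  show ?thesis
  proof (rule tendsto_two_sided[OF _ d(1)])
    show "((\<lambda>h. K * nrm (S h x - x)) \<longlongrightarrow> 0) (at_right 0)"
      using tendsto_mult[OF tendsto_const S_right[OF assms(1)], of K] by simp
    fix s :: real assume s: "0 \<le> s" "\<bar>s - t\<bar> < d"
    show "0 \<le> nrm (S s x - S t x) \<and> nrm (S s x - S t x) \<le> K * nrm (S \<bar>s - t\<bar> x - x)"
      unfolding S_increment[OF s(1) assms(2,1)] using s assms
      by (intro conjI d(3) nrm_nonneg S_in V_diff) (auto simp: min_def)
  qed
qed

text \<open>\<open>S t\<close> commutes with the difference quotients at 0 and is bounded, so the
  orbit of \<open>S t x\<close> has the right derivative S t (B x) at 0; \<open>generated_by\<close>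
  translates this back into membership in \<open>D\<close>.\<close>

lemma S_in_D:
  assumes "x \<in> D" "0 \<le> t"
  shows "S t x \<in> D" "emb (B (S t x)) = emb (S t (B x))"
proof -
  have xV: "x \<in> V" "B x \<in> V" using assms D_in B_in by auto
  obtain C where C: "0 \<le> C" "\<And>x. x \<in> V \<Longrightarrow> nrm (S t x) \<le> C * nrm x" using S_bound[OF assms(2)] by metis
  have "((\<lambda>h. nrm ((1 / h) *\<^sub>R (S h x - x) - B x)) \<longlongrightarrow> 0) (at_right 0)"
    using generated xV assms(1) by (auto simp: generated_by_def eqv_iff)
  then have lim: "((\<lambda>h. C * nrm ((1 / h) *\<^sub>R (S h x - x) - B x)) \<longlongrightarrow> 0) (at_right 0)"
    using tendsto_mult[OF tendsto_const, of _ 0 _ C] by fastforce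
  have "((\<lambda>h. nrm ((1 / h) *\<^sub>R (S h (S t x) - S t x) - S t (B x))) \<longlongrightarrow> 0) (at_right 0)"
  proof (rule Lim_null_comparison[OF _ lim])
    show "\<forall>\<^sub>F h in at_right 0. norm (nrm ((1 / h) *\<^sub>R (S h (S t x) - S t x) - S t (B x)))
        \<le> C * nrm ((1 / h) *\<^sub>R (S h x - x) - B x)"
      using eventually_at_right_less[of 0]
    proof eventually_elim
      case (elim h)
      have "emb (S h (S t x)) = emb (S t (S h x))"
        using emb_S_plus[of h t x] emb_S_plus[of t h x] elim assms xV by (simp add: add.commute)
      then have "nrm ((1 / h) *\<^sub>R (S h (S t x) - S t x) - S t (B x)) = nrm (S t ((1 / h) *\<^sub>R (S h x - x) - B x))"
        using elim assms xV by (simp add: nrm_emb V_diff V_scale S_in emb_diff emb_scale emb_S_diff emb_S_scale)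
      then show ?case
        using C(2)[of "(1 / h) *\<^sub>R (S h x - x) - B x"] elim assms xV
        by (simp add: V_diff V_scale S_in nrm_nonneg)
    qed
  qed
  then have "S t x \<in> D \<and> eqv nrm (B (S t x)) (S t (B x))"
    using generated xV assms(2) by (simp add: generated_by_def S_in)
  then show "S t x \<in> D" "emb (B (S t x)) = emb (S t (B x))"
    using xV assms(2) by (auto simp: eqv_iff B_in S_in)
qed

theorem orbit_derivative:
  assumes "x \<in> D"
  shows "has_time_derivative V nrm (\<lambda>t. S t x) (\<lambda>t. B (S t x))"
  unfolding has_time_derivative_def
proof (intro allI impI conjI)
  fix t :: real assume t: "0 \<le> t"
  have xV: "x \<in> V" "B x \<in> V" using assms D_in B_in by auto
  show "S t x \<in> V" "B (S t x) \<in> V" using S_in t xV S_in_D[OF assms t] B_in by auto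
  obtain d K where d: "0 < d" "0 \<le> K" "\<And>s x. 0 \<le> s \<Longrightarrow> \<bar>s - t\<bar> < d \<Longrightarrow> x \<in> V \<Longrightarrow> nrm (S s x) \<le> K * nrm x"
    using S_bounded_near[OF t] by metis
  let ?q = "\<lambda>h. (1 / h) *\<^sub>R (S h x - x) - B x"
  have "((\<lambda>h. nrm (?q h)) \<longlongrightarrow> 0) (at_right 0)"
    using generated xV assms(1) by (auto simp: generated_by_def eqv_iff)
  from tendsto_mult[OF tendsto_const tendsto_add[OF this S_right[OF xV(2)]], of K]
  have lim: "((\<lambda>h. K * (nrm (?q h) + nrm (S h (B x) - B x))) \<longlongrightarrow> 0) (at_right 0)" by simp
  show "((\<lambda>s. nrm ((1 / (s - t)) *\<^sub>R (S s x - S t x) - B (S t x))) \<longlongrightarrow> 0) (at t within {0..})"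
  proof (rule tendsto_two_sided[OF lim d(1)])
    fix s :: real assume s: "0 \<le> s" "s \<noteq> t" "\<bar>s - t\<bar> < d"
    define h where "h = \<bar>s - t\<bar>"
    define r where "r = min s t"
    have h: "0 < h" "0 \<le> r" "0 \<le> h" using s t by (auto simp: h_def r_def)
    have qV: "?q h \<in> V" "S h (B x) - B x \<in> V" using h xV by (auto intro!: V_diff V_scale S_in)
    \<comment> \<open>For s < t the quotient is S s applied to the quotient at 0, but the target B
      (S t x) equals S s (S h (B x)); this produces the second term, which is small by right
      continuity of the orbit of \<open>B x\<close>.\<close>
    have diff: "emb ((1 / (s - t)) *\<^sub>R (S s x - S t x) - B (S t x)) =
        emb (S r (?q h)) - (if s < t then emb (S r (S h (B x) - B x)) else 0)"
    proof (cases "s < t")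
      case True
      then have st: "r = s" "t = s + h" by (auto simp: r_def h_def)
      have hh: "s - t = - h" using st by simp
      show ?thesis unfolding if_P[OF True] using xV s t h S_in_D[OF assms t] unfolding hh unfolding st
        by (simp add: V_diff V_scale S_in B_in emb_diff emb_scale emb_S_diff emb_S_scale emb_S_plus
            scaleR_diff_right)
    next
      case False
      then have st: "r = t" "s = t + h" "s - t = h" using s by (auto simp: r_def h_def)
      show ?thesis unfolding if_not_P[OF False] unfolding st using xV t h S_in_D[OF assms t]
        by (simp add: V_diff V_scale S_in B_in emb_diff emb_scale emb_S_diff emb_S_scale emb_S_plus
            scaleR_diff_right)
    qed
    have rb: "nrm (S r w) \<le> K * nrm w" if "w \<in> V" for w
      using that s t d by (cases "s \<le> t") (auto simp: r_def min_def intro!: d(3))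
    have inV: "(1 / (s - t)) *\<^sub>R (S s x - S t x) - B (S t x) \<in> V"
      using s t xV S_in_D[OF assms t] by (intro V_diff V_scale S_in B_in)
    have "nrm ((1 / (s - t)) *\<^sub>R (S s x - S t x) - B (S t x)) =
        norm (emb (S r (?q h)) - (if s < t then emb (S r (S h (B x) - B x)) else 0))"
      unfolding nrm_emb[OF inV] diff ..
    also have "\<dots> \<le> nrm (S r (?q h)) + nrm (S r (S h (B x) - B x))"
      using norm_triangle_ineq4[of "emb (S r (?q h))" "emb (S r (S h (B x) - B x))"] qV h
      by (auto simp: nrm_emb S_in)
    also have "\<dots> \<le> K * (nrm (?q h) + nrm (S h (B x) - B x))"
      unfolding distrib_left by (intro add_mono rb qV)
    finally show "0 \<le> nrm ((1 / (s - t)) *\<^sub>R (S s x - S t x) - B (S t x)) \<and>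
        nrm ((1 / (s - t)) *\<^sub>R (S s x - S t x) - B (S t x)) \<le>
        K * (nrm (?q \<bar>s - t\<bar>) + nrm (S \<bar>s - t\<bar> (B x) - B x))"
      using nrm_nonneg[OF inV] by (simp add: h_def)
  qed
qed

lemma orbit_derivative_continuous:
  assumes "x \<in> D" "0 \<le> t"
  shows "((\<lambda>s. nrm (B (S s x) - B (S t x))) \<longlongrightarrow> 0) (at t within {0..})"
proof (rule Lim_transform_eventually[OF S_continuous[of "B x" t]])
  have "\<forall>\<^sub>F s in at t within {0..}. 0 \<le> s" by (simp add: eventually_at_filter)
  then show "\<forall>\<^sub>F s in at t within {0..}. nrm (S s (B x) - S t (B x)) = nrm (B (S s x) - B (S t x))"
    by eventually_elim (use assms S_in_D[OF assms(1)] in \<open>simp add: nrm_emb V_diff S_in B_in emb_diff\<close>)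
qed (use assms B_in in auto)

end

section \<open>Energy decay and uniqueness of the semigroup\<close>

context dissipative_operator
begin

text \<open>With q the difference quotient of \<open>w\<close>, that of the energy equals 2 ip (w t)
  q + (s - t) (nrm q)^2 exactly, so convergence of q in the seminorm suffices.\<close>

lemma energy_derivative:
  assumes "has_time_derivative V nrm w z" "0 \<le> t"
  shows "((\<lambda>s. ip (w s) (w s)) has_real_derivative 2 * ip (w t) (z t)) (at t within {0..})"
  unfolding has_field_derivative_iff
proof (rule Lim_transform_eventually)
  let ?F = "at t within {0..}"
  let ?q = "\<lambda>s. (1 / (s - t)) *\<^sub>R (w s - w t)"
  have wV: "w s \<in> V" "z s \<in> V" if "0 \<le> s" for s using assms(1) that by (auto simp: has_time_derivative_def)
  have lim: "((\<lambda>s. nrm (?q s - z t)) \<longlongrightarrow> 0) ?F"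
    using assms by (simp add: has_time_derivative_def)
  have pos: "\<forall>\<^sub>F s in ?F. 0 \<le> s" by (simp add: eventually_at_filter)
  have qV: "\<forall>\<^sub>F s in ?F. ?q s \<in> V"
    using pos by eventually_elim (use wV assms(2) in \<open>auto intro!: V_scale V_diff\<close>)
  have "((\<lambda>s. s - t) \<longlongrightarrow> t - t) ?F" by (intro tendsto_intros)
  then have st: "((\<lambda>s. s - t) \<longlongrightarrow> 0) ?F" by simp
  have "((\<lambda>s. 2 * ip (w t) (?q s) + (s - t) * (nrm (?q s))\<^sup>2) \<longlongrightarrow> 2 * ip (w t) (z t) + 0 * (nrm (z t))\<^sup>2) ?F"
    by (intro tendsto_add tendsto_mult tendsto_const tendsto_power st
        tendsto_ip[OF qV _ _ lim] tendsto_nrm[OF qV _ lim] wV assms(2))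
  then show "((\<lambda>s. 2 * ip (w t) (?q s) + (s - t) * (nrm (?q s))\<^sup>2) \<longlongrightarrow> 2 * ip (w t) (z t)) ?F" by simp
  have ne: "\<forall>\<^sub>F s in ?F. s \<noteq> t" by (simp add: eventually_at_filter)
  show "\<forall>\<^sub>F s in ?F. 2 * ip (w t) (?q s) + (s - t) * (nrm (?q s))\<^sup>2 = (ip (w s) (w s) - ip (w t) (w t)) / (s - t)"
    using pos ne
  proof eventually_elim
    case (elim s)
    define v where "v = w s - w t"
    have v: "v \<in> V" "w s = w t + v" using wV elim assms(2) by (auto simp: v_def V_diff)
    have "(nrm (?q s))\<^sup>2 = ip v v / (s - t)\<^sup>2"
      using v unfolding v_def[symmetric] by (simp add: nrm_scale power_mult_distrib nrm_sq power_divide)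
    moreover have "ip (w t) (?q s) = ip (w t) v / (s - t)"
      using v wV assms(2) unfolding v_def[symmetric] by (simp add: ip_bilinear)
    moreover have "ip (w s) (w s) - ip (w t) (w t) = 2 * ip (w t) v + ip v v"
      unfolding v(2) using v wV[OF assms(2)] by (simp add: ip_bilinear ip_sym[of v "w t"])
    moreover have "2 * (a / h) + h * (b / h\<^sup>2) = (2 * a + b) / h" if "h \<noteq> 0" for a b h :: real
      using that by (simp add: field_simps power2_eq_square)
    ultimately show ?case using elim by (metis right_minus_eq)
  qed
qed

lemma dissipative_solution_decreasing:
  assumes "has_time_derivative V nrm w z" "0 \<le> t"
    and "\<And>s. 0 \<le> s \<Longrightarrow> ip (w s) (z s) \<le> 0"
  shows "nrm (w t) \<le> nrm (w 0)"
proof (cases "t = 0")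
  case False
  have "ip (w t) (w t) \<le> ip (w 0) (w 0)"
  proof (rule DERIV_nonpos_imp_decreasing_open[of 0 t "\<lambda>s. ip (w s) (w s)"])
    show "0 \<le> t" by fact
    fix s :: real assume "0 < s" "s < t"
    then have "((\<lambda>s. ip (w s) (w s)) has_real_derivative 2 * ip (w s) (z s)) (at s within {0<..})"
      by (intro DERIV_subset[OF energy_derivative[OF assms(1), of s]]) auto
    moreover have "at s within {0<..} = at s" using \<open>0 < s\<close> by (intro at_within_open) auto
    ultimately have "((\<lambda>s. ip (w s) (w s)) has_real_derivative 2 * ip (w s) (z s)) (at s)" by simp
    moreover have "2 * ip (w s) (z s) \<le> 0" using assms(3)[of s] \<open>0 < s\<close> by simp
    ultimately show "\<exists>y. ((\<lambda>s. ip (w s) (w s)) has_real_derivative y) (at s) \<and> y \<le> 0" by blast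
  next
    show "continuous_on {0..t} (\<lambda>s. ip (w s) (w s))"
    proof (rule DERIV_continuous_on)
      fix s assume "s \<in> {0..t}"
      then have "((\<lambda>s. ip (w s) (w s)) has_real_derivative 2 * ip (w s) (z s)) (at s within {0..})"
        by (intro energy_derivative[OF assms(1)]) simp
      then show "((\<lambda>s. ip (w s) (w s)) has_real_derivative 2 * ip (w s) (z s)) (at s within {0..t})"
        by (rule DERIV_subset) auto
    qed
  qed
  then show ?thesis by (simp add: nrm_def)
qed simp

end

context generated_semigroup
begin

text \<open>On \<open>D\<close> the energy decreases along orbits. For general \<open>x\<close>,
  density is combined with the bound C at time \<open>t\<close>: the error (C + 1) nrm (x - z) can
  be made arbitrarily small, so the final constant is 1 whatever C was.\<close>

lemma S_nrm:
  assumes "x \<in> V" "0 \<le> t" shows "nrm (S t x) \<le> nrm x"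
proof (rule field_le_epsilon)
  fix e :: real assume e: "0 < e"
  obtain C where C: "0 \<le> C" "\<And>x. x \<in> V \<Longrightarrow> nrm (S t x) \<le> C * nrm x" using S_bound[OF assms(2)] by metis
  obtain z where z: "z \<in> D" "nrm (x - z) < e / (C + 1)"
    using D_dense[OF assms(1), of "e / (C + 1)"] e C(1) by auto
  have zV: "z \<in> V" using z D_in by blast
  have "nrm (S t z) \<le> nrm (S 0 z)"
  proof (rule dissipative_solution_decreasing[OF orbit_derivative[OF z(1)] assms(2)])
    fix s :: real assume "0 \<le> s"
    then have "S s z \<in> D" using S_in_D z by blast
    then show "ip (S s z) (B (S s z)) \<le> 0" using B_dissipative ip_sym D_in B_in by metis
  qed
  also have "\<dots> = nrm z" using emb_S_0[OF zV] zV by (simp add: nrm_emb S_in)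
  finally have "nrm (S t z) \<le> nrm z" .
  moreover have "nrm z \<le> nrm x + nrm (x - z)"
    using norm_triangle_ineq4[of "emb x" "emb (x - z)"] zV assms by (simp add: nrm_emb V_diff emb_diff)
  moreover have "nrm (S t x) \<le> nrm (S t z) + nrm (S t (x - z))"
    using norm_triangle_ineq[of "emb (S t z)" "emb (S t (x - z))"] zV assms
    by (simp add: nrm_emb V_diff S_in emb_S_diff)
  moreover have "nrm (S t (x - z)) \<le> C * nrm (x - z)" using C(2) zV assms V_diff by blast
  ultimately have "nrm (S t x) \<le> nrm x + (C + 1) * nrm (x - z)" by (simp add: algebra_simps)
  also have "(C + 1) * nrm (x - z) \<le> e"
    using z(2) C(1) by (simp add: field_simps)
  finally show "nrm (S t x) \<le> nrm x + e" by simp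
qed

text \<open>For data in \<open>D\<close> the difference of the two orbits solves w' = B w with null
  initial value, and energy decay keeps it null. Contractivity of both semigroups extends the
  equality from the dense set \<open>D\<close>.\<close>

theorem semigroup_unique:
  assumes "C0_semigroup V nrm R" "generated_by V nrm R D B" "x \<in> V" "0 \<le> t"
  shows "eqv nrm (S t x) (R t x)"
proof -
  interpret R: generated_semigroup V ip D B R by unfold_locales fact+
  have on_D: "emb (S t z) = emb (R t z)" if z: "z \<in> D" for z
  proof -
    have zV: "z \<in> V" using z D_in by blast
    have "has_time_derivative V nrm (\<lambda>t. S t z - R t z) (\<lambda>t. B (S t z) - B (R t z))"
      unfolding has_time_derivative_def
    proof (intro allI impI conjI)
      fix t :: real assume t: "0 \<le> t"
      show "S t z - R t z \<in> V" "B (S t z) - B (R t z) \<in> V"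
        using t zV z S_in R.S_in S_in_D R.S_in_D B_in by (auto intro!: V_diff)
      have "((\<lambda>s. nrm ((1 / (s - t)) *\<^sub>R (S s z - S t z) - B (S t z)) +
          nrm ((1 / (s - t)) *\<^sub>R (R s z - R t z) - B (R t z))) \<longlongrightarrow> 0) (at t within {0..})"
        using orbit_derivative[OF z] R.orbit_derivative[OF z] t
        by (intro tendsto_add_zero) (auto simp: has_time_derivative_def)
      then show "((\<lambda>s. nrm ((1 / (s - t)) *\<^sub>R (S s z - R s z - (S t z - R t z)) - (B (S t z) - B (R t z)))) \<longlongrightarrow> 0) (at t within {0..})"
      proof (rule Lim_null_comparison[rotated])
        have "\<forall>\<^sub>F s in at t within {0..}. 0 \<le> s" by (simp add: eventually_at_filter)
        then show "\<forall>\<^sub>F s in at t within {0..}. norm (nrm ((1 / (s - t)) *\<^sub>R (S s z - R s z - (S t z - R t z)) - (B (S t z) - B (R t z))))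
          \<le> nrm ((1 / (s - t)) *\<^sub>R (S s z - S t z) - B (S t z)) + nrm ((1 / (s - t)) *\<^sub>R (R s z - R t z) - B (R t z))"
        proof eventually_elim
          case (elim s)
          let ?p = "(1 / (s - t)) *\<^sub>R (S s z - S t z) - B (S t z)"
          let ?r = "(1 / (s - t)) *\<^sub>R (R s z - R t z) - B (R t z)"
          have pr: "?p \<in> V" "?r \<in> V"
            using t elim zV z S_in R.S_in S_in_D R.S_in_D B_in by (auto intro!: V_diff V_scale)
          have "(1 / (s - t)) *\<^sub>R (S s z - R s z - (S t z - R t z)) - (B (S t z) - B (R t z)) = ?p - ?r"
            by (simp add: scaleR_diff_right)
          then show ?case
            using pr norm_triangle_ineq4[of "emb ?p" "emb ?r"] nrm_nonneg[OF V_diff[OF pr]]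
            by (simp only: nrm_emb V_diff emb_diff real_norm_def abs_norm_cancel)
        qed
      qed
    qed
    then have "nrm (S t z - R t z) \<le> nrm (S 0 z - R 0 z)"
    proof (rule dissipative_solution_decreasing[OF _ assms(4)])
      fix s :: real assume s: "0 \<le> s"
      have D: "S s z \<in> D" "R s z \<in> D" using s z S_in_D R.S_in_D by auto
      have V: "S s z - R s z \<in> V" "B (S s z) - B (R s z) \<in> V" "B (S s z - R s z) \<in> V"
        using D D_in B_in V_diff D_diff by auto
      \<comment> \<open>Dissipativity speaks of B applied to the difference, while the derivative is
        the difference of the images; the two agree up to a null vector, which the inner product
        does not see.\<close>
      have "nrm (B (S s z - R s z) - (B (S s z) - B (R s z))) = 0"
        using V D by (simp add: nrm_emb V_diff emb_diff emb_B_diff B_in)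
      then have "ip (B (S s z - R s z) - (B (S s z) - B (R s z))) (S s z - R s z) = 0"
        using V by (intro ip_null) (auto simp: V_diff)
      then have "ip (B (S s z) - B (R s z)) (S s z - R s z) \<le> 0"
        using B_dissipative[OF D_diff[OF D]] V by (simp add: ip_diff V_diff)
      then show "ip (S s z - R s z) (B (S s z) - B (R s z)) \<le> 0" using ip_sym V by metis
    qed
    also have "\<dots> = 0" using zV by (simp add: nrm_emb V_diff S_in R.S_in emb_diff emb_S_0 R.emb_S_0)
    finally show ?thesis using zV assms(4) nrm_nonneg[of "S t z - R t z"]
      by (simp add: emb_eq_iff S_in R.S_in V_diff)
  qed
  have "norm (emb (S t x) - emb (R t x)) \<le> 0 + e" if e: "0 < e" for e
  proof -
    obtain z where z: "z \<in> D" "nrm (x - z) < e / 2" using D_dense[OF assms(3), of "e / 2"] e by auto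
    have zV: "z \<in> V" using z D_in by blast
    have "emb (S t x) - emb (R t x) = emb (S t (x - z)) - emb (R t (x - z))"
      using on_D[OF z(1)] zV assms by (simp add: emb_S_diff R.emb_S_diff)
    also have "norm \<dots> \<le> nrm (S t (x - z)) + nrm (R t (x - z))"
      using norm_triangle_ineq4 zV assms by (simp add: nrm_emb S_in R.S_in V_diff)
    also have "\<dots> \<le> e" using S_nrm[of "x - z" t] R.S_nrm[of "x - z" t] z(2) zV assms V_diff by fastforce
    finally show ?thesis by simp
  qed
  then have "norm (emb (S t x) - emb (R t x)) \<le> 0" by (rule field_le_epsilon)
  then show ?thesis using assms by (simp add: eqv_iff S_in R.S_in)
qed

end

section \<open>Test functions\<close>

definition quad :: "real \<Rightarrow> real \<Rightarrow> real poly" where "quad c d = [:- c * d, c + d, -1:]"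

text \<open>This family of functions supported in \<open>[c, d]\<close> is closed under differentiation.\<close>

definition bump :: "real \<Rightarrow> real \<Rightarrow> real \<Rightarrow> real poly \<Rightarrow> nat \<Rightarrow> real \<Rightarrow> real" where
  "bump c d e p k x =
     (if c < x \<and> x < d then poly p x / poly (quad c d) x ^ k * exp (- e / poly (quad c d) x) else 0)"

text \<open>With w = (x - c) (d - x), differentiating p w^(-k) exp (-e / w) gives w^(-k-2) exp (-e /
  w) times p' w^2 - k p w' w + e p w', which is this polynomial.\<close>

definition bump_deriv :: "real \<Rightarrow> real \<Rightarrow> real \<Rightarrow> real poly \<Rightarrow> nat \<Rightarrow> real poly" where
  "bump_deriv c d e p k = pderiv p * (quad c d)\<^sup>2 - smult (real k) (p * pderiv (quad c d) * quad c d)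
     + smult e (p * pderiv (quad c d))"

lemma poly_quad: "poly (quad c d) x = (x - c) * (d - x)"
  by (simp add: quad_def algebra_simps)

lemma poly_quad_pos: "c < x \<Longrightarrow> x < d \<Longrightarrow> 0 < poly (quad c d) x"
  by (simp add: poly_quad)

text \<open>A single term of the exponential series bounds \<open>exp y\<close> from below.\<close>

lemma exp_minus_le_power:
  fixes y :: real assumes "0 < y" shows "exp (- y) \<le> fact n / y ^ n"
proof -
  have "(\<Sum>i\<in>{n}. y ^ i /\<^sub>R fact i) \<le> exp y"
    unfolding exp_def using assms summable_exp_generic[of y] by (intro sum_le_suminf) auto
  then have "y ^ n \<le> fact n * exp y" by (simp add: field_simps)
  then show ?thesis using assms by (simp add: exp_minus field_simps)
qed

text \<open>Vanishing to second order at both ends makes these functions differentiable there with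
  derivative 0, whatever \<open>p\<close> and \<open>k\<close> are.\<close>

lemma bump_bound:
  assumes "0 < e" "c < d"
  obtains M where "0 \<le> M" "\<And>x. \<bar>bump c d e p k x\<bar> \<le> M * (x - c)\<^sup>2" "\<And>x. \<bar>bump c d e p k x\<bar> \<le> M * (x - d)\<^sup>2"
proof -
  have "compact (poly p ` {c..d})" by (intro compact_continuous_image continuous_intros compact_Icc)
  then obtain b where "\<forall>y\<in>poly p ` {c..d}. norm y \<le> b"
    using compact_imp_bounded[of "poly p ` {c..d}"] unfolding bounded_iff by blast
  then have b: "\<bar>poly p x\<bar> \<le> b" if "x \<in> {c..d}" for x using that by auto
  have b0: "0 \<le> b" using b[of c] assms by force
  \<comment> \<open>The power k + 2 of w = \<open>poly (quad c d) x\<close> in the estimate of the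
    exponential cancels the denominator w^k and leaves w^2.\<close>
  define K where "K = b * fact (k + 2) / e ^ (k + 2)"
  have K: "0 \<le> K" using b0 assms by (simp add: K_def)
  have main: "\<bar>bump c d e p k x\<bar> \<le> K * (poly (quad c d) x)\<^sup>2" if x: "c < x" "x < d" for x
  proof -
    let ?w = "poly (quad c d) x"
    have w: "0 < ?w" using poly_quad_pos x .
    have "exp (- (e / ?w)) \<le> fact (k + 2) / (e / ?w) ^ (k + 2)"
      using assms w by (intro exp_minus_le_power) simp
    also have "\<dots> = fact (k + 2) * ?w ^ (k + 2) / e ^ (k + 2)" by (simp add: power_divide)
    finally have E: "exp (- e / ?w) \<le> fact (k + 2) * ?w ^ (k + 2) / e ^ (k + 2)" by simp
    have "\<bar>bump c d e p k x\<bar> = \<bar>poly p x\<bar> / ?w ^ k * exp (- e / ?w)"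
      using x w by (simp add: bump_def abs_mult)
    also have "\<dots> \<le> b / ?w ^ k * (fact (k + 2) * ?w ^ (k + 2) / e ^ (k + 2))"
      using x w b[of x] b0 E by (intro mult_mono divide_right_mono) auto
    also have "\<dots> = K * ?w\<^sup>2" using w assms unfolding K_def power_add by (simp del: fact_Suc)
    finally show ?thesis .
  qed
  have "\<bar>bump c d e p k x\<bar> \<le> (K * (d - c)\<^sup>2) * (x - c)\<^sup>2 \<and> \<bar>bump c d e p k x\<bar> \<le> (K * (d - c)\<^sup>2) * (x - d)\<^sup>2" for x
  proof (cases "c < x \<and> x < d")
    case True
    have "(poly (quad c d) x)\<^sup>2 \<le> (d - c)\<^sup>2 * (x - c)\<^sup>2"
      unfolding poly_quad power_mult_distrib using True
      by (subst mult.commute, intro mult_right_mono power_mono) auto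
    moreover have "(poly (quad c d) x)\<^sup>2 \<le> (d - c)\<^sup>2 * (x - d)\<^sup>2"
      unfolding poly_quad power_mult_distrib power2_commute[of x d] using True
      by (intro mult_right_mono power_mono) auto
    ultimately have "K * (poly (quad c d) x)\<^sup>2 \<le> K * ((d - c)\<^sup>2 * (x - c)\<^sup>2)"
        "K * (poly (quad c d) x)\<^sup>2 \<le> K * ((d - c)\<^sup>2 * (x - d)\<^sup>2)"
      using K by (auto intro: mult_left_mono)
    then show ?thesis using main[of x] True by (auto simp: mult.assoc)
  qed (use K in \<open>auto simp: bump_def\<close>)
  then show ?thesis using that[of "K * (d - c)\<^sup>2"] K by auto
qed

lemma derivative_zero_quadratic:
  fixes f :: "real \<Rightarrow> real"
  assumes "f c = 0" "\<And>x. \<bar>f x\<bar> \<le> M * (x - c)\<^sup>2"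
  shows "(f has_real_derivative 0) (at c)"
  unfolding has_field_derivative_iff
proof (rule Lim_null_comparison)
  have "((\<lambda>x. M * \<bar>x - c\<bar>) \<longlongrightarrow> M * \<bar>c - c\<bar>) (at c)" by (intro tendsto_intros)
  then show "((\<lambda>x. M * \<bar>x - c\<bar>) \<longlongrightarrow> 0) (at c)" by simp
  have "\<bar>(f x - f c) / (x - c)\<bar> \<le> M * \<bar>x - c\<bar>" if "x \<noteq> c" for x
  proof -
    have "\<bar>(f x - f c) / (x - c)\<bar> = \<bar>f x\<bar> / \<bar>x - c\<bar>" by (simp add: assms(1))
    also have "\<dots> \<le> M * (x - c)\<^sup>2 / \<bar>x - c\<bar>" using assms(2) by (intro divide_right_mono) auto
    also have "\<dots> = M * \<bar>x - c\<bar>" using that by (simp add: field_simps power2_eq_square abs_if)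
    finally show ?thesis .
  qed
  then show "\<forall>\<^sub>F x in at c. norm ((f x - f c) / (x - c)) \<le> M * \<bar>x - c\<bar>"
    by (auto simp: eventually_at_filter)
qed

lemma bump_has_derivative:
  assumes "0 < e" "c < d"
  shows "(bump c d e p k has_real_derivative bump c d e (bump_deriv c d e p k) (k + 2) x) (at x)"
proof -
  obtain M where M: "\<And>x. \<bar>bump c d e p k x\<bar> \<le> M * (x - c)\<^sup>2" "\<And>x. \<bar>bump c d e p k x\<bar> \<le> M * (x - d)\<^sup>2"
    using bump_bound[OF assms] by metis
  consider "x < c" | "x = c" | "c < x" "x < d" | "x = d" | "d < x" by linarith
  then show ?thesis
  proof cases
    case 1
    have "((\<lambda>_. 0) has_real_derivative 0) (at x)" by simp
    then have "(bump c d e p k has_real_derivative 0) (at x)"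
      by (rule has_field_derivative_transform_within_open[of _ _ _ "{..<c}"]) (use 1 in \<open>auto simp: bump_def\<close>)
    then show ?thesis using 1 by (simp add: bump_def[of _ _ _ _ _ x])
  next
    case 5
    have "((\<lambda>_. 0) has_real_derivative 0) (at x)" by simp
    then have "(bump c d e p k has_real_derivative 0) (at x)"
      by (rule has_field_derivative_transform_within_open[of _ _ _ "{d<..}"]) (use 5 in \<open>auto simp: bump_def\<close>)
    then show ?thesis using 5 by (simp add: bump_def[of _ _ _ _ _ x])
  next
    case 2
    have "(bump c d e p k has_real_derivative 0) (at c)"
      by (rule derivative_zero_quadratic[OF _ M(1)]) (simp add: bump_def)
    then show ?thesis using 2 by (simp add: bump_def[of _ _ _ _ _ c])
  next
    case 4
    have "(bump c d e p k has_real_derivative 0) (at d)"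
      by (rule derivative_zero_quadratic[OF _ M(2)]) (simp add: bump_def)
    then show ?thesis using 4 by (simp add: bump_def[of _ _ _ _ _ d])
  next
    case 3
    let ?q = "quad c d"
    have w: "0 < poly ?q x" using poly_quad_pos 3 .
    define w' where "w' = poly (pderiv ?q) x"
    define W where "W = poly ?q x"
    define E where "E = exp (- e / W)"
    define P where "P = poly p x"
    define P' where "P' = poly (pderiv p) x"
    have W: "0 < W" using w by (simp add: W_def)
    have dq: "(poly ?q has_real_derivative w') (at x)" unfolding w'_def by (rule poly_DERIV)
    have dp: "(poly p has_real_derivative P') (at x)" unfolding P'_def by (rule poly_DERIV)
    have d1: "((\<lambda>x. poly p x / poly ?q x ^ k) has_real_derivative
        (P' * W ^ k - P * (real k * (W ^ (k - 1) * w'))) / (W ^ k * W ^ k)) (at x)"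
      using DERIV_divide[OF dp DERIV_power[OF dq, of k]] w by (simp add: W_def P_def ac_simps)
    have d2: "((\<lambda>x. exp (- e / poly ?q x)) has_real_derivative E * (e * w' / (W * W))) (at x)"
      using DERIV_fun_exp[OF DERIV_divide[OF DERIV_const[of "- e"] dq]] w
      by (simp add: W_def E_def mult.commute)
    have "((\<lambda>x. poly p x / poly ?q x ^ k * exp (- e / poly ?q x)) has_real_derivative
        (P' * W ^ k - P * (real k * (W ^ (k - 1) * w'))) / (W ^ k * W ^ k) * E + E * (e * w' / (W * W)) * (P / W ^ k)) (at x)"
      using DERIV_mult[OF d1 d2] by (simp add: W_def E_def P_def)
    also have "(P' * W ^ k - P * (real k * (W ^ (k - 1) * w'))) / (W ^ k * W ^ k) * E + E * (e * w' / (W * W)) * (P / W ^ k)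
        = bump c d e (bump_deriv c d e p k) (k + 2) x"
    proof -
      have kk: "real k * W ^ (k - 1) = real k * W ^ k / W" using W by (cases k) auto
      have quot: "(P' * W ^ k - P * (real k * (W ^ (k - 1) * w'))) / (W ^ k * W ^ k) = (P' - P * (real k * w') / W) / W ^ k"
      proof -
        have num: "P * (real k * (W ^ (k - 1) * w')) = P * (real k * w') / W * W ^ k"
        proof -
          have "P * (real k * (W ^ (k - 1) * w')) = P * w' * (real k * W ^ (k - 1))" by simp
          also have "\<dots> = P * (real k * w') / W * W ^ k" unfolding kk by simp
          finally show ?thesis .
        qed
        have "(P' * W ^ k - P * (real k * w') / W * W ^ k) / (W ^ k * W ^ k) = (P' - P * (real k * w') / W) / W ^ k"
          unfolding left_diff_distrib[symmetric] using W by simp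
        then show ?thesis unfolding num .
      qed
      have val: "bump c d e (bump_deriv c d e p k) (k + 2) x =
          (P' * W\<^sup>2 - real k * (P * w' * W) + e * (P * w')) / W ^ (k + 2) * E"
        using 3 by (simp add: bump_def bump_deriv_def W_def P_def P'_def w'_def E_def)
      show ?thesis unfolding quot val power_add using W by (simp add: field_simps power2_eq_square)
    qed
    finally show ?thesis
      by (rule has_field_derivative_transform_within_open[of _ _ _ "{c<..<d}"]) (use 3 in \<open>auto simp: bump_def\<close>)
  qed
qed

lemma bump_deriv_funpow:
  assumes "0 < e" "c < d"
  shows "\<exists>q m. (deriv ^^ n) (bump c d e p k) = bump c d e q m"
proof (induction n)
  case (Suc n)
  then obtain q m where "(deriv ^^ n) (bump c d e p k) = bump c d e q m" by blast
  then have "(deriv ^^ Suc n) (bump c d e p k) = bump c d e (bump_deriv c d e q m) (m + 2)"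
    using DERIV_imp_deriv[OF bump_has_derivative[OF assms, of q m]] by auto
  then show ?case by blast
qed auto

lemma test_function_bump:
  assumes "0 < e" "0 < c" "c < d" "d < 1"
  shows "test_function (bump c d e p k)"
  unfolding test_function_def
proof (intro conjI allI)
  fix n x
  obtain q m where "(deriv ^^ n) (bump c d e p k) = bump c d e q m"
    using bump_deriv_funpow[OF assms(1,3)] by blast
  then show "(deriv ^^ n) (bump c d e p k) field_differentiable at x"
    using bump_has_derivative[OF assms(1,3)] field_differentiable_def by metis
  show "\<exists>c' d'. 0 < c' \<and> c' < d' \<and> d' < 1 \<and> (\<forall>x. x \<notin> {c'..d'} \<longrightarrow> bump c d e p k x = 0)"
    using assms by (intro exI[of _ c] exI[of _ d]) (auto simp: bump_def)
qed

lemma test_function_support: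
  assumes "test_function \<phi>"
  obtains c d where "0 < c" "c < d" "d < 1" "\<And>x. x \<notin> {c..d} \<Longrightarrow> \<phi> x = 0"
  using assms unfolding test_function_def by blast

lemma test_function_DERIV:
  assumes "test_function \<phi>" shows "(\<phi> has_real_derivative deriv \<phi> x) (at x)"
proof -
  have "(deriv ^^ 0) \<phi> field_differentiable at x" using assms unfolding test_function_def by blast
  then show ?thesis by (simp add: field_differentiable_derivI DERIV_deriv_iff_field_differentiable)
qed

lemma test_function_continuous: "test_function \<phi> \<Longrightarrow> continuous_on S \<phi>"
  by (intro continuous_at_imp_continuous_on ballI DERIV_isCont[OF test_function_DERIV])

lemma test_function_deriv:
  assumes "test_function \<phi>" shows "test_function (deriv \<phi>)"
  unfolding test_function_def
proof (intro conjI allI)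
  fix n x
  have "(deriv ^^ n) (deriv \<phi>) = (deriv ^^ Suc n) \<phi>" by (simp add: funpow_swap1)
  then show "(deriv ^^ n) (deriv \<phi>) field_differentiable at x"
    using assms unfolding test_function_def by metis
  obtain c d where cd: "0 < c" "c < d" "d < 1" "\<And>x. x \<notin> {c..d} \<Longrightarrow> \<phi> x = 0"
    using test_function_support[OF assms] by blast
  have "deriv \<phi> x = 0" if "x \<notin> {c..d}" for x
  proof -
    have "((\<lambda>_. 0) has_real_derivative 0) (at x)" by simp
    then have "(\<phi> has_real_derivative 0) (at x)"
      by (rule has_field_derivative_transform_within_open[of _ _ _ "- {c..d}"])
        (use that cd(4) in auto)
    then show ?thesis by (rule DERIV_imp_deriv)
  qed
  then show "\<exists>c d. 0 < c \<and> c < d \<and> d < 1 \<and> (\<forall>x. x \<notin> {c..d} \<longrightarrow> deriv \<phi> x = 0)"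
    using cd by blast
qed

lemma test_function_deriv_funpow: "test_function \<phi> \<Longrightarrow> test_function ((deriv ^^ n) \<phi>)"
  by (induction n) (auto simp: test_function_deriv)

lemma deriv_funpow_linear:
  assumes "test_function \<phi>" "test_function \<psi>"
  shows "(deriv ^^ n) (\<lambda>x. a * \<phi> x + b * \<psi> x) = (\<lambda>x. a * (deriv ^^ n) \<phi> x + b * (deriv ^^ n) \<psi> x)"
proof (induction n)
  case (Suc n)
  show ?case
  proof
    fix x
    have "((\<lambda>x. a * (deriv ^^ n) \<phi> x + b * (deriv ^^ n) \<psi> x) has_real_derivative
        a * deriv ((deriv ^^ n) \<phi>) x + b * deriv ((deriv ^^ n) \<psi>) x) (at x)"
      using assms by (intro DERIV_add DERIV_cmult test_function_DERIV test_function_deriv_funpow)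
    then show "(deriv ^^ Suc n) (\<lambda>x. a * \<phi> x + b * \<psi> x) x = a * (deriv ^^ Suc n) \<phi> x + b * (deriv ^^ Suc n) \<psi> x"
      by (simp add: Suc DERIV_imp_deriv)
  qed
qed simp

lemma test_function_linear:
  assumes "test_function \<phi>" "test_function \<psi>"
  shows "test_function (\<lambda>x. a * \<phi> x + b * \<psi> x)"
  unfolding test_function_def
proof (intro conjI allI)
  fix n x
  have "((\<lambda>x. a * (deriv ^^ n) \<phi> x + b * (deriv ^^ n) \<psi> x) has_real_derivative
      a * deriv ((deriv ^^ n) \<phi>) x + b * deriv ((deriv ^^ n) \<psi>) x) (at x)"
    using assms by (intro DERIV_add DERIV_cmult test_function_DERIV test_function_deriv_funpow)
  then show "(deriv ^^ n) (\<lambda>x. a * \<phi> x + b * \<psi> x) field_differentiable at x"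
    unfolding deriv_funpow_linear[OF assms] field_differentiable_def by blast
  obtain c d where cd: "0 < c" "c < d" "d < 1" "\<And>x. x \<notin> {c..d} \<Longrightarrow> \<phi> x = 0"
    using test_function_support[OF assms(1)] by blast
  obtain c' d' where cd': "0 < c'" "c' < d'" "d' < 1" "\<And>x. x \<notin> {c'..d'} \<Longrightarrow> \<psi> x = 0"
    using test_function_support[OF assms(2)] by blast
  have "a * \<phi> x + b * \<psi> x = 0" if "x \<notin> {min c c'..max d d'}" for x
  proof -
    have "x \<notin> {c..d}" "x \<notin> {c'..d'}" using that by auto
    then show ?thesis using cd(4) cd'(4) by simp
  qed
  then show "\<exists>c d. 0 < c \<and> c < d \<and> d < 1 \<and> (\<forall>x. x \<notin> {c..d} \<longrightarrow> a * \<phi> x + b * \<psi> x = 0)"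
    using cd(1-3) cd'(1-3) by (intro exI[of _ "min c c'"] exI[of _ "max d d'"]) auto
qed

text \<open>Only zero mean makes the antiderivative vanish to the right of the support.\<close>

lemma test_function_antiderivative:
  assumes "test_function \<psi>" "integral {0..1} \<psi> = 0"
  obtains \<phi> where "test_function \<phi>" "deriv \<phi> = \<psi>"
proof -
  obtain c d where cd: "0 < c" "c < d" "d < 1" "\<And>x. x \<notin> {c..d} \<Longrightarrow> \<psi> x = 0"
    using test_function_support[OF assms(1)] by blast
  have int: "\<psi> integrable_on {a..b}" for a b
    by (intro integrable_continuous_real test_function_continuous assms)
  \<comment> \<open>The support is built into the definition; that the pieces fit together as a
    single primitive is the content of \<open>eq\<close>.\<close>
  define \<phi> where "\<phi> x = (if x < c then 0 else if x \<le> d then integral {0..x} \<psi> else 0)" for x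
  have zero: "integral {a..b} \<psi> = 0" if "b < c \<or> d < a" for a b
  proof -
    have "integral {a..b} \<psi> = integral {a..b} (\<lambda>_. 0)"
      by (rule Henstock_Kurzweil_Integration.integral_cong) (use that cd in auto)
    then show ?thesis by simp
  qed
  have eq: "\<phi> x = integral {-1..x} \<psi>" if "-1 < x" "x < 2" for x
  proof -
    have split: "integral {-1..0} \<psi> + integral {0..x} \<psi> = integral {-1..x} \<psi>" if "0 \<le> x"
      using that int by (intro Henstock_Kurzweil_Integration.integral_combine) auto
    have z: "integral {-1..0} \<psi> = 0" using cd by (intro zero) auto
    consider "x < c" | "c \<le> x" "x \<le> d" | "d < x" by linarith
    then show ?thesis
    proof cases
      case 1
      then show ?thesis using zero by (simp add: \<phi>_def)
    next
      case 2
      then show ?thesis using split z cd by (simp add: \<phi>_def)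
    next
      case 3
      have "integral {0..x} \<psi> = 0"
      proof (cases "x \<le> 1")
        case True
        have "integral {0..x} \<psi> + integral {x..1} \<psi> = integral {0..1} \<psi>"
          using True 3 cd int by (intro Henstock_Kurzweil_Integration.integral_combine) auto
        then show ?thesis using zero[of 1 x] 3 assms(2) by simp
      next
        case False
        have "integral {0..1} \<psi> + integral {1..x} \<psi> = integral {0..x} \<psi>"
          using False int by (intro Henstock_Kurzweil_Integration.integral_combine) auto
        then show ?thesis using zero[of x 1] cd assms(2) by simp
      qed
      then show ?thesis using 3 split z cd by (simp add: \<phi>_def)
    qed
  qed
  have D: "(\<phi> has_real_derivative \<psi> x) (at x)" for x
  proof -
    consider "x < c" | "0 < x" "x < 1" | "d < x" using cd by linarith
    then show ?thesis
    proof cases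
      case 1
      have "((\<lambda>_. 0) has_real_derivative 0) (at x)" by simp
      then have "(\<phi> has_real_derivative 0) (at x)"
        by (rule has_field_derivative_transform_within_open[of _ _ _ "{..<c}"]) (use 1 in \<open>auto simp: \<phi>_def\<close>)
      then show ?thesis using 1 cd by simp
    next
      case 3
      have "((\<lambda>_. 0) has_real_derivative 0) (at x)" by simp
      then have "(\<phi> has_real_derivative 0) (at x)"
        by (rule has_field_derivative_transform_within_open[of _ _ _ "{d<..}"]) (use 3 cd in \<open>auto simp: \<phi>_def\<close>)
      then show ?thesis using 3 cd by simp
    next
      case 2
      have "((\<lambda>x. integral {-1..x} \<psi>) has_real_derivative \<psi> x) (at x within {-1..2})"
        using 2 by (intro integral_has_real_derivative test_function_continuous assms) auto
      then have "((\<lambda>x. integral {-1..x} \<psi>) has_real_derivative \<psi> x) (at x within {-1<..<2})"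
        by (rule DERIV_subset) auto
      moreover have "at x within {-1<..<2} = at x" using 2 by (intro at_within_open) auto
      ultimately have "((\<lambda>x. integral {-1..x} \<psi>) has_real_derivative \<psi> x) (at x)" by simp
      then show ?thesis
        by (rule has_field_derivative_transform_within_open[of _ _ _ "{-1<..<2}"]) (use 2 eq in auto)
    qed
  qed
  have d\<phi>: "deriv \<phi> = \<psi>" using D DERIV_imp_deriv by blast
  have "test_function \<phi>"
    unfolding test_function_def
  proof (intro conjI allI)
    fix n x
    show "(deriv ^^ n) \<phi> field_differentiable at x"
    proof (cases n)
      case 0
      then show ?thesis using D field_differentiable_def by auto
    next
      case (Suc m)
      then have "(deriv ^^ n) \<phi> = (deriv ^^ m) \<psi>" by (simp add: funpow_swap1 d\<phi>)
      then show ?thesis using assms(1) by (simp add: test_function_def)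
    qed
    show "\<exists>c d. 0 < c \<and> c < d \<and> d < 1 \<and> (\<forall>x. x \<notin> {c..d} \<longrightarrow> \<phi> x = 0)"
      using cd by (intro exI[of _ c] exI[of _ d]) (auto simp: \<phi>_def)
  qed
  then show ?thesis using that d\<phi> by blast
qed

section \<open>Weak derivatives\<close>

lemma M01_integrable_iff:
  fixes f :: "real \<Rightarrow> real"
  shows "integrable M01 f \<longleftrightarrow> set_integrable lebesgue {0<..<1} f"
  by (simp add: integrable_restrict_space set_integrable_def)

lemma M01_integral_eq:
  fixes f :: "real \<Rightarrow> real"
  assumes "integrable M01 f"
  shows "f integrable_on {0..1}" "integral\<^sup>L M01 f = integral {0..1} f"
proof -
  have s: "set_integrable lebesgue {0<..<1} f" using assms M01_integrable_iff by blast
  have "f integrable_on {0<..<1}" using s by (rule set_lebesgue_integral_eq_integral(1))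
  then show "f integrable_on {0..1}" by (simp add: integrable_on_Icc_iff_Ioo)
  have "integral\<^sup>L M01 f = set_lebesgue_integral lebesgue {0<..<1} f"
    by (simp add: integral_restrict_space set_lebesgue_integral_def)
  also have "\<dots> = integral {0<..<1} f" using s by (rule set_lebesgue_integral_eq_integral(2))
  finally show "integral\<^sup>L M01 f = integral {0..1} f" by (simp add: integral_open_interval_real)
qed

lemma M01_AE_iff: "(AE x in M01. P x) \<longleftrightarrow> (AE x in lebesgue. x \<in> {0<..<1} \<longrightarrow> P x)"
  by (rule AE_restrict_space_iff) simp

lemma AE_M01I: "(\<And>x. 0 < x \<Longrightarrow> x < 1 \<Longrightarrow> P x) \<Longrightarrow> AE x in M01. P x"
  by (rule AE_I2) (simp add: space_restrict_space)

lemma finite_measure_M01: "finite_measure M01"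
  by (rule finite_measure_lebesgue_on) simp

lemma M01_continuous_measurable: "continuous_on {0<..<1} f \<Longrightarrow> (f :: real \<Rightarrow> real) \<in> borel_measurable M01"
  by (erule continuous_imp_measurable_on_sets_lebesgue) (rule fmeasurableD, simp)

lemma M01_integrable_continuous:
  assumes "continuous_on {0..1} (f :: real \<Rightarrow> real)" shows "integrable M01 f"
proof -
  have "f absolutely_integrable_on {0..1}" by (rule absolutely_integrable_continuous_real[OF assms])
  then have "set_integrable lebesgue {0<..<1} f" by (rule set_integrable_subset) auto
  then show ?thesis by (simp only: M01_integrable_iff)
qed

lemma M01_integrable_imp_L1_loc:
  assumes "integrable M01 f" shows "f \<in> L1_loc"
  unfolding L1_loc_def
proof (intro CollectI allI impI)
  fix c d :: real assume "0 < c \<and> c < d \<and> d < 1"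
  then have "{c..d} \<subseteq> {0<..<1}" by auto
  then show "f absolutely_integrable_on {c..d}"
    using assms unfolding M01_integrable_iff by (rule set_integrable_subset[rotated 2]) simp
qed

lemma M01_integrable_supported:
  fixes f :: "real \<Rightarrow> real"
  assumes "0 < c" "d < 1" "f absolutely_integrable_on {c..d}" "\<And>x. x \<notin> {c..d} \<Longrightarrow> f x = 0"
  shows "integrable M01 f"
proof -
  have "(\<lambda>x. indicator {0<..<1} x *\<^sub>R f x) = (\<lambda>x. indicator {c..d} x *\<^sub>R f x)"
    using assms by (auto simp: indicator_def fun_eq_iff)
  then show ?thesis using assms(3) unfolding M01_integrable_iff set_integrable_def by simp
qed

lemma L1_loc_mult_integrable:
  assumes "f \<in> L1_loc" "0 < c" "c < d" "d < 1" "continuous_on {c..d} \<phi>" "\<And>x. x \<notin> {c..d} \<Longrightarrow> \<phi> x = 0"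
  shows "integrable M01 (\<lambda>x. f x * \<phi> x)"
proof (rule M01_integrable_supported[OF assms(2,4)])
  have "(\<lambda>x. \<phi> x * f x) absolutely_integrable_on {c..d}"
  proof (rule absolutely_integrable_bounded_measurable_product_real)
    show "\<phi> \<in> borel_measurable (lebesgue_on {c..d})"
      using assms(5) by (rule continuous_imp_measurable_on_sets_lebesgue) simp
    show "bounded (\<phi> ` {c..d})"
      using assms(5) by (intro compact_imp_bounded compact_continuous_image compact_Icc)
    show "f absolutely_integrable_on {c..d}" using assms by (simp add: L1_loc_def)
  qed simp
  then show "(\<lambda>x. f x * \<phi> x) absolutely_integrable_on {c..d}" by (simp only: mult.commute)
qed (simp add: assms(6))

lemma L1_loc_test_integrable:
  assumes "f \<in> L1_loc" "test_function \<phi>"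
  shows "integrable M01 (\<lambda>x. f x * \<phi> x)"
proof -
  obtain c d where "0 < c" "c < d" "d < 1" "\<And>x. x \<notin> {c..d} \<Longrightarrow> \<phi> x = 0"
    using test_function_support[OF assms(2)] by blast
  then show ?thesis using L1_loc_mult_integrable[OF assms(1)] test_function_continuous[OF assms(2)] by blast
qed

lemma test_integrable: "test_function \<phi> \<Longrightarrow> integrable M01 \<phi>"
  by (intro M01_integrable_continuous test_function_continuous)

lemma L1_loc_linear:
  assumes "f \<in> L1_loc" "g \<in> L1_loc" shows "(\<lambda>x. a * f x + b * g x) \<in> L1_loc"
  using assms unfolding L1_loc_def by (auto intro!: set_integral_add set_integrable_mult_right)

lemma L1_loc_diff: "f \<in> L1_loc \<Longrightarrow> g \<in> L1_loc \<Longrightarrow> (\<lambda>x. f x - g x) \<in> L1_loc"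
  using L1_loc_linear[of f g 1 "-1"] by simp

text \<open>The offset 3 keeps the left endpoint below the right one for every n, including n =
  0.\<close>

lemma exhaust_01:
  fixes x :: real
  assumes "0 < x" "x < 1" obtains n :: nat where "x \<in> {1 / (real n + 3) <..< 1 - 1 / (real n + 3)}"
proof -
  define m where "m = min x (1 - x)"
  have m: "0 < m" "m \<le> x" "m \<le> 1 - x" using assms by (auto simp: m_def)
  obtain n :: nat where "1 / m < n" using reals_Archimedean2 by blast
  then have "1 / m < real n + 3" by simp
  then have "1 / (real n + 3) < m" using m(1) by (simp add: field_simps)
  then have "x \<in> {1 / (real n + 3) <..< 1 - 1 / (real n + 3)}" using m by auto
  then show ?thesis using that[of n] by auto
qed

text \<open>Exhaustion by intervals with closure inside (0,1), on each of which local integrability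
  supplies measurability.\<close>

lemma L1_loc_measurable:
  assumes "f \<in> L1_loc" shows "f \<in> borel_measurable M01"
proof -
  let ?S = "\<lambda>n::nat. {1 / (real n + 3) <..< 1 - 1 / (real n + 3)}"
  have m: "(\<lambda>x. indicator (?S n) x * f x) \<in> borel_measurable M01" for n
  proof -
    let ?c = "1 / (real n + 3)"
    have c: "0 < ?c" "?c < 1 - ?c" "1 - ?c < 1" by (simp_all add: field_simps)
    have "f absolutely_integrable_on {?c..1 - ?c}" using assms c unfolding L1_loc_def by blast
    then have "f absolutely_integrable_on ?S n" by (rule set_integrable_subset) auto
    then have "(\<lambda>x. indicator (?S n) x * f x) \<in> borel_measurable lebesgue"
      by (auto simp: set_integrable_def dest: borel_measurable_integrable)
    then show ?thesis by (rule measurable_restrict_space1)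
  qed
  show ?thesis
  proof (rule borel_measurable_LIMSEQ_real[OF _ m])
    fix x assume "x \<in> space M01"
    then have x: "0 < x" "x < 1" by (auto simp: space_restrict_space)
    obtain n where n: "x \<in> ?S n" by (rule exhaust_01[OF x])
    have "x \<in> ?S m" if "n \<le> m" for m
    proof -
      have "1 / (real m + 3) \<le> 1 / (real n + 3)" using that by (intro divide_left_mono) auto
      then have "1 / (real m + 3) < x" "x < 1 - 1 / (real m + 3)"
        using n unfolding greaterThanLessThan_iff by linarith+
      then show ?thesis by simp
    qed
    then have "\<forall>\<^sub>F m in sequentially. f x = indicator (?S m) x * f x"
      unfolding eventually_sequentially by (intro exI[of _ n]) auto
    then show "(\<lambda>m. indicator (?S m) x * f x) \<longlonglongrightarrow> f x"
      by (rule Lim_transform_eventually[OF tendsto_const])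
  qed
qed

text \<open>Bump functions approximate indicators of intervals, so \<open>f\<close> has integral 0
  over every interval with closure inside (0,1). A Dynkin argument extends this to the Borel subsets
  of such an interval, and an integrable function is determined by these integrals.\<close>

theorem fundamental_lemma:
  assumes f: "f \<in> L1_loc"
    and zero: "\<And>\<phi>. test_function \<phi> \<Longrightarrow> (LINT x|M01. f x * \<phi> x) = 0"
  shows "AE x in M01. f x = 0"
proof -
  have fm: "f \<in> borel_measurable M01" by (rule L1_loc_measurable[OF f])
  have interval: "(LINT x|M01. f x * indicator {c<..<d} x) = 0" if cd: "0 < c" "c < d" "d < 1" for c d
  proof -
    \<comment> \<open>With w = (x - c) (d - x), exp (-1 / ((n + 1) w)) tends to 1 on (c, d) and
      stays below 1, so dominated convergence replaces the test functions by the indicator.\<close>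
    define b where "b n = bump c d (1 / real (Suc n)) 1 0" for n
    have dom: "integrable M01 (\<lambda>x. \<bar>f x\<bar> * indicator {c..d} x)"
    proof (rule M01_integrable_supported[OF cd(1,3)])
      have "f absolutely_integrable_on {c..d}" using f cd by (simp add: L1_loc_def)
      then have "(\<lambda>x. \<bar>f x\<bar>) absolutely_integrable_on {c..d}" by (rule set_integrable_abs)
      then show "(\<lambda>x. \<bar>f x\<bar> * indicator {c..d} x) absolutely_integrable_on {c..d}"
        by (rule set_integrable_cong[THEN iffD1, rotated -1]) auto
    qed auto
    have "(\<lambda>n. LINT x|M01. f x * b n x) \<longlonglongrightarrow> (LINT x|M01. f x * indicator {c<..<d} x)"
    proof (rule integral_dominated_convergence[OF _ _ dom])
      have test: "test_function (b n)" for n unfolding b_def using cd by (intro test_function_bump) auto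
      show "(\<lambda>x. f x * b n x) \<in> borel_measurable M01" for n
        using L1_loc_test_integrable[OF f test] by (rule borel_measurable_integrable)
      have "(\<lambda>x. indicator {c<..<d} x :: real) \<in> borel_measurable M01"
        by (intro measurable_restrict_space1 borel_measurable_indicator) simp
      then show "(\<lambda>x. f x * indicator {c<..<d} x) \<in> borel_measurable M01"
        using fm by (intro borel_measurable_times)
      show "AE x in M01. (\<lambda>n. f x * b n x) \<longlonglongrightarrow> f x * indicator {c<..<d} x"
      proof (rule AE_I2)
        fix x
        have "(\<lambda>n. b n x) \<longlonglongrightarrow> indicator {c<..<d} x"
        proof (cases "c < x \<and> x < d")
          case True
          have "(\<lambda>n. exp (- (1 / poly (quad c d) x) * (1 / real (Suc n)))) \<longlonglongrightarrow> exp (- (1 / poly (quad c d) x) * 0)"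
            using LIMSEQ_inverse_real_of_nat by (intro tendsto_intros) (simp add: inverse_eq_divide)
          then show ?thesis using True by (simp add: b_def bump_def mult.commute)
        qed (auto simp: b_def bump_def)
        then show "(\<lambda>n. f x * b n x) \<longlonglongrightarrow> f x * indicator {c<..<d} x" by (intro tendsto_mult tendsto_const)
      qed
      have "\<bar>b n x\<bar> \<le> indicator {c..d} x" for n x
        using poly_quad_pos[of c x d] by (auto simp: b_def bump_def)
      then show "AE x in M01. norm (f x * b n x) \<le> \<bar>f x\<bar> * indicator {c..d} x" for n
        by (intro AE_I2) (simp add: abs_mult mult_left_mono)
    qed
    moreover have "(\<lambda>n. LINT x|M01. f x * b n x) = (\<lambda>_. 0)"
      unfolding b_def using cd by (intro ext zero test_function_bump) auto
    ultimately have "(\<lambda>_. 0) \<longlonglongrightarrow> (LINT x|M01. f x * indicator {c<..<d} x)" by (simp only:)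
    then show ?thesis by (simp only: LIMSEQ_const_iff)
  qed
  have local: "AE x in lebesgue. x \<in> {c<..<d} \<longrightarrow> f x = 0" if cd: "0 < c" "c < d" "d < 1" for c d
  proof -
    define h where "h x = f x * indicator {c<..<d} x" for x
    have "f absolutely_integrable_on {c..d}" using f cd by (simp add: L1_loc_def)
    then have "f absolutely_integrable_on {c<..<d}" by (rule set_integrable_subset) auto
    then have hint: "integrable lebesgue h" by (simp add: set_integrable_def h_def[abs_def] mult.commute)
    have hI: "(LINT x|lebesgue. indicator {a<..<b} x * h x) = 0" for a b
    proof -
      have "(\<lambda>x. indicator {a<..<b} x * h x) = (\<lambda>x. indicator {0<..<1} x *\<^sub>R (f x * indicator {max a c<..<min b d} x))"
        using cd by (auto simp: h_def indicator_def fun_eq_iff)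
      then have eq: "(LINT x|lebesgue. indicator {a<..<b} x * h x) = (LINT x|M01. f x * indicator {max a c<..<min b d} x)"
        by (simp add: integral_restrict_space)
      show ?thesis
      proof (cases "max a c < min b d")
        case True
        then show ?thesis unfolding eq using cd by (intro interval) auto
      next
        case False
        then have empty: "{max a c<..<min b d} = {}" by auto
        show ?thesis unfolding eq empty by simp
      qed
    qed
    \<comment> \<open>Intervals generate only the Borel sets, whereas \<open>h\<close> is Lebesgue
      measurable; a Borel version makes the induction over the sigma-algebra possible.\<close>
    obtain g where g: "g \<in> borel_measurable lborel" "AE x in lborel. h x = g x"
      using completion_ex_borel_measurable_real[of h lborel] borel_measurable_integrable[OF hint] by blast
    have gh: "AE x in lebesgue. h x = g x" using g(2) by (rule AE_completion)
    have gint: "integrable lborel g"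
    proof -
      have "g \<in> borel_measurable lebesgue" using g(1) by (rule measurable_completion)
      then have "integrable lebesgue g"
        using hint gh integrable_cong_AE borel_measurable_integrable by blast
      then show ?thesis using g(1) by (simp add: integrable_completion)
    qed
    have interval_zero: "(LINT x:{a<..<b}|lborel. g x) = 0" for a b
    proof -
      have "(LINT x:{a<..<b}|lborel. g x) = (LINT x|lebesgue. indicator {a<..<b} x * g x)"
        unfolding set_lebesgue_integral_def using g(1) by (subst integral_completion) auto
      also have "\<dots> = (LINT x|lebesgue. indicator {a<..<b} x * h x)"
      proof (rule integral_cong_AE)
        show "(\<lambda>x. indicator {a<..<b} x * g x) \<in> borel_measurable lebesgue"
          using g(1) by (intro measurable_completion borel_measurable_times) auto
        show "(\<lambda>x. indicator {a<..<b} x * h x) \<in> borel_measurable lebesgue"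
          using borel_measurable_integrable[OF hint]
          by (intro borel_measurable_times borel_measurable_indicator fmeasurableD) simp_all
        show "AE x in lebesgue. indicator {a<..<b} x * g x = indicator {a<..<b} x * h x"
          using gh by eventually_elim simp
      qed
      finally show ?thesis using hI by simp
    qed
    have total: "(LINT x|lborel. g x) = 0"
    proof -
      have "(\<lambda>x. indicator {c<..<d} x * h x) = h" by (auto simp: h_def indicator_def)
      then have "(LINT x|lebesgue. h x) = 0" using hI[of c d] by simp
      moreover have "(LINT x|lebesgue. h x) = (LINT x|lebesgue. g x)"
        by (rule integral_cong_AE[OF borel_measurable_integrable[OF hint] measurable_completion[OF g(1)] gh])
      ultimately show ?thesis using g(1) by (simp add: integral_completion)
    qed
    have sets_zero: "(LINT x:A|lborel. g x) = 0" if "A \<in> sets lborel" for A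
    proof -
      let ?G = "range (\<lambda>(a, b). {a<..<b :: real})"
      have "sets borel = sigma_sets UNIV (range (\<lambda>(a, b). box a b :: real set))"
        unfolding borel_eq_box by (rule sets_measure_of) simp
      then have sets_eq: "sets borel = sigma_sets UNIV ?G" by (simp only: box_real)
      have A: "A \<in> sigma_sets UNIV ?G" using that sets_eq by simp
      have sub: "sigma_sets UNIV ?G \<subseteq> sets borel" using sets_eq by simp
      have intA: "set_integrable lborel A g" if "A \<in> sigma_sets UNIV ?G" for A
        using gint that sub unfolding set_integrable_def by (intro integrable_mult_indicator) auto
      have stable: "Int_stable ?G"
      proof (rule Int_stableI)
        fix A B assume "A \<in> ?G" "B \<in> ?G"
        then obtain a b c d where "A = {a<..<b}" "B = {c<..<d}" by auto
        then have "A \<inter> B = {max a c<..<min b d}" by auto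
        then show "A \<inter> B \<in> ?G" by auto
      qed
      have pow: "?G \<subseteq> Pow UNIV" by simp
      show ?thesis using A
      proof (induction rule: sigma_sets_induct_disjoint[OF stable pow, consumes 1, case_names basic empty compl union])
        case (basic A)
        then show ?case using interval_zero by auto
      next
        case empty
        then show ?case by (simp add: set_lebesgue_integral_def)
      next
        case (compl A)
        have "(LINT x:UNIV - A|lborel. g x) = (LINT x|lborel. g x - indicator A x *\<^sub>R g x)"
          unfolding set_lebesgue_integral_def
          by (intro Bochner_Integration.integral_cong) (auto simp: indicator_def)
        also have "\<dots> = (LINT x|lborel. g x) - (LINT x:A|lborel. g x)"
          using gint intA[OF compl(1)] unfolding set_integrable_def set_lebesgue_integral_def
          by (intro Bochner_Integration.integral_diff) auto
        finally show ?case using total compl by simp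
      next
        case (union A)
        have Ai: "A i \<in> sigma_sets UNIV ?G" for i using union(2) by blast
        have "(LINT x:(\<Union>i. A i)|lborel. g x) = (\<Sum>i. (LINT x:(A i)|lborel. g x))"
        proof (rule lebesgue_integral_countable_add)
          show "A i \<in> sets lborel" for i using Ai sub by auto
          show "A i \<inter> A j = {}" if "i \<noteq> j" for i j using union(1) that by (auto simp: disjoint_family_on_def)
          show "set_integrable lborel (\<Union>i. A i) g" by (intro intA sigma_sets.Union Ai)
        qed
        then show ?case using union by simp
      qed
    qed
    have "AE x in lborel. g x = 0"
      by (rule density_unique_real[OF gint]) (auto simp: sets_zero)
    then have "AE x in lebesgue. g x = 0" by (rule AE_completion)
    with gh show ?thesis by eventually_elim (auto simp: h_def)
  qed
  have "AE x in lebesgue. \<forall>n::nat. x \<in> {1 / (real n + 3) <..< 1 - 1 / (real n + 3)} \<longrightarrow> f x = 0"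
    unfolding AE_all_countable by (intro allI local) (auto simp: field_simps)
  then have "AE x in lebesgue. x \<in> {0<..<1} \<longrightarrow> f x = 0"
  proof eventually_elim
    case (elim x)
    show ?case using exhaust_01[of x] elim by (metis greaterThanLessThan_iff)
  qed
  then show ?thesis by (simp only: M01_AE_iff)
qed

lemma fundamental_lemma_eq:
  assumes "f \<in> L1_loc" "g \<in> L1_loc"
    and "\<And>\<phi>. test_function \<phi> \<Longrightarrow> (LINT x|M01. f x * \<phi> x) = (LINT x|M01. g x * \<phi> x)"
  shows "AE x in M01. f x = g x"
proof -
  have "AE x in M01. f x - g x = 0"
  proof (rule fundamental_lemma[OF L1_loc_diff[OF assms(1,2)]])
    fix \<phi> assume "test_function \<phi>"
    then show "(LINT x|M01. (f x - g x) * \<phi> x) = 0"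
      using assms by (simp add: left_diff_distrib L1_loc_test_integrable)
  qed
  then show ?thesis by simp
qed

section \<open>Uniqueness and linearity of weak derivatives\<close>

lemma has_weak_deriv_unique:
  assumes "has_weak_deriv k u g" "has_weak_deriv k u h"
  shows "AE x in M01. g x = h x"
  using assms unfolding has_weak_deriv_def by (intro fundamental_lemma_eq) auto

lemma weak_deriv_eq:
  assumes "has_weak_deriv k u g"
  shows "has_weak_deriv k u (weak_deriv k u)" "AE x in M01. weak_deriv k u x = g x"
proof -
  show w: "has_weak_deriv k u (weak_deriv k u)" 
    unfolding weak_deriv_def using someI[of "has_weak_deriv k u" g] assms by (simp only:)
  show "AE x in M01. weak_deriv k u x = g x" by (rule has_weak_deriv_unique[OF w assms])
qed

lemma M01_integral_cong_test:
  assumes "f \<in> L1_loc" "g \<in> L1_loc" "AE x in M01. f x = g x" "test_function \<phi>"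
  shows "(LINT x|M01. f x * \<phi> x) = (LINT x|M01. g x * \<phi> x)"
proof (rule integral_cong_AE)
  show "AE x in M01. f x * \<phi> x = g x * \<phi> x" using assms(3) by eventually_elim simp
qed (use assms L1_loc_test_integrable borel_measurable_integrable in blast)+

lemma has_weak_deriv_cong:
  assumes "has_weak_deriv k u g" "v \<in> L1_loc" "AE x in M01. u x = v x" "h \<in> L1_loc" "AE x in M01. g x = h x"
  shows "has_weak_deriv k v h"
  unfolding has_weak_deriv_def
proof (intro conjI allI impI assms(2,4))
  have L1: "u \<in> L1_loc" "g \<in> L1_loc" using assms(1) by (auto simp: has_weak_deriv_def)
  fix \<phi> assume \<phi>: "test_function \<phi>"
  have "(LINT x|M01. v x * (deriv ^^ k) \<phi> x) = (LINT x|M01. u x * (deriv ^^ k) \<phi> x)"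
    using M01_integral_cong_test[OF L1(1) assms(2,3) test_function_deriv_funpow[OF \<phi>]] by simp
  also have "\<dots> = (- 1) ^ k * (LINT x|M01. g x * \<phi> x)"
    using assms(1) \<phi> by (simp add: has_weak_deriv_def)
  also have "(LINT x|M01. g x * \<phi> x) = (LINT x|M01. h x * \<phi> x)"
    by (rule M01_integral_cong_test[OF L1(2) assms(4,5) \<phi>])
  finally show "(LINT x|M01. v x * (deriv ^^ k) \<phi> x) = (- 1) ^ k * (LINT x|M01. h x * \<phi> x)" .
qed

lemma has_weak_deriv_linear:
  assumes "has_weak_deriv k u g" "has_weak_deriv k v h"
  shows "has_weak_deriv k (\<lambda>x. a * u x + b * v x) (\<lambda>x. a * g x + b * h x)"
  unfolding has_weak_deriv_def
proof (intro conjI allI impI)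
  show "(\<lambda>x. a * u x + b * v x) \<in> L1_loc" "(\<lambda>x. a * g x + b * h x) \<in> L1_loc"
    using assms by (auto simp: has_weak_deriv_def intro: L1_loc_linear)
  fix \<phi> assume \<phi>: "test_function \<phi>"
  have *: "(LINT x|M01. (a * p x + b * q x) * \<psi> x) = a * (LINT x|M01. p x * \<psi> x) + b * (LINT x|M01. q x * \<psi> x)"
    if "p \<in> L1_loc" "q \<in> L1_loc" "test_function \<psi>" for p q \<psi>
  proof -
    have "(\<lambda>x. (a * p x + b * q x) * \<psi> x) = (\<lambda>x. a * (p x * \<psi> x) + b * (q x * \<psi> x))"
      by (simp add: algebra_simps)
    then show ?thesis using that by (simp add: L1_loc_test_integrable)
  qed
  show "(LINT x|M01. (a * u x + b * v x) * (deriv ^^ k) \<phi> x) = (- 1) ^ k * (LINT x|M01. (a * g x + b * h x) * \<phi> x)"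
  proof -
    have L1: "u \<in> L1_loc" "g \<in> L1_loc" "v \<in> L1_loc" "h \<in> L1_loc"
      using assms by (auto simp: has_weak_deriv_def)
    have w: "(LINT x|M01. u x * (deriv ^^ k) \<phi> x) = (- 1) ^ k * (LINT x|M01. g x * \<phi> x)"
      "(LINT x|M01. v x * (deriv ^^ k) \<phi> x) = (- 1) ^ k * (LINT x|M01. h x * \<phi> x)"
      using assms \<phi> by (auto simp: has_weak_deriv_def)
    show ?thesis
      unfolding *[OF L1(1,3) test_function_deriv_funpow[OF \<phi>]] *[OF L1(2,4) \<phi>] w
      by (simp only: distrib_left mult.left_commute)
  qed
qed

lemma weak_deriv_linear:
  assumes "has_weak_deriv k u g" "has_weak_deriv k v h"
  shows "AE x in M01. weak_deriv k (\<lambda>x. a * u x + b * v x) x = a * weak_deriv k u x + b * weak_deriv k v x"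
  using weak_deriv_eq(2)[OF has_weak_deriv_linear[OF weak_deriv_eq(1)[OF assms(1)] weak_deriv_eq(1)[OF assms(2)]]] .

section \<open>Functions whose weak derivative vanishes\<close>

lemma test_function_unit_mass:
  obtains b where "test_function b" "(LINT x|M01. b x) = 1"
proof -
  define b where "b = bump (1/4) (3/4) 1 1 0"
  have b: "test_function b" unfolding b_def by (intro test_function_bump) auto
  define \<beta> where "\<beta> = (LINT x|M01. b x)"
  have pos: "\<beta> \<noteq> 0"
  proof
    assume "\<beta> = 0"
    have nonneg: "0 \<le> b x" for x using poly_quad_pos[of "1/4" x "3/4"] by (auto simp: b_def bump_def)
    have "(b has_integral 0) (cbox 0 1)"
      using \<open>\<beta> = 0\<close> M01_integral_eq[OF test_integrable[OF b]] integrable_integral[of b "{0..1}"]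
      by (simp add: \<beta>_def)
    then have "b (1/2) = 0"
      by (rule has_integral_0_cbox_imp_0[OF test_function_continuous[OF b] nonneg]) auto
    then show False by (simp add: b_def bump_def)
  qed
  have "test_function (\<lambda>x. 1 / \<beta> * b x + 0 * b x)" by (rule test_function_linear[OF b b])
  moreover have "(LINT x|M01. 1 / \<beta> * b x + 0 * b x) = 1" using pos by (simp add: \<beta>_def)
  ultimately show ?thesis by (rule that)
qed

text \<open>Subtracting the mean times \<open>b\<close> leaves a test function of zero mean, and
  such a function has a primitive that is again a test function.\<close>

lemma test_function_minus_mean:
  assumes b: "test_function b" "(LINT x|M01. b x) = 1" and \<eta>: "test_function \<eta>"
  obtains \<phi> where "test_function \<phi>" "deriv \<phi> = (\<lambda>x. 1 * \<eta> x + (- (LINT x|M01. \<eta> x)) * b x)"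
proof -
  let ?\<psi> = "\<lambda>x. 1 * \<eta> x + (- (LINT x|M01. \<eta> x)) * b x"
  have \<psi>: "test_function ?\<psi>" by (rule test_function_linear[OF \<eta> b(1)])
  have "(LINT x|M01. ?\<psi> x) = 0"
    using test_integrable[OF b(1)] test_integrable[OF \<eta>] b(2) by simp
  then have "integral {0..1} ?\<psi> = 0" using M01_integral_eq(2)[OF test_integrable[OF \<psi>]] by simp
  then show ?thesis using test_function_antiderivative[OF \<psi>] that by blast
qed

text \<open>Any test function is a derivative plus its mean times \<open>b\<close>, and
  \<open>f\<close> annihilates the derivative. So pairing with \<open>f\<close> multiplies the mean
  by a fixed number, which is what pairing with a constant does.\<close>

theorem du_bois_reymond:
  assumes f: "f \<in> L1_loc"
    and zero: "\<And>\<phi>. test_function \<phi> \<Longrightarrow> (LINT x|M01. f x * deriv \<phi> x) = 0"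
  obtains c where "AE x in M01. f x = c"
proof -
  obtain b where b: "test_function b" "(LINT x|M01. b x) = 1" by (rule test_function_unit_mass)
  define c where "c = (LINT x|M01. f x * b x)"
  have "AE x in M01. f x = c"
  proof (rule fundamental_lemma_eq[OF f])
    show "(\<lambda>x. c) \<in> L1_loc" by (intro M01_integrable_imp_L1_loc M01_integrable_continuous continuous_intros)
    fix \<eta> assume \<eta>: "test_function \<eta>"
    define m where "m = (LINT x|M01. \<eta> x)"
    obtain \<phi> where \<phi>: "test_function \<phi>" "deriv \<phi> = (\<lambda>x. 1 * \<eta> x + (- m) * b x)"
      unfolding m_def by (rule test_function_minus_mean[OF b \<eta>])
    have "0 = (LINT x|M01. f x * \<eta> x - m * (f x * b x))"
      using zero[OF \<phi>(1)] unfolding \<phi>(2) by (simp add: algebra_simps)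
    also have "\<dots> = (LINT x|M01. f x * \<eta> x) - m * (LINT x|M01. f x * b x)"
      using L1_loc_test_integrable[OF f \<eta>] L1_loc_test_integrable[OF f b(1)] by simp
    finally show "(LINT x|M01. f x * \<eta> x) = (LINT x|M01. c * \<eta> x)" by (simp add: c_def m_def)
  qed
  then show ?thesis by (rule that)
qed

section \<open>Primitives\<close>

text \<open>The primitive from 0, written with an indicator over the whole interval: in this form it
  is an inner integral to which Fubini's theorem applies.\<close>

definition prim :: "(real \<Rightarrow> real) \<Rightarrow> real \<Rightarrow> real" where
  "prim k x = (LINT y|M01. indicator {..x} y * k y)"

lemma M01_indicator_mult:
  assumes "integrable M01 k" "A \<in> sets borel"
  shows "integrable M01 (\<lambda>y. indicator A y * (k y :: real))"
proof (rule Bochner_Integration.integrable_bound[OF assms(1)])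
  have "A \<in> sets lebesgue" using assms(2) by (intro sets_completionI_sets) simp
  then have "(indicator A :: real \<Rightarrow> real) \<in> borel_measurable M01"
    by (intro measurable_restrict_space1 borel_measurable_indicator)
  then show "(\<lambda>y. indicator A y * k y) \<in> borel_measurable M01"
    using borel_measurable_integrable[OF assms(1)] by (rule borel_measurable_times)
  show "AE y in M01. norm (indicator A y * k y) \<le> norm (k y)"
    by (intro AE_I2) (simp add: indicator_def)
qed

lemma prim_eq:
  assumes "integrable M01 k" "x \<in> {0..1}"
  shows "prim k x = integral {0..x} k"
proof -
  have "prim k x = integral {0..1} (\<lambda>y. indicator {..x} y * k y)"
    unfolding prim_def by (rule M01_integral_eq(2)[OF M01_indicator_mult[OF assms(1)]]) simp
  also have "\<dots> = integral {0..1} (\<lambda>y. if y \<in> {0..x} then k y else 0)"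
    by (rule Henstock_Kurzweil_Integration.integral_cong) auto
  also have "\<dots> = integral {0..x} k"
    unfolding integral_restrict_Int using assms(2) by (simp add: Int_absorb1)
  finally show ?thesis .
qed

lemma prim_0: "integrable M01 k \<Longrightarrow> prim k 0 = 0"
  by (simp add: prim_eq)

lemma prim_1: "integrable M01 k \<Longrightarrow> prim k 1 = integral\<^sup>L M01 k"
  by (simp add: prim_eq M01_integral_eq)

lemma prim_linear:
  assumes "integrable M01 f" "integrable M01 g"
  shows "prim (\<lambda>x. a * f x + b * g x) x = a * prim f x + b * prim g x"
proof -
  have "prim (\<lambda>x. a * f x + b * g x) x =
      (LINT y|M01. a * (indicator {..x} y * f y) + b * (indicator {..x} y * g y))"
    unfolding prim_def by (simp add: algebra_simps)
  then show ?thesis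
    using M01_indicator_mult[OF assms(1), of "{..x}"] M01_indicator_mult[OF assms(2), of "{..x}"]
    by (simp add: prim_def)
qed

lemma prim_continuous:
  assumes "integrable M01 k" shows "continuous_on {0..1} (prim k)"
proof -
  have "continuous_on {0..1} (\<lambda>x. integral {0..x} k)"
    by (rule indefinite_integral_continuous_1[OF M01_integral_eq(1)[OF assms]])
  then show ?thesis by (rule continuous_on_eq) (simp add: prim_eq[OF assms])
qed

lemma prim_integrable: "integrable M01 k \<Longrightarrow> integrable M01 (prim k)"
  by (rule M01_integrable_continuous[OF prim_continuous])

lemma prim_has_derivative:
  assumes "continuous_on {0..1} k" "x \<in> {0..1}"
  shows "(prim k has_real_derivative k x) (at x within {0..1})"
proof (rule has_field_derivative_transform_within[OF _ zero_less_one assms(2)])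
  show "((\<lambda>x. integral {0..x} k) has_real_derivative k x) (at x within {0..1})"
    by (rule integral_has_real_derivative[OF assms])
qed (simp add: prim_eq[OF M01_integrable_continuous[OF assms(1)]])

lemma prim_of_derivative:
  assumes "\<And>x. x \<in> {0..1} \<Longrightarrow> (w has_real_derivative w' x) (at x within {0..1})"
    and "continuous_on {0..1} w'" "x \<in> {0..1}"
  shows "prim w' x = w x - w 0"
proof -
  have "(w' has_integral (w x - w 0)) {0..x}"
  proof (rule fundamental_theorem_of_calculus)
    fix y assume "y \<in> {0..x}"
    then have "(w has_real_derivative w' y) (at y within {0..x})"
      using assms(3) by (intro DERIV_subset[OF assms(1)]) auto
    then show "(w has_vector_derivative w' y) (at y within {0..x})"
      by (simp add: has_real_derivative_iff_has_vector_derivative)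
  qed (use assms(3) in auto)
  then show ?thesis
    using prim_eq[OF M01_integrable_continuous[OF assms(2)] assms(3)] by (simp add: integral_unique)
qed

lemma prim_test:
  assumes "test_function \<phi>" "x \<in> {0..1}" shows "prim (deriv \<phi>) x = \<phi> x"
proof -
  have "\<phi> 0 = 0"
    using test_function_support[OF assms(1)] by (metis atLeastAtMost_iff not_le)
  then show ?thesis
    using prim_of_derivative[of \<phi> "deriv \<phi>" x] test_function_DERIV[OF assms(1)] assms(2)
      test_function_continuous[OF test_function_deriv[OF assms(1)]]
    by (simp add: has_field_derivative_at_within)
qed

lemma M01_bounded_mult:
  assumes "integrable M01 f" "continuous_on {0..1} g"
  shows "integrable M01 (\<lambda>x. f x * (g x :: real))"
proof -
  obtain b where "\<forall>y\<in>g ` {0..1}. norm y \<le> b"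
    using compact_imp_bounded[OF compact_continuous_image[OF assms(2) compact_Icc]]
    unfolding bounded_iff by blast
  then have b: "\<bar>g x\<bar> \<le> b" if "x \<in> {0..1}" for x using that by auto
  show ?thesis
  proof (rule Bochner_Integration.integrable_bound)
    show "integrable M01 (\<lambda>x. b * f x)" using assms(1) by simp
    show "(\<lambda>x. f x * g x) \<in> borel_measurable M01"
    proof (rule borel_measurable_times[OF borel_measurable_integrable[OF assms(1)]])
      have "{0<..<1} \<subseteq> {0..1 :: real}" by auto
      then show "g \<in> borel_measurable M01"
        by (intro M01_continuous_measurable continuous_on_subset[OF assms(2)])
    qed
    show "AE x in M01. norm (f x * g x) \<le> norm (b * f x)"
    proof (rule AE_M01I)
      fix x :: real assume "0 < x" "x < 1"
      then have "\<bar>g x\<bar> \<le> \<bar>b\<bar>" using b[of x] by fastforce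
      then show "norm (f x * g x) \<le> norm (b * f x)"
        using mult_right_mono[of "\<bar>g x\<bar>" "\<bar>b\<bar>" "\<bar>f x\<bar>"] by (simp add: abs_mult mult.commute)
    qed
  qed
qed

text \<open>Fubini's theorem for \<open>f x * k y\<close> on the triangle \<open>y > x\<close>.\<close>

theorem integration_by_parts:
  assumes f: "integrable M01 f" and k: "integrable M01 k"
  shows "(LINT x|M01. prim f x * k x) = (LINT x|M01. f x) * (LINT x|M01. k x) - (LINT x|M01. f x * prim k x)"
proof -
  interpret finite_measure M01 by (rule finite_measure_M01)
  interpret pair_sigma_finite M01 M01 ..
  define F where "F x y = indicator {..y} x * (f x * k y)" for x y :: real
  have fm: "f \<in> borel_measurable M01" "k \<in> borel_measurable M01"
    using f k borel_measurable_integrable by auto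
  have prod: "integrable (M01 \<Otimes>\<^sub>M M01) (\<lambda>p. f (fst p) * k (snd p))"
  proof (rule Fubini_integrable)
    show "(\<lambda>p. f (fst p) * k (snd p)) \<in> borel_measurable (M01 \<Otimes>\<^sub>M M01)"
      using fm by measurable
    have "integrable M01 (\<lambda>x. \<bar>f x\<bar> * (LINT y|M01. \<bar>k y\<bar>))" using f by simp
    then show "integrable M01 (\<lambda>x. LINT y|M01. norm (f (fst (x, y)) * k (snd (x, y))))"
      by (simp add: abs_mult)
    show "AE x in M01. integrable M01 (\<lambda>y. f (fst (x, y)) * k (snd (x, y)))" using k by simp
  qed
  have id_m: "(\<lambda>x. x) \<in> borel_measurable M01"
    by (intro M01_continuous_measurable continuous_intros)
  have ind_m: "(\<lambda>p. if fst p \<le> snd p then 1 else 0 :: real) \<in> borel_measurable (M01 \<Otimes>\<^sub>M M01)"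
    using id_m by measurable
  have Fint: "integrable (M01 \<Otimes>\<^sub>M M01) (case_prod F)"
  proof (rule Bochner_Integration.integrable_bound[OF prod])
    have "case_prod F = (\<lambda>p. (if fst p \<le> snd p then 1 else 0) * (f (fst p) * k (snd p)))"
      by (auto simp: F_def indicator_def)
    then show "case_prod F \<in> borel_measurable (M01 \<Otimes>\<^sub>M M01)"
      using ind_m borel_measurable_integrable[OF prod] by simp
    show "AE p in M01 \<Otimes>\<^sub>M M01. norm (case_prod F p) \<le> norm (f (fst p) * k (snd p))"
      by (intro AE_I2) (auto simp: F_def indicator_def)
  qed
  have "(LINT y|M01. prim f y * k y) = (LINT y|M01. LINT x|M01. F x y)"
    unfolding prim_def F_def by (simp add: mult.assoc[symmetric])
  also have "\<dots> = (LINT x|M01. LINT y|M01. F x y)" by (rule Fubini_integral[OF Fint])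
  also have "\<dots> = (LINT x|M01. f x * (LINT y|M01. k y) - f x * prim k x)"
  proof (rule Bochner_Integration.integral_cong[OF refl])
    fix x
    \<comment> \<open>After the exchange y runs over y >= x, while \<open>prim k x\<close>
      integrates over y <= x; the diagonal point common to both is null.\<close>
    have "AE y in M01. y \<noteq> x" unfolding M01_AE_iff
      using AE_completion[OF AE_lborel_singleton[of x]] by eventually_elim simp
    then have ae: "AE y in M01. F x y = f x * (k y - indicator {..x} y * k y)"
      by eventually_elim (auto simp: F_def indicator_def)
    have ix: "integrable M01 (\<lambda>y. indicator {..x} y * k y)" by (rule M01_indicator_mult[OF k]) simp
    have Feq: "F x = (\<lambda>y. f x * (indicator {x..} y * k y))" by (auto simp: F_def indicator_def)
    have "(LINT y|M01. F x y) = (LINT y|M01. f x * (k y - indicator {..x} y * k y))"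
    proof (rule integral_cong_AE[OF _ _ ae])
      have "integrable M01 (\<lambda>y. indicator {x..} y * k y)" by (rule M01_indicator_mult[OF k]) simp
      then show "F x \<in> borel_measurable M01" unfolding Feq by (auto intro: borel_measurable_integrable)
      show "(\<lambda>y. f x * (k y - indicator {..x} y * k y)) \<in> borel_measurable M01"
        using ix k by (intro borel_measurable_integrable) simp
    qed
    then show "(LINT y|M01. F x y) = f x * (LINT y|M01. k y) - f x * prim k x"
      using ix k by (simp add: prim_def right_diff_distrib)
  qed
  also have "\<dots> = (LINT x|M01. f x) * (LINT x|M01. k x) - (LINT x|M01. f x * prim k x)"
    using f M01_bounded_mult[OF f prim_continuous[OF k]] by simp
  finally show ?thesis .
qed

text \<open>A test function vanishes at 1, so its derivative has integral 0 and the boundary term of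
  the integration by parts disappears.\<close>

lemma prim_weak_deriv:
  assumes "integrable M01 k" shows "has_weak_deriv 1 (prim k) k"
  unfolding has_weak_deriv_def
proof (intro conjI allI impI)
  show "prim k \<in> L1_loc" "k \<in> L1_loc" using assms prim_integrable M01_integrable_imp_L1_loc by auto
  fix \<phi> assume \<phi>: "test_function \<phi>"
  have d: "integrable M01 (deriv \<phi>)" by (intro test_integrable test_function_deriv \<phi>)
  have \<phi>1: "\<phi> 1 = 0"
    using test_function_support[OF \<phi>] by (metis atLeastAtMost_iff not_le)
  have zero: "(LINT x|M01. deriv \<phi> x) = 0" using prim_1[OF d] prim_test[OF \<phi>, of 1] \<phi>1 by simp
  have "(LINT x|M01. prim k x * deriv \<phi> x) = - (LINT x|M01. k x * prim (deriv \<phi>) x)"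
    using integration_by_parts[OF assms d] zero by simp
  also have "(LINT x|M01. k x * prim (deriv \<phi>) x) = (LINT x|M01. k x * \<phi> x)"
    by (rule Bochner_Integration.integral_cong[OF refl]) (simp add: prim_test[OF \<phi>] space_restrict_space)
  finally show "(LINT x|M01. prim k x * (deriv ^^ 1) \<phi> x) = (- 1) ^ 1 * (LINT x|M01. k x * \<phi> x)" by simp
qed

lemma has_weak_deriv_compose:
  assumes "has_weak_deriv j u v" "has_weak_deriv k v g"
  shows "has_weak_deriv (j + k) u g"
  unfolding has_weak_deriv_def
proof (intro conjI allI impI)
  show "u \<in> L1_loc" "g \<in> L1_loc" using assms by (auto simp: has_weak_deriv_def)
  fix \<phi> assume \<phi>: "test_function \<phi>"
  show "(LINT x|M01. u x * (deriv ^^ (j + k)) \<phi> x) = (- 1) ^ (j + k) * (LINT x|M01. g x * \<phi> x)"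
    using assms \<phi> test_function_deriv_funpow[OF \<phi>, of k]
    by (simp add: has_weak_deriv_def funpow_add power_add)
qed

text \<open>The functional \<open>\<phi> \<mapsto> \<integral> f \<phi>'\<close> annihilates derivatives, hence is a multiple of \<open>\<phi> \<mapsto> \<integral> \<phi>\<close>.\<close>

theorem du_bois_reymond2:
  assumes f: "f \<in> L1_loc"
    and zero: "\<And>\<phi>. test_function \<phi> \<Longrightarrow> (LINT x|M01. f x * (deriv ^^ 2) \<phi> x) = 0"
  obtains a b where "AE x in M01. f x = a + b * x"
proof -
  obtain b where b: "test_function b" "(LINT x|M01. b x) = 1" by (rule test_function_unit_mass)
  \<comment> \<open>Subtracting the mean times \<open>b\<close> yields \<integral> f \<eta>' = c
    \<integral> \<eta>. As \<integral> x \<eta>' = - \<integral> \<eta>, the function f + c x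
    annihilates all first derivatives, and the first order case applies.\<close>
  define c where "c = (LINT x|M01. f x * deriv b x)"
  have one: "integrable M01 (\<lambda>x. 1 :: real)" and lin: "integrable M01 (\<lambda>x. x)"
    by (intro M01_integrable_continuous continuous_intros)+
  have "(LINT x|M01. (f x + c * x) * deriv \<eta> x) = 0" if \<eta>: "test_function \<eta>" for \<eta>
  proof -
    define m where "m = (LINT x|M01. \<eta> x)"
    obtain \<phi> where \<phi>: "test_function \<phi>" "deriv \<phi> = (\<lambda>x. 1 * \<eta> x + (- m) * b x)"
      unfolding m_def by (rule test_function_minus_mean[OF b \<eta>])
    have dd: "deriv (deriv \<phi>) = (\<lambda>x. 1 * deriv \<eta> x + (- m) * deriv b x)"
      using deriv_funpow_linear[OF \<eta> b(1), of 1 1 "- m"] by (simp add: \<phi>(2))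
    have i: "integrable M01 (\<lambda>x. f x * deriv \<eta> x)" "integrable M01 (\<lambda>x. f x * deriv b x)"
      using L1_loc_test_integrable[OF f] test_function_deriv \<eta> b(1) by auto
    have "0 = (LINT x|M01. f x * deriv (deriv \<phi>) x)" using zero[OF \<phi>(1)] by (simp add: numeral_2_eq_2)
    also have "\<dots> = (LINT x|M01. f x * deriv \<eta> x - m * (f x * deriv b x))"
      unfolding dd by (simp add: algebra_simps)
    also have "\<dots> = (LINT x|M01. f x * deriv \<eta> x) - c * m"
      using i by (simp add: c_def)
    finally have 1: "(LINT x|M01. f x * deriv \<eta> x) = c * m" by simp
    have "has_weak_deriv 1 (\<lambda>x. x) (\<lambda>x. 1)"
    proof (rule has_weak_deriv_cong[OF prim_weak_deriv[OF one]])
      have "prim (\<lambda>x. 1) x = x" if "x \<in> {0..1}" for x :: real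
        using prim_eq[OF one that] that by simp
      then show "AE x in M01. prim (\<lambda>x. 1) x = x" by (intro AE_M01I) simp
    qed (use one lin M01_integrable_imp_L1_loc in auto)
    then have 2: "(LINT x|M01. x * deriv \<eta> x) = - m"
      using \<eta> by (simp add: has_weak_deriv_def m_def)
    have "integrable M01 (\<lambda>x. x * deriv \<eta> x)"
      by (rule L1_loc_test_integrable[OF M01_integrable_imp_L1_loc[OF lin] test_function_deriv[OF \<eta>]])
    then have "(LINT x|M01. f x * deriv \<eta> x + c * (x * deriv \<eta> x)) = 0"
      using i 1 2 by simp
    then show ?thesis by (simp add: algebra_simps)
  qed
  moreover have "(\<lambda>x. f x + c * x) \<in> L1_loc"
    using L1_loc_linear[OF f M01_integrable_imp_L1_loc[OF lin], of 1 c] by simp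
  ultimately obtain a where "AE x in M01. f x + c * x = a" using du_bois_reymond by blast
  then have "AE x in M01. f x = a + (- c) * x" by eventually_elim simp
  then show ?thesis by (rule that)
qed

section \<open>Square integrable functions\<close>

text \<open>The measure is a parameter, so that the unweighted space and the space with density 1 /
  a are two instances of one construction.\<close>

definition Lsq :: "'a measure \<Rightarrow> ('a \<Rightarrow> real) set" where
  "Lsq M = {u \<in> borel_measurable M. integrable M (\<lambda>x. (u x)\<^sup>2)}"

lemma Lsq_mult:
  assumes "u \<in> Lsq M" "v \<in> Lsq M" shows "integrable M (\<lambda>x. u x * v x)"
proof (rule Bochner_Integration.integrable_bound)
  show "integrable M (\<lambda>x. (u x)\<^sup>2 + (v x)\<^sup>2)" using assms by (simp add: Lsq_def)
  show "(\<lambda>x. u x * v x) \<in> borel_measurable M" using assms by (auto simp: Lsq_def)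
  have "\<bar>a * b\<bar> \<le> a\<^sup>2 + b\<^sup>2" for a b :: real
  proof -
    have "0 \<le> (\<bar>a\<bar> - \<bar>b\<bar>)\<^sup>2" by simp
    then have "2 * (\<bar>a\<bar> * \<bar>b\<bar>) \<le> a\<^sup>2 + b\<^sup>2" by (simp add: power2_diff)
    moreover have "0 \<le> \<bar>a\<bar> * \<bar>b\<bar>" by simp
    ultimately show ?thesis unfolding abs_mult by linarith
  qed
  then show "AE x in M. norm (u x * v x) \<le> norm ((u x)\<^sup>2 + (v x)\<^sup>2)" by (intro AE_I2) simp
qed

lemma Lsq_linear:
  assumes "u \<in> Lsq M" "v \<in> Lsq M" shows "(\<lambda>x. a * u x + b * v x) \<in> Lsq M"
proof -
  have "(\<lambda>x. (a * u x + b * v x)\<^sup>2) = (\<lambda>x. a\<^sup>2 * (u x)\<^sup>2 + b\<^sup>2 * (v x)\<^sup>2 + 2 * a * b * (u x * v x))"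
    by (simp add: power2_eq_square algebra_simps)
  then have "integrable M (\<lambda>x. (a * u x + b * v x)\<^sup>2)"
    using assms Lsq_mult[OF assms] by (simp add: Lsq_def)
  moreover have "(\<lambda>x. a * u x + b * v x) \<in> borel_measurable M"
    using assms by (intro borel_measurable_add borel_measurable_times) (auto simp: Lsq_def)
  ultimately show ?thesis by (simp add: Lsq_def)
qed

text \<open>Riesz-Fischer: a rapidly converging subsequence converges almost everywhere, and Fatou's
  lemma turns the pointwise limit into a limit in mean square of the whole sequence.\<close>

lemma Lsq_complete:
  fixes X :: "nat \<Rightarrow> 'a \<Rightarrow> real"
  assumes X: "\<And>n. X n \<in> Lsq M"
    and cauchy: "\<And>e. 0 < e \<Longrightarrow> \<exists>N. \<forall>m\<ge>N. \<forall>n\<ge>N. (LINT x|M. (X m x - X n x)\<^sup>2) < e"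
  obtains f where "f \<in> Lsq M" "(\<lambda>n. LINT x|M. (X n x - f x)\<^sup>2) \<longlonglongrightarrow> 0"
proof -
  have [measurable]: "X n \<in> borel_measurable M" for n using X by (simp add: Lsq_def)
  have int: "integrable M (\<lambda>x. (X m x - X n x)\<^sup>2)" for m n
    using Lsq_linear[OF X[of m] X[of n], of 1 "-1"] by (simp add: Lsq_def)
  have "\<forall>k. \<exists>N. \<forall>m\<ge>N. \<forall>n\<ge>N. (LINT x|M. (X m x - X n x)\<^sup>2) < (1/4) ^ k" by (intro allI cauchy) simp
  then obtain N where N: "\<And>k m n. N k \<le> m \<Longrightarrow> N k \<le> n \<Longrightarrow> (LINT x|M. (X m x - X n x)\<^sup>2) < (1/4) ^ k"
    by metis
  \<comment> \<open>Partial sums give an increasing choice of indices that dominates both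
    \<open>N k\<close> and \<open>k\<close>.\<close>
  define r where "r k = (\<Sum>i\<le>k. N i + 1)" for k
  have r_N: "N k \<le> r k" for k
    using member_le_sum[of k "{..k}" "\<lambda>i. N i + 1"] by (simp add: r_def)
  have r_Suc: "r k \<le> r (Suc k)" for k by (simp add: r_def)
  have r_ge: "k \<le> r k" for k by (induction k) (auto simp: r_def)
  \<comment> \<open>The integrals of the squares are below 4^-k, so even with the weight 2^k the
    series of squares converges almost everywhere.\<close>
  define D where "D k x = X (r (Suc k)) x - X (r k) x" for k x
  have [measurable]: "D k \<in> borel_measurable M" for k unfolding D_def by measurable
  have "(\<integral>\<^sup>+x. (\<Sum>k. ennreal (2 ^ k * (D k x)\<^sup>2)) \<partial>M) = (\<Sum>k. \<integral>\<^sup>+x. ennreal (2 ^ k * (D k x)\<^sup>2) \<partial>M)"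
    by (rule nn_integral_suminf) measurable
  also have "\<dots> \<le> (\<Sum>k. ennreal ((1/2) ^ k))"
  proof (rule suminf_le)
    fix k
    have "(\<integral>\<^sup>+x. ennreal (2 ^ k * (D k x)\<^sup>2) \<partial>M) = ennreal (LINT x|M. 2 ^ k * (D k x)\<^sup>2)"
      using int[of "r (Suc k)" "r k"] by (intro nn_integral_eq_integral) (auto simp: D_def)
    also have "(LINT x|M. 2 ^ k * (D k x)\<^sup>2) \<le> 2 ^ k * (1/4) ^ k"
      using N[of k "r (Suc k)" "r k"] r_N[of k] r_Suc[of k] by (simp add: D_def)
    also have "2 ^ k * (1/4) ^ k = (1/2 :: real) ^ k" by (simp flip: power_mult_distrib)
    finally show "(\<integral>\<^sup>+x. ennreal (2 ^ k * (D k x)\<^sup>2) \<partial>M) \<le> ennreal ((1/2) ^ k)"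
      by (simp add: ennreal_leI)
  qed auto
  also have "\<dots> = ennreal (\<Sum>k. (1/2) ^ k)"
    by (intro suminf_ennreal2 summable_geometric) auto
  also have "\<dots> < \<infinity>" by simp
  finally have "AE x in M. (\<Sum>k. ennreal (2 ^ k * (D k x)\<^sup>2)) \<noteq> \<infinity>"
    by (intro nn_integral_PInf_AE) auto
  then have conv: "AE x in M. convergent (\<lambda>k. X (r k) x)"
  proof eventually_elim
    case (elim x)
    then have s: "summable (\<lambda>k. 2 ^ k * (D k x)\<^sup>2)"
      by (intro summable_suminf_not_top) (auto simp: top.not_eq_extremum)
    have "summable (\<lambda>k. (2 ^ k * (D k x)\<^sup>2 + (1/2) ^ k) / 2)"
      by (intro summable_divide summable_add s summable_geometric) simp
    moreover have "norm (D k x) \<le> (2 ^ k * (D k x)\<^sup>2 + (1/2) ^ k) / 2" for k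
    proof -
      \<comment> \<open>Young's inequality |D| <= (2^k D^2 + 2^-k) / 2 turns the weighted squares
        into absolute summability.\<close>
      have "0 \<le> (2 ^ k * \<bar>D k x\<bar> - 1)\<^sup>2" by simp
      then have "2 ^ k * (2 * \<bar>D k x\<bar>) \<le> 2 ^ k * (2 ^ k * (D k x)\<^sup>2 + (1/2) ^ k)"
        by (simp add: power2_diff power_mult_distrib power_one_over power2_eq_square algebra_simps)
      then show ?thesis by simp
    qed
    ultimately have "summable (\<lambda>k. D k x)" by (rule summable_comparison_test')
    then have "convergent (\<lambda>n. \<Sum>k<n. D k x)" by (simp add: summable_iff_convergent)
    then have "convergent (\<lambda>n. (\<Sum>k<n. D k x) + X (r 0) x)" by (intro convergent_add convergent_const)
    then show ?case unfolding D_def sum_lessThan_telescope[of "\<lambda>k. X (r k) x"] by simp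
  qed
  define f where "f x = lim (\<lambda>k. X (r k) x)" for x
  have f_m[measurable]: "f \<in> borel_measurable M" unfolding f_def[abs_def] by measurable
  have lim: "AE x in M. (\<lambda>k. X (r k) x) \<longlonglongrightarrow> f x"
    using conv by eventually_elim (simp add: f_def convergent_LIMSEQ_iff)
  have fatou: "(\<integral>\<^sup>+x. ennreal ((X n x - f x)\<^sup>2) \<partial>M) \<le> ennreal e"
    if e: "\<And>m. m \<ge> K \<Longrightarrow> (LINT x|M. (X n x - X m x)\<^sup>2) \<le> e" for n K e
  proof -
    have "(\<integral>\<^sup>+x. ennreal ((X n x - f x)\<^sup>2) \<partial>M) = (\<integral>\<^sup>+x. liminf (\<lambda>k. ennreal ((X n x - X (r k) x)\<^sup>2)) \<partial>M)"
    proof (rule nn_integral_cong_AE)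
      show "AE x in M. ennreal ((X n x - f x)\<^sup>2) = liminf (\<lambda>k. ennreal ((X n x - X (r k) x)\<^sup>2))"
        using lim
      proof eventually_elim
        case (elim x)
        have "(\<lambda>k. ennreal ((X n x - X (r k) x)\<^sup>2)) \<longlonglongrightarrow> ennreal ((X n x - f x)\<^sup>2)"
          by (intro tendsto_ennrealI tendsto_power tendsto_diff tendsto_const elim)
        then show ?case by (rule lim_imp_Liminf[OF trivial_limit_sequentially, symmetric])
      qed
    qed
    also have "\<dots> \<le> liminf (\<lambda>k. \<integral>\<^sup>+x. ennreal ((X n x - X (r k) x)\<^sup>2) \<partial>M)"
      by (rule nn_integral_liminf) measurable
    also have "\<dots> \<le> limsup (\<lambda>k. \<integral>\<^sup>+x. ennreal ((X n x - X (r k) x)\<^sup>2) \<partial>M)"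
      by (rule Liminf_le_Limsup) simp
    also have "\<dots> \<le> ennreal e"
    proof (rule Limsup_bounded)
      have "(\<integral>\<^sup>+x. ennreal ((X n x - X (r k) x)\<^sup>2) \<partial>M) \<le> ennreal e" if "K \<le> k" for k
      proof -
        have "(\<integral>\<^sup>+x. ennreal ((X n x - X (r k) x)\<^sup>2) \<partial>M) = ennreal (LINT x|M. (X n x - X (r k) x)\<^sup>2)"
          by (rule nn_integral_eq_integral[OF int]) simp
        then show ?thesis using e[of "r k"] r_ge[of k] that by (simp add: ennreal_leI)
      qed
      then show "\<forall>\<^sub>F k in sequentially. (\<integral>\<^sup>+x. ennreal ((X n x - X (r k) x)\<^sup>2) \<partial>M) \<le> ennreal e"
        unfolding eventually_sequentially by blast
    qed
    finally show ?thesis .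
  qed
  have diff: "integrable M (\<lambda>x. (X n x - f x)\<^sup>2) \<and> (LINT x|M. (X n x - f x)\<^sup>2) \<le> e"
    if "0 \<le> e" "\<And>m. m \<ge> K \<Longrightarrow> (LINT x|M. (X n x - X m x)\<^sup>2) \<le> e" for n K e
  proof -
    have le: "(\<integral>\<^sup>+x. ennreal ((X n x - f x)\<^sup>2) \<partial>M) \<le> ennreal e" using fatou that(2) by blast
    have i: "integrable M (\<lambda>x. (X n x - f x)\<^sup>2)"
      by (rule integrableI_nonneg) (use le in \<open>auto simp: le_less_trans\<close>)
    have "ennreal (LINT x|M. (X n x - f x)\<^sup>2) \<le> ennreal e"
      using le nn_integral_eq_integral[OF i] by simp
    then show ?thesis using i that(1) by (simp add: ennreal_le_iff)
  qed
  have small: "\<exists>K. \<forall>n\<ge>K. integrable M (\<lambda>x. (X n x - f x)\<^sup>2) \<and> (LINT x|M. (X n x - f x)\<^sup>2) \<le> e" if e: "0 < e" for e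
  proof -
    obtain K where "\<And>m n. K \<le> m \<Longrightarrow> K \<le> n \<Longrightarrow> (LINT x|M. (X m x - X n x)\<^sup>2) < e" using cauchy[OF e] by blast
    then show ?thesis using diff[of e K] e by (meson less_imp_le)
  qed
  obtain n where "integrable M (\<lambda>x. (X n x - f x)\<^sup>2)" using small[of 1] by auto
  then have "(\<lambda>x. X n x - f x) \<in> Lsq M" by (simp add: Lsq_def)
  from Lsq_linear[OF X[of n] this, of 1 "-1"] have "f \<in> Lsq M" by simp
  moreover have "(\<lambda>n. LINT x|M. (X n x - f x)\<^sup>2) \<longlonglongrightarrow> 0"
  proof (rule LIMSEQ_I)
    fix e :: real assume "0 < e"
    then obtain K where K: "\<And>n. n \<ge> K \<Longrightarrow> (LINT x|M. (X n x - f x)\<^sup>2) \<le> e / 2" using small[of "e / 2"] by auto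
    have "norm ((LINT x|M. (X n x - f x)\<^sup>2) - 0) < e" if "n \<ge> K" for n
    proof -
      have "0 \<le> (LINT x|M. (X n x - f x)\<^sup>2)" by (rule Bochner_Integration.integral_nonneg) simp
      then show ?thesis using K[OF that] \<open>0 < e\<close> by simp
    qed
    then show "\<exists>K. \<forall>n\<ge>K. norm ((LINT x|M. (X n x - f x)\<^sup>2) - 0) < e" by blast
  qed
  ultimately show ?thesis by (rule that)
qed

lemmas fun_simps = plus_fun_def fun_diff_def fun_Compl_def zero_fun_def scaleR_fun_def

theorem semi_hilbert_Lsq: "semi_hilbert (Lsq M) (\<lambda>u v. LINT x|M. u x * v x)"
proof
  show "subspace (Lsq M)"
    unfolding subspace_def
  proof (intro conjI ballI allI)
    show "0 \<in> Lsq M" by (simp add: Lsq_def zero_fun_def)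
    show "u + v \<in> Lsq M" if "u \<in> Lsq M" "v \<in> Lsq M" for u v
      using Lsq_linear[OF that, of 1 1] by (simp add: plus_fun_def)
    show "c *\<^sub>R u \<in> Lsq M" if "u \<in> Lsq M" for u c
      using Lsq_linear[OF that that, of c 0] by (simp add: scaleR_fun_def)
  qed
next
  fix u v w :: "'a \<Rightarrow> real" and c assume "u \<in> Lsq M" "v \<in> Lsq M" "w \<in> Lsq M"
  then show "(LINT x|M. (u + v) x * w x) = (LINT x|M. u x * w x) + (LINT x|M. v x * w x)"
    by (simp add: plus_fun_def distrib_right Lsq_mult)
next
  fix u v :: "'a \<Rightarrow> real" and c
  show "(LINT x|M. (c *\<^sub>R u) x * v x) = c * (LINT x|M. u x * v x)"
    by (simp add: scaleR_fun_def mult.assoc)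
next
  fix X :: "nat \<Rightarrow> 'a \<Rightarrow> real"
  assume X: "\<And>n. X n \<in> Lsq M"
    and cauchy: "\<And>e. 0 < e \<Longrightarrow> \<exists>N. \<forall>m\<ge>N. \<forall>n\<ge>N. sqrt (LINT x|M. (X m - X n) x * (X m - X n) x) < e"
  obtain f where f: "f \<in> Lsq M" "(\<lambda>n. LINT x|M. (X n x - f x)\<^sup>2) \<longlonglongrightarrow> 0"
  proof (rule Lsq_complete[OF X])
    fix e :: real assume "0 < e"
    then have "\<exists>N. \<forall>m\<ge>N. \<forall>n\<ge>N. sqrt (LINT x|M. (X m x - X n x)\<^sup>2) < sqrt e"
      using cauchy[of "sqrt e"] by (simp add: fun_diff_def power2_eq_square)
    then show "\<exists>N. \<forall>m\<ge>N. \<forall>n\<ge>N. (LINT x|M. (X m x - X n x)\<^sup>2) < e" by simp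
  qed blast
  then have "(\<lambda>n. sqrt (LINT x|M. (X n x - f x)\<^sup>2)) \<longlonglongrightarrow> sqrt 0" by (intro tendsto_real_sqrt)
  then show "\<exists>f\<in>Lsq M. (\<lambda>n. sqrt (LINT x|M. (X n - f) x * (X n - f) x)) \<longlonglongrightarrow> 0"
    using f(1) by (auto simp: fun_diff_def power2_eq_square)
qed (auto simp: mult.commute intro: Bochner_Integration.integral_nonneg)

section \<open>The space \<open>H2_0\<close>\<close>

interpretation sq: semi_hilbert "Lsq M01" "\<lambda>u v. LINT x|M01. u x * v x"
  by (rule semi_hilbert_Lsq)

lemma sq_nrm: "sq.nrm u = sqrt (LINT x|M01. (u x)\<^sup>2)"
  by (simp add: sq.nrm_def power2_eq_square)

lemma L2_eq: "L2 = Lsq M01"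
  by (auto simp: L2_def Lsq_def)

lemma Lsq_cong_AE:
  assumes "u \<in> Lsq M" "v \<in> borel_measurable M" "AE x in M. u x = v x"
  shows "v \<in> Lsq M"
proof -
  have "integrable M (\<lambda>x. (v x)\<^sup>2) \<longleftrightarrow> integrable M (\<lambda>x. (u x)\<^sup>2)"
    using assms by (intro integrable_cong_AE) (auto simp: Lsq_def)
  then show ?thesis using assms by (simp add: Lsq_def)
qed

lemma continuous_Lsq:
  assumes "continuous_on {0..1} u" shows "u \<in> Lsq M01"
proof -
  have "continuous_on {0..1} (\<lambda>x. (u x)\<^sup>2)" using assms by (intro continuous_intros)
  from M01_integrable_continuous[OF this] borel_measurable_integrable[OF M01_integrable_continuous[OF assms]]
  show ?thesis by (simp add: Lsq_def)
qed

lemma Lsq_M01_integrable: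
  assumes "u \<in> Lsq M01" shows "integrable M01 u"
  using Lsq_mult[OF assms continuous_Lsq[of "\<lambda>_. 1"]] by simp

lemma L2_L1_loc: "u \<in> L2 \<Longrightarrow> u \<in> L1_loc"
  by (simp add: L2_eq Lsq_M01_integrable M01_integrable_imp_L1_loc)

lemma M01_integral_const: "(LINT x|M01. c) = (c :: real)"
  using M01_integral_eq(2)[OF M01_integrable_continuous[of "\<lambda>_. c"]] by simp

text \<open>Cauchy-Schwarz against an indicator, whose norm is at most 1 because the interval has
  length 1.\<close>

lemma prim_le_nrm:
  assumes "g \<in> Lsq M01" shows "\<bar>prim g x\<bar> \<le> sq.nrm g"
proof -
  let ?i = "indicator {..x} :: real \<Rightarrow> real"
  have one: "integrable M01 (\<lambda>_. 1 :: real)" by (intro M01_integrable_continuous continuous_intros)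
  have i: "integrable M01 ?i" using M01_indicator_mult[OF one, of "{..x}"] by simp
  have sq: "(\<lambda>y. (?i y)\<^sup>2) = ?i" by (auto simp: indicator_def)
  have iL: "?i \<in> Lsq M01" using i by (simp add: Lsq_def sq borel_measurable_integrable)
  have "(LINT y|M01. ?i y) \<le> (LINT y|M01. 1)" by (rule integral_mono[OF i one]) (simp add: indicator_def)
  then have "(LINT y|M01. (?i y)\<^sup>2) \<le> 1" unfolding sq M01_integral_const .
  then have "sq.nrm ?i \<le> 1" by (simp add: sq_nrm)
  moreover have "\<bar>prim g x\<bar> \<le> sq.nrm ?i * sq.nrm g"
    unfolding prim_def by (rule sq.cauchy_schwarz[OF iL assms])
  ultimately show ?thesis
    using mult_right_mono[of "sq.nrm ?i" 1 "sq.nrm g"] sq.nrm_nonneg[OF assms] by simp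
qed

text \<open>The inner primitive is bounded by the norm of \<open>g\<close>, so the outer one grows
  at most linearly from 0. The factor \<open>x\<close> is what later compensates the weight 1 /
  a.\<close>

lemma prim_prim_le_nrm:
  assumes "g \<in> Lsq M01" "x \<in> {0..1}" shows "\<bar>prim (prim g) x\<bar> \<le> sq.nrm g * x"
proof -
  have "continuous_on {0..x} (prim g)"
    using prim_continuous[OF Lsq_M01_integrable[OF assms(1)]] assms(2) by (auto elim: continuous_on_subset)
  then have "norm (integral {0..x} (prim g)) \<le> sq.nrm g * (x - 0)"
    using assms(2) prim_le_nrm[OF assms(1)] by (intro integral_bound) auto
  then show ?thesis
    using prim_eq[OF prim_integrable[OF Lsq_M01_integrable[OF assms(1)]] assms(2)] by simp
qed

lemma has_weak_deriv_L1_loc: "has_weak_deriv k u g \<Longrightarrow> u \<in> L1_loc" "has_weak_deriv k u g \<Longrightarrow> g \<in> L1_loc"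
  by (auto simp: has_weak_deriv_def)

lemma field_derivative_unique_01:
  assumes "(f has_real_derivative c) (at x within {0..1})" "(f has_real_derivative d) (at x within {0..1})"
    "x \<in> {0..1}"
  shows "c = d"
  using vector_derivative_unique_within_closed_interval[of 0 1 x f c d] assms
  by (simp add: has_real_derivative_iff_has_vector_derivative)

text \<open>For the C^1 representative w, the functions w' and \<open>prim g\<close> have the same
  weak derivative, so they differ by a constant, and w' 0 = 0 removes it. The boundary values at 1
  become two orthogonality conditions on \<open>g\<close>: against 1 and, given that one, against
  x.\<close>

theorem H2_0_representation:
  assumes u: "u \<in> H2_0"
  defines "g \<equiv> weak_deriv 2 u"
  shows "g \<in> Lsq M01" "has_weak_deriv 2 u g" "(LINT x|M01. g x) = 0" "prim (prim g) 1 = 0"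
    "AE x in M01. u x = prim (prim g) x" "has_weak_deriv 1 u (prim g)"
proof -
  obtain g0 where g0: "g0 \<in> L2" "has_weak_deriv 2 u g0" using u by (auto simp: H2_0_def H2_def)
  show g2: "has_weak_deriv 2 u g" unfolding g_def by (rule weak_deriv_eq(1)[OF g0(2)])
  have "AE x in M01. g0 x = g x" unfolding g_def using weak_deriv_eq(2)[OF g0(2)] by eventually_elim simp
  then show gL: "g \<in> Lsq M01"
    using g0(1) L1_loc_measurable[OF has_weak_deriv_L1_loc(2)[OF g2]] Lsq_cong_AE by (auto simp: L2_eq)
  have gi: "integrable M01 g" and gpi: "integrable M01 (prim g)"
    using Lsq_M01_integrable[OF gL] prim_integrable by auto
  have uL: "u \<in> L1_loc" using has_weak_deriv_L1_loc(1)[OF g2] .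
  obtain w w' where uw: "AE x in M01. u x = w x"
    and w: "\<And>x. x \<in> {0..1} \<Longrightarrow> (w has_real_derivative w' x) (at x within {0..1})"
    and w'c: "continuous_on {0..1} w'" and bd: "w 0 = 0" "w 1 = 0" "w' 0 = 0" "w' 1 = 0"
    using u unfolding H2_0_def by blast
  have w'i: "integrable M01 w'" by (rule M01_integrable_continuous[OF w'c])
  have pw: "prim w' x = w x" if "x \<in> {0..1}" for x using prim_of_derivative[OF w w'c that] bd by simp
  have "AE x in M01. prim w' x = w x" by (rule AE_M01I) (simp add: pw)
  with uw have "AE x in M01. prim w' x = u x" by eventually_elim simp
  then have u1: "has_weak_deriv 1 u w'"
    using has_weak_deriv_cong[OF prim_weak_deriv[OF w'i] uL _ M01_integrable_imp_L1_loc[OF w'i]] by simp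
  obtain c where c: "AE x in M01. w' x - prim g x = c"
  proof (rule du_bois_reymond)
    show "(\<lambda>x. w' x - prim g x) \<in> L1_loc" using w'i gpi by (intro L1_loc_diff M01_integrable_imp_L1_loc)
    fix \<phi> assume \<phi>: "test_function \<phi>"
    note d\<phi> = test_function_deriv[OF \<phi>]
    have "(LINT x|M01. u x * deriv (deriv \<phi>) x) = - (LINT x|M01. w' x * deriv \<phi> x)"
      using u1 d\<phi> by (simp add: has_weak_deriv_def)
    moreover have "(LINT x|M01. u x * deriv (deriv \<phi>) x) = (LINT x|M01. g x * \<phi> x)"
      using g2 \<phi> by (simp add: has_weak_deriv_def numeral_2_eq_2)
    moreover have "(LINT x|M01. prim g x * deriv \<phi> x) = - (LINT x|M01. g x * \<phi> x)"
      using prim_weak_deriv[OF gi] \<phi> by (simp add: has_weak_deriv_def)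
    moreover have "integrable M01 (\<lambda>x. w' x * deriv \<phi> x)" "integrable M01 (\<lambda>x. prim g x * deriv \<phi> x)"
      using w'i gpi d\<phi> by (auto intro: L1_loc_test_integrable M01_integrable_imp_L1_loc)
    ultimately show "(LINT x|M01. (w' x - prim g x) * deriv \<phi> x) = 0"
      by (simp add: left_diff_distrib)
  qed blast
  \<comment> \<open>The relation w' = prim g + c is so far known almost everywhere; integrating it
    gives an identity for w at every point, which is then differentiated back, endpoints
    included.\<close>
  have w_eq: "w x = prim (prim g) x + c * x" if x: "x \<in> {0..1}" for x
  proof -
    have one: "integrable M01 (\<lambda>_. 1 :: real)" by (intro M01_integrable_continuous continuous_intros)
    have "w x = (LINT y|M01. indicator {..x} y * w' y)" using pw[OF x] by (simp add: prim_def)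
    also have "\<dots> = (LINT y|M01. indicator {..x} y * (1 * prim g y + c * 1))"
    proof (rule integral_cong_AE)
      show "(\<lambda>y. indicator {..x} y * w' y) \<in> borel_measurable M01"
        by (rule borel_measurable_integrable[OF M01_indicator_mult[OF w'i]]) simp
      have "integrable M01 (\<lambda>y. 1 * prim g y + c * 1)"
        by (intro Bochner_Integration.integrable_add integrable_mult_right gpi one)
      then show "(\<lambda>y. indicator {..x} y * (1 * prim g y + c * 1)) \<in> borel_measurable M01"
        by (intro borel_measurable_integrable[OF M01_indicator_mult]) simp_all
      show "AE y in M01. indicator {..x} y * w' y = indicator {..x} y * (1 * prim g y + c * 1)"
        using c by eventually_elim (auto simp: algebra_simps)
    qed
    also have "\<dots> = prim (\<lambda>y. 1 * prim g y + c * 1) x" by (simp add: prim_def)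
    also have "\<dots> = prim (prim g) x + c * prim (\<lambda>_. 1) x" using prim_linear[OF gpi one, of 1 c x] by simp
    also have "prim (\<lambda>_. 1) x = x" using prim_eq[OF one x] x by simp
    finally show ?thesis .
  qed
  have w'_eq: "w' x = prim g x + c" if x: "x \<in> {0..1}" for x
  proof (rule field_derivative_unique_01[OF w[OF x] _ x])
    have "((\<lambda>x. prim (prim g) x + c * x) has_real_derivative prim g x + c * 1) (at x within {0..1})"
      by (intro DERIV_add DERIV_cmult DERIV_ident prim_has_derivative prim_continuous gi x)
    then have D: "((\<lambda>x. prim (prim g) x + c * x) has_real_derivative prim g x + c) (at x within {0..1})" by simp
    show "(w has_real_derivative prim g x + c) (at x within {0..1})"
      by (rule has_field_derivative_transform_within[OF D zero_less_one x]) (rule w_eq[symmetric])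
  qed
  have c0: "c = 0" using w'_eq[of 0] bd prim_0[OF gi] by simp
  show "(LINT x|M01. g x) = 0" using w'_eq[of 1] bd prim_1[OF gi] c0 by simp
  show "prim (prim g) 1 = 0" using w_eq[of 1] bd c0 by simp
  have "AE x in M01. w x = prim (prim g) x" by (rule AE_M01I) (simp add: w_eq c0)
  with uw show "AE x in M01. u x = prim (prim g) x" by eventually_elim simp
  have ae: "AE x in M01. w' x = prim g x" by (rule AE_M01I) (simp add: w'_eq c0)
  show "has_weak_deriv 1 u (prim g)"
    by (rule has_weak_deriv_cong[OF u1 uL _ M01_integrable_imp_L1_loc[OF gpi] ae]) simp
qed

text \<open>The double primitive of \<open>g\<close> is itself the C^1 representative demanded by
  \<open>H2_0\<close>; the two conditions on \<open>g\<close> are its boundary conditions at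
  1.\<close>

theorem H2_0I:
  assumes g: "g \<in> Lsq M01" "(LINT x|M01. g x) = 0" "prim (prim g) 1 = 0"
    and u: "u \<in> L2" "AE x in M01. u x = prim (prim g) x"
  shows "u \<in> H2_0" "has_weak_deriv 2 u g"
proof -
  have gi: "integrable M01 g" and gpi: "integrable M01 (prim g)"
    using Lsq_M01_integrable[OF g(1)] prim_integrable by auto
  have ae: "AE x in M01. prim (prim g) x = u x" using u(2) by eventually_elim simp
  have u1: "has_weak_deriv 1 u (prim g)"
    by (rule has_weak_deriv_cong[OF prim_weak_deriv[OF gpi] L2_L1_loc[OF u(1)] ae M01_integrable_imp_L1_loc[OF gpi]]) simp
  show u2: "has_weak_deriv 2 u g"
    using has_weak_deriv_compose[OF u1 prim_weak_deriv[OF gi]] by (simp add: numeral_2_eq_2)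
  have "prim g \<in> L2" unfolding L2_eq by (rule continuous_Lsq[OF prim_continuous[OF gi]])
  then have "u \<in> H2" using u u1 u2 g(1) by (auto simp: H2_def L2_eq)
  then show "u \<in> H2_0"
    unfolding H2_0_def
    using u(2) prim_has_derivative[OF prim_continuous[OF gi]] prim_continuous[OF gi]
      prim_0[OF gpi] g(3) prim_0[OF gi] prim_1[OF gi] g(2)
    by (intro CollectI conjI exI[of _ "prim (prim g)"] exI[of _ "prim g"]) auto
qed

lemma weak_deriv_measurable: "has_weak_deriv k u g \<Longrightarrow> weak_deriv k u \<in> borel_measurable M01"
  by (rule L1_loc_measurable[OF has_weak_deriv_L1_loc(2)[OF weak_deriv_eq(1)]])

lemma H2_0_L2: "u \<in> H2_0 \<Longrightarrow> u \<in> L2"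
  by (simp add: H2_0_def H2_def)

lemma H2_0_bound:
  assumes "u \<in> H2_0" shows "AE x in M01. \<bar>u x\<bar> \<le> sq.nrm (weak_deriv 2 u) * x"
proof -
  have "AE x in M01. \<bar>prim (prim (weak_deriv 2 u)) x\<bar> \<le> sq.nrm (weak_deriv 2 u) * x"
    by (rule AE_M01I) (simp add: prim_prim_le_nrm H2_0_representation(1)[OF assms])
  with H2_0_representation(5)[OF assms] show ?thesis by eventually_elim simp
qed

lemma H2_0_linear:
  assumes "u \<in> H2_0" "v \<in> H2_0"
  shows "(\<lambda>x. a * u x + b * v x) \<in> H2_0"
    "AE x in M01. weak_deriv 2 (\<lambda>x. a * u x + b * v x) x = a * weak_deriv 2 u x + b * weak_deriv 2 v x"
proof -
  let ?g = "weak_deriv 2 u" and ?h = "weak_deriv 2 v"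
  note U = H2_0_representation[OF assms(1)] and V = H2_0_representation[OF assms(2)]
  show "AE x in M01. weak_deriv 2 (\<lambda>x. a * u x + b * v x) x = a * ?g x + b * ?h x"
    by (rule weak_deriv_linear[OF U(2) V(2)])
  have i: "integrable M01 ?g" "integrable M01 ?h" using U V Lsq_M01_integrable by auto
  have p: "prim (\<lambda>x. a * ?g x + b * ?h x) = (\<lambda>x. a * prim ?g x + b * prim ?h x)"
    using prim_linear[OF i] by blast
  have pp: "prim (prim (\<lambda>x. a * ?g x + b * ?h x)) = (\<lambda>x. a * prim (prim ?g) x + b * prim (prim ?h) x)"
    unfolding p using prim_linear[OF prim_integrable[OF i(1)] prim_integrable[OF i(2)]] by blast
  show "(\<lambda>x. a * u x + b * v x) \<in> H2_0"
  proof (rule H2_0I(1)[of "\<lambda>x. a * ?g x + b * ?h x"])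
    show "(\<lambda>x. a * ?g x + b * ?h x) \<in> Lsq M01" by (rule Lsq_linear[OF U(1) V(1)])
    show "(LINT x|M01. a * ?g x + b * ?h x) = 0" using i U(3) V(3) by simp
    show "prim (prim (\<lambda>x. a * ?g x + b * ?h x)) 1 = 0" unfolding pp using U(4) V(4) by simp
    show "(\<lambda>x. a * u x + b * v x) \<in> L2" unfolding L2_eq using assms H2_0_L2 by (intro Lsq_linear) (auto simp: L2_eq)
    show "AE x in M01. a * u x + b * v x = prim (prim (\<lambda>x. a * ?g x + b * ?h x)) x"
      unfolding pp using U(5) V(5) by eventually_elim simp
  qed
qed

lemma H2_0_diff:
  assumes "u \<in> H2_0" "v \<in> H2_0"
  shows "u - v \<in> H2_0" "AE x in M01. weak_deriv 2 (u - v) x = weak_deriv 2 u x - weak_deriv 2 v x"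
  using H2_0_linear[OF assms, of 1 "-1"] by (simp_all add: fun_diff_def)

lemma H2_0_cong:
  assumes "u \<in> H2_0" "v \<in> L2" "AE x in M01. u x = v x"
  shows "v \<in> H2_0" "AE x in M01. weak_deriv 2 v x = weak_deriv 2 u x"
proof -
  note U = H2_0_representation[OF assms(1)]
  have "AE x in M01. v x = prim (prim (weak_deriv 2 u)) x"
    using U(5) assms(3) by eventually_elim simp
  from H2_0I[OF U(1,3,4) assms(2) this] weak_deriv_eq(2)
  show "v \<in> H2_0" "AE x in M01. weak_deriv 2 v x = weak_deriv 2 u x" by blast+
qed

text \<open>The second derivative alone gives a complete seminorm. Along a Cauchy sequence the
  second derivatives converge in L2 to some g; the conditions at 1 pass to g because primitives are
  bounded by the L2 norm, and the limit is the double primitive of g.\<close>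

theorem semi_hilbert_H2_0: "semi_hilbert H2_0 (\<lambda>u v. LINT x|M01. weak_deriv 2 u x * weak_deriv 2 v x)"
proof
  have lin: "(\<lambda>x. a * u x + b * v x) = a *\<^sub>R u + b *\<^sub>R v" for a b and u v :: "real \<Rightarrow> real"
    by (simp add: fun_simps)
  have "0 \<in> H2_0"
  proof (rule H2_0I(1)[of "\<lambda>_. 0"])
    have "prim (\<lambda>_. 0) = (\<lambda>_. 0)" by (simp add: prim_def fun_eq_iff)
    then show "prim (prim (\<lambda>_. 0)) 1 = 0" "AE x in M01. 0 x = prim (prim (\<lambda>_. 0)) x"
      by (simp_all add: zero_fun_def)
  qed (auto simp: L2_eq Lsq_def zero_fun_def)
  then show "subspace H2_0"
    unfolding subspace_def
    using H2_0_linear(1)[of _ _ 1 1, unfolded lin] H2_0_linear(1)[of _ _ _ 0, unfolded lin] by simp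
next
  fix u v z c assume uv: "u \<in> H2_0" "v \<in> H2_0" "z \<in> H2_0"
  note R = H2_0_representation(1)
  have m: "weak_deriv 2 y \<in> borel_measurable M01" if "y \<in> H2_0" for y using R[OF that] by (simp add: Lsq_def)
  have sum_in: "u + v \<in> H2_0" "c *\<^sub>R u \<in> H2_0"
    using H2_0_linear(1)[OF uv(1,2), of 1 1] H2_0_linear(1)[OF uv(1,2), of c 0] by (simp_all add: fun_simps)
  have "(LINT x|M01. weak_deriv 2 (u + v) x * weak_deriv 2 z x) =
      (LINT x|M01. (weak_deriv 2 u x + weak_deriv 2 v x) * weak_deriv 2 z x)"
  proof (rule integral_cong_AE)
    have "AE x in M01. weak_deriv 2 (u + v) x = weak_deriv 2 u x + weak_deriv 2 v x"
      using H2_0_linear(2)[OF uv(1,2), of 1 1] by (simp add: fun_simps)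
    then show "AE x in M01. weak_deriv 2 (u + v) x * weak_deriv 2 z x =
        (weak_deriv 2 u x + weak_deriv 2 v x) * weak_deriv 2 z x" by eventually_elim simp
  qed (use m uv sum_in in \<open>auto intro!: borel_measurable_times borel_measurable_add\<close>)
  then show "(LINT x|M01. weak_deriv 2 (u + v) x * weak_deriv 2 z x) =
      (LINT x|M01. weak_deriv 2 u x * weak_deriv 2 z x) + (LINT x|M01. weak_deriv 2 v x * weak_deriv 2 z x)"
    using Lsq_mult[OF R[OF uv(1)] R[OF uv(3)]] Lsq_mult[OF R[OF uv(2)] R[OF uv(3)]]
    by (simp add: distrib_right)
next
  fix u z :: "real \<Rightarrow> real" and c assume uz: "u \<in> H2_0" "z \<in> H2_0"
  note R = H2_0_representation(1)
  have m: "weak_deriv 2 y \<in> borel_measurable M01" if "y \<in> H2_0" for y using R[OF that] by (simp add: Lsq_def)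
  have sc: "c *\<^sub>R u \<in> H2_0" using H2_0_linear(1)[OF uz(1,1), of c 0] by (simp add: fun_simps)
  have "(LINT x|M01. weak_deriv 2 (c *\<^sub>R u) x * weak_deriv 2 z x) =
      (LINT x|M01. c * (weak_deriv 2 u x * weak_deriv 2 z x))"
  proof (rule integral_cong_AE)
    have "AE x in M01. weak_deriv 2 (c *\<^sub>R u) x = c * weak_deriv 2 u x"
      using H2_0_linear(2)[OF uz(1,1), of c 0] by (simp add: fun_simps)
    then show "AE x in M01. weak_deriv 2 (c *\<^sub>R u) x * weak_deriv 2 z x = c * (weak_deriv 2 u x * weak_deriv 2 z x)"
      by eventually_elim simp
  qed (use m uz sc in \<open>auto intro!: borel_measurable_times\<close>)
  then show "(LINT x|M01. weak_deriv 2 (c *\<^sub>R u) x * weak_deriv 2 z x) =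
      c * (LINT x|M01. weak_deriv 2 u x * weak_deriv 2 z x)" by simp
next
  fix X :: "nat \<Rightarrow> real \<Rightarrow> real"
  assume X: "\<And>n. X n \<in> H2_0"
    and cauchy: "\<And>e. 0 < e \<Longrightarrow> \<exists>M. \<forall>m\<ge>M. \<forall>n\<ge>M.
      sqrt (LINT x|M01. weak_deriv 2 (X m - X n) x * weak_deriv 2 (X m - X n) x) < e"
  define G where "G n = weak_deriv 2 (X n)" for n
  have G: "G n \<in> Lsq M01" for n unfolding G_def by (rule H2_0_representation(1)[OF X])
  have nrm_diff: "sqrt (LINT x|M01. weak_deriv 2 (X n - y) x * weak_deriv 2 (X n - y) x) = sq.nrm (G n - g)"
    if "y \<in> H2_0" "AE x in M01. weak_deriv 2 y x = g x" "g \<in> Lsq M01" for n y g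
  proof -
    have "(LINT x|M01. weak_deriv 2 (X n - y) x * weak_deriv 2 (X n - y) x) = (LINT x|M01. (G n - g) x * (G n - g) x)"
    proof (rule integral_cong_AE)
      show "(\<lambda>x. weak_deriv 2 (X n - y) x * weak_deriv 2 (X n - y) x) \<in> borel_measurable M01"
        using H2_0_representation(1)[OF H2_0_diff(1)[OF X that(1)]]
        by (intro borel_measurable_times) (auto simp: Lsq_def)
      show "(\<lambda>x. (G n - g) x * (G n - g) x) \<in> borel_measurable M01"
      proof -
        have "G n - g \<in> borel_measurable M01"
          using sq.V_diff[OF G that(3)] by (simp only: Lsq_def mem_Collect_eq)
        then show ?thesis by (intro borel_measurable_times)
      qed
      show "AE x in M01. weak_deriv 2 (X n - y) x * weak_deriv 2 (X n - y) x = (G n - g) x * (G n - g) x"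
        using H2_0_diff(2)[OF X[of n] that(1)] that(2) by eventually_elim (simp add: G_def fun_diff_def)
    qed
    then show ?thesis by (simp add: sq.nrm_def)
  qed
  obtain g where g: "g \<in> Lsq M01" "(\<lambda>n. sq.nrm (G n - g)) \<longlonglongrightarrow> 0"
  proof (rule sq.complete_nrm[OF G])
    fix e :: real assume "0 < e"
    moreover have "sqrt (LINT x|M01. weak_deriv 2 (X m - X n) x * weak_deriv 2 (X m - X n) x) = sq.nrm (G m - G n)"
      for m n using nrm_diff[OF X _ G] by (simp add: G_def)
    ultimately show "\<exists>M. \<forall>m\<ge>M. \<forall>n\<ge>M. sq.nrm (G m - G n) < e" using cauchy by simp
  qed blast
  have gi: "integrable M01 g" "integrable M01 (G n)" for n using g G Lsq_M01_integrable by auto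
  have p: "prim (G n - g) x = prim (G n) x - prim g x" for n x
    using prim_linear[OF gi(2)[of n] gi(1), of 1 "-1" x] by (simp add: fun_diff_def)
  have pp: "prim (prim (G n - g)) x = prim (prim (G n)) x - prim (prim g) x" for n x
    using prim_linear[OF prim_integrable[OF gi(2)[of n]] prim_integrable[OF gi(1)], of 1 "-1" x]
    by (simp add: p[abs_def])
  have le0: "z = 0" if "\<And>n. \<bar>z\<bar> \<le> sq.nrm (G n - g)" for z
    using LIMSEQ_le_const[OF g(2), of "\<bar>z\<bar>"] that by auto
  have g1: "prim g 1 = 0"
  proof (rule le0)
    fix n show "\<bar>prim g 1\<bar> \<le> sq.nrm (G n - g)"
      using prim_le_nrm[OF sq.V_diff[OF G[of n] g(1)], of 1] p[of n 1] prim_1[OF gi(2)[of n]] H2_0_representation(3)[OF X[of n]]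
      by (simp add: G_def)
  qed
  have g2: "prim (prim g) 1 = 0"
  proof (rule le0)
    fix n show "\<bar>prim (prim g) 1\<bar> \<le> sq.nrm (G n - g)"
      using prim_prim_le_nrm[OF sq.V_diff[OF G[of n] g(1)], of 1] pp[of n 1] H2_0_representation(4)[OF X[of n]]
      by (simp add: G_def)
  qed
  have "prim (prim g) \<in> L2"
    unfolding L2_eq by (intro continuous_Lsq prim_continuous prim_integrable gi)
  from H2_0I[OF g(1) _ g2 this] g1 prim_1[OF gi(1)]
  have y: "prim (prim g) \<in> H2_0" "has_weak_deriv 2 (prim (prim g)) g" by auto
  show "\<exists>y\<in>H2_0. (\<lambda>n. sqrt (LINT x|M01. weak_deriv 2 (X n - y) x * weak_deriv 2 (X n - y) x)) \<longlonglongrightarrow> 0"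
    using g(2) unfolding nrm_diff[OF y(1) weak_deriv_eq(2)[OF y(2)] g(1), symmetric]
    by (rule bexI[OF _ y(1)])
qed (auto simp: mult.commute intro: Bochner_Integration.integral_nonneg)

section \<open>The degenerate weight\<close>

locale degenerate =
  fixes a :: "real \<Rightarrow> real"
  assumes a_continuous: "continuous_on {0..1} a"
    and a_positive: "x \<in> {0<..1} \<Longrightarrow> 0 < a x"
    and a_degenerate: "\<exists>K\<in>{0<..<2::real}. \<exists>r\<in>{0<..1}. mono_on {0<..r} (\<lambda>x. x powr K / a x)"
begin

lemma a_pos: "0 < x \<Longrightarrow> x < 1 \<Longrightarrow> 0 < a x"
  using a_positive by simp

lemma a_lower:
  assumes "0 < c" "c \<le> 1" obtains m where "0 < m" "\<And>x. x \<in> {c..1} \<Longrightarrow> m \<le> a x"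
proof -
  have "continuous_on {c..1} a" using a_continuous assms by (auto elim: continuous_on_subset)
  then obtain y where "y \<in> {c..1}" "\<And>x. x \<in> {c..1} \<Longrightarrow> a y \<le> a x"
    using continuous_attains_inf[of "{c..1}" a] assms by auto
  then show ?thesis using that[of "a y"] a_positive[of y] assms by auto
qed

text \<open>Elements of \<open>H2_0\<close> are \<open>O(x)\<close> at \<open>0\<close>, so only \<open>x / a x\<close> and \<open>x\<^sup>2 / a x\<close> have to be controlled.\<close>

lemma weight_bound:
  obtains C K where "0 \<le> C" "K < 2" "\<And>x. 0 < x \<Longrightarrow> x < 1 \<Longrightarrow> x / a x \<le> C * x powr (1 - K) + C"
    "\<And>x. 0 < x \<Longrightarrow> x < 1 \<Longrightarrow> x\<^sup>2 / a x \<le> C"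
proof -
  obtain K r where K: "0 < K" "K < 2" and r: "0 < r" "r \<le> 1" and mono: "mono_on {0<..r} (\<lambda>x. x powr K / a x)"
    using a_degenerate by auto
  \<comment> \<open>Monotonicity bounds x^K / a x on (0, r] by its value at \<open>r\<close>; on
    [r, 1] the weight is bounded below by the constant m.\<close>
  define c where "c = r powr K / a r"
  have c: "0 \<le> c" using a_positive[of r] r by (simp add: c_def)
  obtain m where m: "0 < m" "\<And>x. x \<in> {r..1} \<Longrightarrow> m \<le> a x" using a_lower[OF r] by metis
  define C where "C = c + 1 / m"
  have C: "0 \<le> C" "c \<le> C" "1 / m \<le> C" using c m by (simp_all add: C_def)
  have small: "x / a x \<le> C * x powr (1 - K) \<and> x\<^sup>2 / a x \<le> C" if x: "0 < x" "x \<le> r" for x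
  proof -
    have ax: "0 < a x" using a_positive[of x] x r by simp
    have le: "x powr K / a x \<le> C" using mono_onD[OF mono, of x r] x r C by (auto simp: c_def)
    have "x / a x = x powr (1 - K) * (x powr K / a x)" using x by (simp flip: powr_add)
    also have "\<dots> \<le> x powr (1 - K) * C" using le by (intro mult_left_mono) auto
    finally have 1: "x / a x \<le> C * x powr (1 - K)" by (simp add: mult.commute)
    have "x\<^sup>2 / a x = x powr (2 - K) * (x powr K / a x)"
      using x by (simp flip: powr_add)
    also have "\<dots> \<le> 1 * C" using powr_le1[of "2 - K" x] le K x r ax by (intro mult_mono) auto
    finally show ?thesis using 1 by simp
  qed
  have large: "x / a x \<le> C \<and> x\<^sup>2 / a x \<le> C" if x: "r \<le> x" "x < 1" for x
  proof -
    have ax: "m \<le> a x" using m(2)[of x] x by simp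
    have "x \<le> 1" "x\<^sup>2 \<le> 1" using x r by (auto simp: power_le_one)
    then have "x / a x \<le> 1 / m" "x\<^sup>2 / a x \<le> 1 / m" using ax m(1) x r by (auto intro!: frac_le)
    then show ?thesis using C by linarith
  qed
  show ?thesis
  proof (rule that[OF C(1) K(2)])
    fix x :: real assume x: "0 < x" "x < 1"
    have p: "0 \<le> C * x powr (1 - K)" using C by simp
    have "x / a x \<le> C * x powr (1 - K) + C \<and> x\<^sup>2 / a x \<le> C"
    proof (cases "x \<le> r")
      case True
      then show ?thesis using small[OF x(1) True] C(1) by linarith
    next
      case False
      then show ?thesis using large[of x] x p by linarith
    qed
    then show "x / a x \<le> C * x powr (1 - K) + C" "x\<^sup>2 / a x \<le> C" by simp_all
  qed
qed

lemma a_measurable: "a \<in> borel_measurable M01"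
  by (rule borel_measurable_integrable[OF M01_integrable_continuous[OF a_continuous]])

lemma inverse_a_measurable: "(\<lambda>x. 1 / a x) \<in> borel_measurable M01"
  using a_measurable by (intro borel_measurable_divide) auto

text \<open>K < 2 makes the exponent 1 - K of the dominating power exceed -1.\<close>

lemma weight_integrable: "integrable M01 (\<lambda>x. x / a x)"
proof -
  obtain C K where C: "0 \<le> C" "K < 2" "\<And>x. 0 < x \<Longrightarrow> x < 1 \<Longrightarrow> x / a x \<le> C * x powr (1 - K) + C"
    using weight_bound by metis
  have "(\<lambda>x. x powr (1 - K)) integrable_on {0..1}"
    using has_integral_powr_from_0[of "1 - K" 1] C(2) by (auto simp: integrable_on_def)
  then have "(\<lambda>x. x powr (1 - K)) absolutely_integrable_on {0..1}"
    by (rule nonnegative_absolutely_integrable_1) simp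
  then have "set_integrable lebesgue {0<..<1} (\<lambda>x. x powr (1 - K))" by (rule set_integrable_subset) auto
  then have p: "integrable M01 (\<lambda>x. x powr (1 - K))" by (simp only: M01_integrable_iff)
  show ?thesis
  proof (rule Bochner_Integration.integrable_bound)
    have "integrable M01 (\<lambda>_. C)" by (intro M01_integrable_continuous continuous_intros)
    then show "integrable M01 (\<lambda>x. C * x powr (1 - K) + C)" using p by simp
    have "(\<lambda>x. x) \<in> borel_measurable M01" by (intro M01_continuous_measurable continuous_intros)
    then show "(\<lambda>x. x / a x) \<in> borel_measurable M01" using a_measurable by (intro borel_measurable_divide)
    show "AE x in M01. norm (x / a x) \<le> norm (C * x powr (1 - K) + C)"
    proof (rule AE_M01I)
      fix x :: real assume x: "0 < x" "x < 1"
      have "norm (x / a x) = x / a x" using a_pos[OF x] x by simp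
      also have "\<dots> \<le> C * x powr (1 - K) + C" by (rule C(3)[OF x])
      finally show "norm (x / a x) \<le> norm (C * x powr (1 - K) + C)" by simp
    qed
  qed
qed

end

section \<open>The energy space and the fourth order operator\<close>

lemma semi_hilbert_cong:
  assumes "semi_hilbert V ip" "\<And>x y. x \<in> V \<Longrightarrow> y \<in> V \<Longrightarrow> ip x y = ip' x y"
  shows "semi_hilbert V ip'"
proof -
  interpret semi_hilbert V ip by fact
  show ?thesis
  proof
    show "subspace V" by (rule subspace_V)
    fix X :: "nat \<Rightarrow> 'a"
    assume X: "\<And>n. X n \<in> V"
      and cauchy: "\<And>e. 0 < e \<Longrightarrow> \<exists>M. \<forall>m\<ge>M. \<forall>n\<ge>M. sqrt (ip' (X m - X n) (X m - X n)) < e"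
    have eq: "sqrt (ip' (X m - y) (X m - y)) = nrm (X m - y)" if "y \<in> V" for m y
      using assms(2)[of "X m - y" "X m - y"] V_diff[OF X that] by (simp add: nrm_def)
    obtain y where "y \<in> V" "(\<lambda>n. nrm (X n - y)) \<longlonglongrightarrow> 0"
    proof (rule complete_nrm[OF X])
      fix e :: real assume "0 < e"
      from cauchy[OF this] show "\<exists>M. \<forall>m\<ge>M. \<forall>n\<ge>M. nrm (X m - X n) < e" by (simp only: eq[OF X])
    qed blast
    then show "\<exists>y\<in>V. (\<lambda>n. sqrt (ip' (X n - y) (X n - y))) \<longlonglongrightarrow> 0"
      by (intro bexI[of _ y]) (simp_all add: eq)
  next
    fix x y z c assume v: "x \<in> V" "z \<in> V"
    show "ip' (c *\<^sub>R x) z = c * ip' x z" using v by (simp add: assms(2)[symmetric] ip_bilinear)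
    show "ip' (x + y) z = ip' x z + ip' y z" if "y \<in> V"
      using v that by (simp add: assms(2)[symmetric] ip_bilinear)
  next
    show "ip' x y = ip' y x" if "x \<in> V" "y \<in> V" for x y using that by (simp add: assms(2)[symmetric] ip_sym)
    show "0 \<le> ip' x x" if "x \<in> V" for x using that by (simp add: assms(2)[symmetric] ip_nonneg)
  qed
qed

lemma semi_hilbert_prod:
  assumes "semi_hilbert V ip" "semi_hilbert W jp"
  shows "semi_hilbert (V \<times> W) (\<lambda>x y. ip (fst x) (fst y) + jp (snd x) (snd y))"
proof -
  interpret v: semi_hilbert V ip by fact
  interpret w: semi_hilbert W jp by fact
  show ?thesis
  proof
    show "subspace (V \<times> W)" by (intro subspace_Times v.subspace_V w.subspace_V)
    fix X :: "nat \<Rightarrow> 'a \<times> 'b"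
    assume X: "\<And>n. X n \<in> V \<times> W" and cauchy: "\<And>e. 0 < e \<Longrightarrow> \<exists>M. \<forall>m\<ge>M. \<forall>n\<ge>M.
      sqrt (ip (fst (X m - X n)) (fst (X m - X n)) + jp (snd (X m - X n)) (snd (X m - X n))) < e"
    have X1: "fst (X n) \<in> V" and X2: "snd (X n) \<in> W" for n using X[of n] by (auto simp: mem_Times_iff)
    have eq: "sqrt (ip (fst (X m - y)) (fst (X m - y)) + jp (snd (X m - y)) (snd (X m - y)))
        = sqrt ((v.nrm (fst (X m) - fst y))\<^sup>2 + (w.nrm (snd (X m) - snd y))\<^sup>2)" if "y \<in> V \<times> W" for m y
      using that X1 X2 by (simp add: v.nrm_sq w.nrm_sq v.V_diff w.V_diff mem_Times_iff)
    have le: "v.nrm (fst (X m) - fst (X n)) \<le> sqrt ((v.nrm (fst (X m) - fst (X n)))\<^sup>2 + (w.nrm (snd (X m) - snd (X n)))\<^sup>2)"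
        "w.nrm (snd (X m) - snd (X n)) \<le> sqrt ((v.nrm (fst (X m) - fst (X n)))\<^sup>2 + (w.nrm (snd (X m) - snd (X n)))\<^sup>2)" for m n
      by (intro real_le_rsqrt; simp)+
    obtain y where y: "y \<in> V" "(\<lambda>n. v.nrm (fst (X n) - y)) \<longlonglongrightarrow> 0"
    proof (rule v.complete_nrm[OF X1])
      fix e :: real assume "0 < e"
      from cauchy[OF this] obtain M where
        "\<And>m n. M \<le> m \<Longrightarrow> M \<le> n \<Longrightarrow> sqrt ((v.nrm (fst (X m) - fst (X n)))\<^sup>2 + (w.nrm (snd (X m) - snd (X n)))\<^sup>2) < e"
        unfolding eq[OF X] by blast
      then have "\<And>m n. M \<le> m \<Longrightarrow> M \<le> n \<Longrightarrow> v.nrm (fst (X m) - fst (X n)) < e"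
        using le(1) by (rule order_le_less_trans[rotated])
      then show "\<exists>M. \<forall>m\<ge>M. \<forall>n\<ge>M. v.nrm (fst (X m) - fst (X n)) < e" by blast
    qed blast
    obtain z where z: "z \<in> W" "(\<lambda>n. w.nrm (snd (X n) - z)) \<longlonglongrightarrow> 0"
    proof (rule w.complete_nrm[OF X2])
      fix e :: real assume "0 < e"
      from cauchy[OF this] obtain M where
        "\<And>m n. M \<le> m \<Longrightarrow> M \<le> n \<Longrightarrow> sqrt ((v.nrm (fst (X m) - fst (X n)))\<^sup>2 + (w.nrm (snd (X m) - snd (X n)))\<^sup>2) < e"
        unfolding eq[OF X] by blast
      then have "\<And>m n. M \<le> m \<Longrightarrow> M \<le> n \<Longrightarrow> w.nrm (snd (X m) - snd (X n)) < e"
        using le(2) by (rule order_le_less_trans[rotated])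
      then show "\<exists>M. \<forall>m\<ge>M. \<forall>n\<ge>M. w.nrm (snd (X m) - snd (X n)) < e" by blast
    qed blast
    have yz: "(y, z) \<in> V \<times> W" using y z by simp
    have "(\<lambda>n. sqrt ((v.nrm (fst (X n) - y))\<^sup>2 + (w.nrm (snd (X n) - z))\<^sup>2)) \<longlonglongrightarrow> sqrt (0\<^sup>2 + 0\<^sup>2)"
      by (intro tendsto_intros y z)
    then show "\<exists>y\<in>V \<times> W. (\<lambda>n. sqrt (ip (fst (X n - y)) (fst (X n - y)) + jp (snd (X n - y)) (snd (X n - y)))) \<longlonglongrightarrow> 0"
      using eq[OF yz] yz by (intro bexI[of _ "(y, z)"]) simp_all
  qed (auto simp: v.ip_bilinear w.ip_bilinear algebra_simps v.ip_nonneg w.ip_nonneg v.ip_sym w.ip_sym)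
qed

interpretation h2: semi_hilbert H2_0 "\<lambda>u v. LINT x|M01. weak_deriv 2 u x * weak_deriv 2 v x"
  by (rule semi_hilbert_H2_0)

lemma h2_nrm: "h2.nrm u = sq.nrm (weak_deriv 2 u)"
  by (simp add: h2.nrm_def sq.nrm_def)

lemma h2_null: "u \<in> H2_0 \<Longrightarrow> h2.nrm u = 0 \<Longrightarrow> AE x in M01. u x = 0"
  using H2_0_bound[of u] by (simp add: h2_nrm)

lemma prim_cong: "(\<And>x. 0 < x \<Longrightarrow> x < 1 \<Longrightarrow> f x = g x) \<Longrightarrow> prim f = prim g"
  unfolding prim_def by (intro ext Bochner_Integration.integral_cong) (auto simp: space_restrict_space)

lemma test_function_H2_0:
  assumes "test_function \<phi>"
  shows "\<phi> \<in> H2_0" "has_weak_deriv 2 \<phi> (deriv (deriv \<phi>))"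
proof -
  let ?g = "deriv (deriv \<phi>)"
  have t: "test_function (deriv \<phi>)" "test_function ?g" using assms test_function_deriv by auto
  have p: "prim (prim ?g) = prim (deriv \<phi>)" by (rule prim_cong) (simp add: prim_test[OF t(1)])
  have at1: "\<psi> 1 = 0" if "test_function \<psi>" for \<psi>
    using test_function_support[OF that] by (metis atLeastAtMost_iff not_le)
  have c: "\<psi> \<in> Lsq M01" if "test_function \<psi>" for \<psi>
    by (rule continuous_Lsq[OF test_function_continuous[OF that]])
  have "(LINT x|M01. ?g x) = 0"
    using prim_1[OF test_integrable[OF t(2)]] prim_test[OF t(1), of 1] at1[OF t(1)] by simp
  moreover have "prim (prim ?g) 1 = 0" unfolding p using prim_test[OF assms, of 1] at1[OF assms] by simp
  moreover have "AE x in M01. \<phi> x = prim (prim ?g) x"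
    unfolding p by (rule AE_M01I) (simp add: prim_test[OF assms])
  ultimately show "\<phi> \<in> H2_0" "has_weak_deriv 2 \<phi> (deriv (deriv \<phi>))"
    using H2_0I[OF c[OF t(2)]] c[OF assms] by (auto simp: L2_eq)
qed

text \<open>Two of the four derivatives on the test function are absorbed by the defining property
  of \<open>weak_deriv 2 u\<close>; the other two form the weak formulation.\<close>

lemma weak_form_imp_weak_deriv4:
  assumes "u \<in> H2_0" "k \<in> L1_loc"
    and "\<And>\<phi>. test_function \<phi> \<Longrightarrow> (LINT x|M01. weak_deriv 2 u x * deriv (deriv \<phi>) x) = (LINT x|M01. k x * \<phi> x)"
  shows "has_weak_deriv 4 u k"
  unfolding has_weak_deriv_def
proof (intro conjI allI impI)
  note U = H2_0_representation[OF assms(1)]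
  show "u \<in> L1_loc" "k \<in> L1_loc" using has_weak_deriv_L1_loc(1)[OF U(2)] assms by auto
  fix \<phi> assume \<phi>: "test_function \<phi>"
  have "(deriv ^^ 4) \<phi> = (deriv ^^ 2) (deriv (deriv \<phi>))" by (simp add: eval_nat_numeral)
  then have "(LINT x|M01. u x * (deriv ^^ 4) \<phi> x) = (LINT x|M01. weak_deriv 2 u x * deriv (deriv \<phi>) x)"
    using U(2) test_function_deriv[OF test_function_deriv[OF \<phi>]] by (simp add: has_weak_deriv_def)
  then show "(LINT x|M01. u x * (deriv ^^ 4) \<phi> x) = (- 1) ^ 4 * (LINT x|M01. k x * \<phi> x)"
    using assms(3)[OF \<phi>] by simp
qed

text \<open>Since \<open>k\<close> is integrable up to the endpoints, \<open>u''\<close> differs from a double primitive of \<open>k\<close>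
  by an affine function, and all boundary terms vanish.\<close>

theorem green_L1:
  assumes u: "u \<in> H2_0" "has_weak_deriv 4 u k" and k: "integrable M01 k" and v: "v \<in> H2_0"
  shows "(LINT x|M01. weak_deriv 2 u x * weak_deriv 2 v x) = (LINT x|M01. v x * k x)"
proof -
  note U = H2_0_representation[OF u(1)] and V = H2_0_representation[OF v]
  let ?g = "weak_deriv 2 u" and ?h = "weak_deriv 2 v"
  have gi: "integrable M01 ?g" and hi: "integrable M01 ?h" using U V Lsq_M01_integrable by auto
  note pk = prim_integrable[OF k] and ph = prim_integrable[OF hi]
  note ppk = prim_integrable[OF pk]
  obtain \<alpha> \<beta> where ab: "AE x in M01. ?g x - prim (prim k) x = \<alpha> + \<beta> * x"
  proof (rule du_bois_reymond2)
    show "(\<lambda>x. ?g x - prim (prim k) x) \<in> L1_loc"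
      using gi ppk by (intro L1_loc_diff M01_integrable_imp_L1_loc)
    fix \<phi> assume \<phi>: "test_function \<phi>"
    note t2 = test_function_deriv_funpow[OF \<phi>, of 2]
    have "(deriv ^^ 4) \<phi> = (deriv ^^ 2) ((deriv ^^ 2) \<phi>)" by (simp add: eval_nat_numeral)
    then have "(LINT x|M01. ?g x * (deriv ^^ 2) \<phi> x) = (LINT x|M01. u x * (deriv ^^ 4) \<phi> x)"
      using U(2) t2 by (simp add: has_weak_deriv_def)
    also have "\<dots> = (LINT x|M01. k x * \<phi> x)" using u(2) \<phi> by (simp add: has_weak_deriv_def)
    also have "\<dots> = (LINT x|M01. prim (prim k) x * (deriv ^^ 2) \<phi> x)"
      using has_weak_deriv_compose[OF prim_weak_deriv[OF pk] prim_weak_deriv[OF k]] \<phi>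
      by (simp add: has_weak_deriv_def numeral_2_eq_2)
    finally show "(LINT x|M01. (?g x - prim (prim k) x) * (deriv ^^ 2) \<phi> x) = 0"
      using L1_loc_test_integrable[OF M01_integrable_imp_L1_loc[OF gi] t2]
        L1_loc_test_integrable[OF M01_integrable_imp_L1_loc[OF ppk] t2]
      by (simp add: left_diff_distrib)
  qed blast
  have one: "integrable M01 (\<lambda>_. 1 :: real)" by (intro M01_integrable_continuous continuous_intros)
  have prim_one: "prim (\<lambda>_. 1) x = x" if "0 < x" "x < 1" for x using prim_eq[OF one, of x] that by simp
  have int_ph: "(LINT x|M01. prim ?h x) = 0" using prim_1[OF ph] V(4) by simp
  have hx_i: "integrable M01 (\<lambda>x. ?h x * x)" by (rule M01_bounded_mult[OF hi]) (intro continuous_intros)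
  have hP_i: "integrable M01 (\<lambda>x. ?h x * prim (prim k) x)" by (rule M01_bounded_mult[OF hi prim_continuous[OF pk]])
  \<comment> \<open>Together with \<open>V(3)\<close> this says that the second derivative of
    \<open>v\<close> is orthogonal to 1 and x, which removes the affine part.\<close>
  have hx: "(LINT x|M01. ?h x * x) = 0"
  proof -
    have "(LINT x|M01. ?h x * x) = (LINT x|M01. ?h x * prim (\<lambda>_. 1) x)"
      by (rule Bochner_Integration.integral_cong[OF refl]) (simp add: prim_one space_restrict_space)
    also have "\<dots> = - (LINT x|M01. prim ?h x * 1)"
      using integration_by_parts[OF hi one] V(3) by simp
    finally show ?thesis using int_ph by simp
  qed
  \<comment> \<open>Two integrations by parts; the boundary terms carry the factors \<integral> h
    and \<integral> prim h, both of which vanish.\<close>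
  have hP: "(LINT x|M01. ?h x * prim (prim k) x) = (LINT x|M01. prim (prim ?h) x * k x)"
    using integration_by_parts[OF hi pk] integration_by_parts[OF ph k] V(3) int_ph by simp
  have "(LINT x|M01. ?g x * ?h x) = (LINT x|M01. ?h x * prim (prim k) x + (\<alpha> * ?h x + \<beta> * (?h x * x)))"
  proof (rule integral_cong_AE)
    show "(\<lambda>x. ?g x * ?h x) \<in> borel_measurable M01"
      using gi hi by (intro borel_measurable_times borel_measurable_integrable)
    have "integrable M01 (\<lambda>x. ?h x * prim (prim k) x + (\<alpha> * ?h x + \<beta> * (?h x * x)))"
      by (intro Bochner_Integration.integrable_add integrable_mult_right hP_i hi hx_i)
    then show "(\<lambda>x. ?h x * prim (prim k) x + (\<alpha> * ?h x + \<beta> * (?h x * x))) \<in> borel_measurable M01"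
      by (rule borel_measurable_integrable)
    show "AE x in M01. ?g x * ?h x = ?h x * prim (prim k) x + (\<alpha> * ?h x + \<beta> * (?h x * x))"
      using ab
    proof eventually_elim
      case (elim x)
      then have "?g x = prim (prim k) x + (\<alpha> + \<beta> * x)" by simp
      then show ?case by (simp add: algebra_simps)
    qed
  qed
  also have "\<dots> = (LINT x|M01. ?h x * prim (prim k) x) + (\<alpha> * (LINT x|M01. ?h x) + \<beta> * (LINT x|M01. ?h x * x))"
    using hP_i hi hx_i by simp
  also have "\<dots> = (LINT x|M01. prim (prim ?h) x * k x)" using hx hP V(3) by simp
  also have "\<dots> = (LINT x|M01. v x * k x)"
  proof (rule integral_cong_AE)
    show "AE x in M01. prim (prim ?h) x * k x = v x * k x" using V(5) by eventually_elim simp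
    show "(\<lambda>x. prim (prim ?h) x * k x) \<in> borel_measurable M01"
      using prim_integrable[OF ph] k by (intro borel_measurable_times borel_measurable_integrable)
    show "(\<lambda>x. v x * k x) \<in> borel_measurable M01"
      using H2_0_L2[OF v] k by (intro borel_measurable_times borel_measurable_integrable) (auto simp: L2_eq Lsq_M01_integrable)
  qed
  finally show ?thesis .
qed

section \<open>The weighted space, the operator and its resolvent\<close>

context degenerate
begin

text \<open>As the space of square integrable functions for this measure, \<open>L2w a\<close>
  inherits its Hilbert structure and completeness from \<open>Lsq\<close>.\<close>

definition mu :: "real measure" where "mu = density M01 (\<lambda>x. ennreal (1 / a x))"

lemma borel_measurable_mu: "borel_measurable mu = borel_measurable M01"
  by (rule measurable_cong_sets) (simp_all add: mu_def)

lemma AE_a_pos: "AE x in M01. 0 < a x"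
  by (rule AE_M01I) (rule a_pos)

lemma mu_integral:
  assumes "f \<in> borel_measurable M01"
  shows "integrable mu f \<longleftrightarrow> integrable M01 (\<lambda>x. f x / a x)" "(LINT x|mu. f x) = (LINT x|M01. f x / a x)"
proof -
  have nn: "AE x in M01. 0 \<le> 1 / a x" using AE_a_pos by eventually_elim simp
  show "integrable mu f \<longleftrightarrow> integrable M01 (\<lambda>x. f x / a x)"
    unfolding mu_def integrable_density[OF assms inverse_a_measurable nn] by simp
  show "(LINT x|mu. f x) = (LINT x|M01. f x / a x)"
    unfolding mu_def integral_density[OF assms inverse_a_measurable nn] by simp
qed

lemma a_upper: obtains A where "0 < A" "\<And>x. 0 < x \<Longrightarrow> x < 1 \<Longrightarrow> a x \<le> A"
proof -
  obtain y where "y \<in> {0..1}" "\<And>x. x \<in> {0..1} \<Longrightarrow> a x \<le> a y"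
    using continuous_attains_sup[of "{0..1}" a] a_continuous by auto
  note y = this
  have "0 < a 1" using a_positive[of 1] by simp
  also have "a 1 \<le> a y" by (rule y(2)) simp
  finally show ?thesis by (rule that) (simp add: y(2))
qed

text \<open>The inclusion from right to left rests on an upper bound A of \<open>a\<close>: u^2 is
  at most A u^2 / a.\<close>

lemma L2w_eq: "L2w a = Lsq mu"
proof (intro equalityI subsetI)
  fix u assume "u \<in> L2w a"
  then show "u \<in> Lsq mu"
    by (auto simp: L2w_def L2_def Lsq_def borel_measurable_mu mu_integral)
next
  fix u assume u: "u \<in> Lsq mu"
  then have m: "u \<in> borel_measurable M01" and i: "integrable M01 (\<lambda>x. (u x)\<^sup>2 / a x)"
    by (auto simp: Lsq_def borel_measurable_mu mu_integral)
  obtain A where A: "0 < A" "\<And>x. 0 < x \<Longrightarrow> x < 1 \<Longrightarrow> a x \<le> A" using a_upper by metis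
  have "integrable M01 (\<lambda>x. (u x)\<^sup>2)"
  proof (rule Bochner_Integration.integrable_bound)
    show "integrable M01 (\<lambda>x. A * ((u x)\<^sup>2 / a x))" by (rule integrable_mult_right[OF i])
    show "(\<lambda>x. (u x)\<^sup>2) \<in> borel_measurable M01" using m by simp
    show "AE x in M01. norm ((u x)\<^sup>2) \<le> norm (A * ((u x)\<^sup>2 / a x))"
    proof (rule AE_M01I)
      fix x :: real assume x: "0 < x" "x < 1"
      have "(u x)\<^sup>2 * a x \<le> (u x)\<^sup>2 * A" using A(2)[OF x] by (intro mult_left_mono) auto
      then show "norm ((u x)\<^sup>2) \<le> norm (A * ((u x)\<^sup>2 / a x))"
        using a_pos[OF x] A(1) by (simp add: field_simps)
    qed
  qed
  then show "u \<in> L2w a" using m i by (simp add: L2w_def L2_def)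
qed

lemma L2w_measurable: "u \<in> L2w a \<Longrightarrow> u \<in> borel_measurable M01"
  by (simp add: L2w_def L2_def)

sublocale w: semi_hilbert "L2w a" "\<lambda>u v. LINT x|M01. u x * v x / a x"
proof (rule semi_hilbert_cong[of _ "\<lambda>u v. LINT x|mu. u x * v x"])
  show "semi_hilbert (L2w a) (\<lambda>u v. LINT x|mu. u x * v x)" unfolding L2w_eq by (rule semi_hilbert_Lsq)
  show "(LINT x|mu. u x * v x) = (LINT x|M01. u x * v x / a x)" if "u \<in> L2w a" "v \<in> L2w a" for u v
    using that L2w_measurable by (intro mu_integral(2) borel_measurable_times) auto
qed

lemma w_nrm: "w.nrm u = norm_L2w a u"
  by (simp add: w.nrm_def norm_L2w_def power2_eq_square)

lemma L2w_mult: "u \<in> L2w a \<Longrightarrow> v \<in> L2w a \<Longrightarrow> integrable M01 (\<lambda>x. u x * v x / a x)"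
  using Lsq_mult[of u mu v] mu_integral(1)[of "\<lambda>x. u x * v x"] L2w_measurable[of u] L2w_measurable[of v]
  by (simp add: L2w_eq)

lemma L2w_null:
  assumes "u \<in> L2w a" shows "w.nrm u = 0 \<longleftrightarrow> (AE x in M01. u x = 0)"
proof -
  have nn: "AE x in M01. 0 \<le> u x * u x / a x" using AE_a_pos by eventually_elim simp
  have "w.nrm u = 0 \<longleftrightarrow> (LINT x|M01. u x * u x / a x) = 0" by (simp add: w.nrm_def)
  also have "\<dots> \<longleftrightarrow> (AE x in M01. u x * u x / a x = 0)"
    by (rule integral_nonneg_eq_0_iff_AE[OF L2w_mult[OF assms assms] nn])
  also have "\<dots> \<longleftrightarrow> (AE x in M01. u x = 0)"
  proof
    assume "AE x in M01. u x * u x / a x = 0"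
    with AE_a_pos show "AE x in M01. u x = 0" by eventually_elim auto
  next
    assume "AE x in M01. u x = 0"
    then show "AE x in M01. u x * u x / a x = 0" by eventually_elim simp
  qed
  finally show ?thesis .
qed

lemma L2w_cong: "u \<in> L2w a \<Longrightarrow> v \<in> borel_measurable M01 \<Longrightarrow> AE x in M01. u x = v x \<Longrightarrow> v \<in> L2w a"
proof -
  assume *: "u \<in> L2w a" "v \<in> borel_measurable M01" "AE x in M01. u x = v x"
  have "integrable M01 (\<lambda>x. (v x)\<^sup>2 / a x) \<longleftrightarrow> integrable M01 (\<lambda>x. (u x)\<^sup>2 / a x)"
    using * a_measurable L2w_measurable by (intro integrable_cong_AE borel_measurable_divide borel_measurable_power) auto
  then show ?thesis using * Lsq_cong_AE[of u M01 v] by (simp add: L2w_def L2_eq)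
qed

lemma L2w_ip_cong:
  assumes "u \<in> L2w a" "u' \<in> L2w a" "v \<in> L2w a" "AE x in M01. u x = u' x"
  shows "(LINT x|M01. u x * v x / a x) = (LINT x|M01. u' x * v x / a x)"
  using assms(4) L2w_mult[OF assms(1,3)] L2w_mult[OF assms(2,3)]
  by (intro integral_cong_AE borel_measurable_integrable) auto

text \<open>A Hardy type inequality: |u| is at most x times the norm of the second derivative, and
  x^2 / a is bounded. Hence the weighted norm is subordinate to that of the second derivative, and
  \<open>H2w a\<close> is \<open>H2_0\<close> as a set.\<close>

lemma H2_0_subset_L2w:
  obtains C where "0 \<le> C" "\<And>u. u \<in> H2_0 \<Longrightarrow> u \<in> L2w a \<and> w.nrm u \<le> C * h2.nrm u"
proof -
  obtain C where C: "0 \<le> C" "\<And>x. 0 < x \<Longrightarrow> x < 1 \<Longrightarrow> x\<^sup>2 / a x \<le> C" using weight_bound by metis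
  have "u \<in> L2w a \<and> w.nrm u \<le> sqrt C * h2.nrm u" if u: "u \<in> H2_0" for u
  proof -
    let ?N = "h2.nrm u"
    have N: "0 \<le> ?N" using h2.nrm_nonneg[OF u] .
    have um: "u \<in> borel_measurable M01" using H2_0_L2[OF u] by (simp add: L2_def)
    have bound: "AE x in M01. (u x)\<^sup>2 / a x \<le> C * ?N\<^sup>2"
    proof -
      have "AE x in M01. 0 < x \<and> x < 1" by (rule AE_M01I) simp
      with H2_0_bound[OF u] show ?thesis
      proof eventually_elim
        case (elim x)
        then have "(u x)\<^sup>2 \<le> (?N * x)\<^sup>2" by (intro power2_le_iff_abs_le[THEN iffD2]) (auto simp: h2_nrm N[unfolded h2_nrm])
        then have "(u x)\<^sup>2 / a x \<le> (?N * x)\<^sup>2 / a x"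
          using a_pos[of x] elim by (intro divide_right_mono) auto
        also have "\<dots> = ?N\<^sup>2 * (x\<^sup>2 / a x)" by (simp add: power_mult_distrib)
        also have "\<dots> \<le> ?N\<^sup>2 * C" using C(2)[of x] elim by (intro mult_left_mono) auto
        finally show ?case by (simp add: mult.commute)
      qed
    qed
    have nn: "AE x in M01. 0 \<le> (u x)\<^sup>2 / a x" using AE_a_pos by eventually_elim simp
    have const: "integrable M01 (\<lambda>_. C * ?N\<^sup>2)" by (intro M01_integrable_continuous continuous_intros)
    have i: "integrable M01 (\<lambda>x. (u x)\<^sup>2 / a x)"
    proof (rule Bochner_Integration.integrable_bound[OF const])
      show "(\<lambda>x. (u x)\<^sup>2 / a x) \<in> borel_measurable M01"
        using um a_measurable by (intro borel_measurable_divide borel_measurable_power)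
      show "AE x in M01. norm ((u x)\<^sup>2 / a x) \<le> norm (C * ?N\<^sup>2)"
        using bound nn by eventually_elim simp
    qed
    have "(LINT x|M01. (u x)\<^sup>2 / a x) \<le> (LINT x|M01. C * ?N\<^sup>2)" by (rule integral_mono_AE[OF i const bound])
    then have "(LINT x|M01. (u x)\<^sup>2 / a x) \<le> C * ?N\<^sup>2" by (simp only: M01_integral_const)
    then have "w.nrm u \<le> sqrt (C * ?N\<^sup>2)" by (simp add: w_nrm norm_L2w_def)
    then show ?thesis using i H2_0_L2[OF u] N by (simp add: L2w_def real_sqrt_mult)
  qed
  then show ?thesis using that[of "sqrt C"] C by simp
qed

lemma H2_0_L2w: "u \<in> H2_0 \<Longrightarrow> u \<in> L2w a"
  using H2_0_subset_L2w by metis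

lemma H2w_eq: "H2w a = H2_0"
  using H2_0_L2w by (auto simp: H2w_def)

text \<open>On compact subintervals of (0,1) the weight is bounded below. Up to 0 the quotient need
  not be integrable, which is the obstruction to a direct proof of Green's formula on
  \<open>domA a\<close>.\<close>

lemma divide_a_L1_loc:
  assumes "f \<in> L2w a" shows "(\<lambda>x. f x / a x) \<in> L1_loc"
  unfolding L1_loc_def
proof (intro CollectI allI impI)
  fix c d :: real assume cd: "0 < c \<and> c < d \<and> d < 1"
  have "(\<lambda>x. 1 / a x * f x) absolutely_integrable_on {c..d}"
  proof (rule absolutely_integrable_bounded_measurable_product_real)
    have "a x \<noteq> 0" if "x \<in> {c..d}" for x using a_positive[of x] cd that by auto
    moreover have "continuous_on {c..d} a" using cd by (intro continuous_on_subset[OF a_continuous]) auto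
    ultimately have cont: "continuous_on {c..d} (\<lambda>x. 1 / a x)" by (intro continuous_intros) auto
    show "(\<lambda>x. 1 / a x) \<in> borel_measurable (lebesgue_on {c..d})"
      using cont by (rule continuous_imp_measurable_on_sets_lebesgue) simp
    show "bounded ((\<lambda>x. 1 / a x) ` {c..d})"
      using cont by (intro compact_imp_bounded compact_continuous_image compact_Icc)
    have "f \<in> L1_loc" using assms L2_L1_loc by (simp add: L2w_def)
    then show "f absolutely_integrable_on {c..d}" using cd by (simp add: L1_loc_def)
  qed simp
  then show "(\<lambda>x. f x / a x) absolutely_integrable_on {c..d}" by simp
qed

lemma domA_I:
  assumes "u \<in> H2_0" "has_weak_deriv 4 u k" "z \<in> L2w a" "AE x in M01. a x * k x = z x"
  shows "u \<in> domA a" "AE x in M01. opA a u x = z x"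
proof -
  show eq: "AE x in M01. opA a u x = z x"
    using weak_deriv_eq(2)[OF assms(2)] assms(4) by eventually_elim (simp add: opA_def)
  have "opA a u \<in> borel_measurable M01"
    unfolding opA_def using a_measurable weak_deriv_measurable[OF assms(2)] by (intro borel_measurable_times)
  moreover have "AE x in M01. z x = opA a u x" using eq by eventually_elim simp
  ultimately have "opA a u \<in> L2w a" using L2w_cong[OF assms(3)] by blast
  then show "u \<in> domA a" using assms(1,2) by (auto simp: domA_def H2w_eq)
qed

lemma domA_D:
  assumes "u \<in> domA a"
  shows "u \<in> H2_0" "opA a u \<in> L2w a" "has_weak_deriv 4 u (weak_deriv 4 u)"
  using assms weak_deriv_eq(1) by (auto simp: domA_def H2w_eq)

lemma domA_linear:
  assumes "u \<in> domA a" "v \<in> domA a"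
  shows "(\<lambda>x. b * u x + c * v x) \<in> domA a"
    "AE x in M01. opA a (\<lambda>x. b * u x + c * v x) x = b * opA a u x + c * opA a v x"
proof -
  note U = domA_D[OF assms(1)] and V = domA_D[OF assms(2)]
  have z: "(\<lambda>x. b * opA a u x + c * opA a v x) \<in> L2w a"
    using U V unfolding L2w_eq by (intro Lsq_linear) auto
  have "AE x in M01. a x * (b * weak_deriv 4 u x + c * weak_deriv 4 v x) = b * opA a u x + c * opA a v x"
    by (intro AE_I2) (simp add: opA_def algebra_simps)
  from domA_I[OF H2_0_linear(1)[OF U(1) V(1)] has_weak_deriv_linear[OF U(3) V(3)] z this]
  show "(\<lambda>x. b * u x + c * v x) \<in> domA a"
    "AE x in M01. opA a (\<lambda>x. b * u x + c * v x) x = b * opA a u x + c * opA a v x" by auto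
qed

lemma domA_cong:
  assumes "u \<in> domA a" "v \<in> H2_0" "AE x in M01. u x = v x"
  shows "v \<in> domA a" "AE x in M01. opA a v x = opA a u x"
proof -
  note U = domA_D[OF assms(1)]
  have "has_weak_deriv 4 v (weak_deriv 4 u)"
    by (rule has_weak_deriv_cong[OF U(3) L2_L1_loc[OF H2_0_L2[OF assms(2)]] assms(3) has_weak_deriv_L1_loc(2)[OF U(3)]]) simp
  from domA_I[OF assms(2) this U(2)]
  show "v \<in> domA a" "AE x in M01. opA a v x = opA a u x" by (auto simp: opA_def)
qed

text \<open>The equation forces w'''' = - w / (c a), which is dominated by a multiple of x / a and
  hence integrable. \<open>green_L1\<close> with v = w then equates the integral of (w'')^2 with - 1
  / c times that of w^2 / a, and the opposite signs leave only 0.\<close>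

theorem resolvent_unique:
  assumes "w \<in> domA a" "0 < c" "AE x in M01. w x + c * opA a w x = 0"
  shows "h2.nrm w = 0"
proof -
  note W = domA_D[OF assms(1)]
  define k where "k x = - (1 / c) * (w x / a x)" for x
  have wi: "integrable M01 (\<lambda>x. w x / a x)"
  proof (rule Bochner_Integration.integrable_bound)
    show "integrable M01 (\<lambda>x. h2.nrm w * (x / a x))" by (rule integrable_mult_right[OF weight_integrable])
    show "(\<lambda>x. w x / a x) \<in> borel_measurable M01"
      using a_measurable L2w_measurable[OF H2_0_L2w[OF W(1)]] by (intro borel_measurable_divide)
    have "AE x in M01. 0 < x \<and> x < 1" by (rule AE_M01I) simp
    with H2_0_bound[OF W(1)] show "AE x in M01. norm (w x / a x) \<le> norm (h2.nrm w * (x / a x))"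
    proof eventually_elim
      case (elim x)
      have "\<bar>w x\<bar> / a x \<le> h2.nrm w * x / a x"
        using elim a_pos[of x] by (intro divide_right_mono) (auto simp: h2_nrm)
      then show ?case using elim a_pos[of x] h2.nrm_nonneg[OF W(1)] by simp
    qed
  qed
  have ki: "integrable M01 k" unfolding k_def[abs_def] by (rule integrable_mult_right[OF wi])
  have ae: "AE x in M01. weak_deriv 4 w x = k x"
    using assms(3) AE_a_pos
  proof eventually_elim
    case (elim x)
    then have "c * (a x * weak_deriv 4 w x) = - w x" by (simp add: opA_def)
    then show ?case using elim assms(2) by (simp add: k_def field_simps)
  qed
  have "has_weak_deriv 4 w k"
    by (rule has_weak_deriv_cong[OF W(3) L2_L1_loc[OF H2_0_L2[OF W(1)]] AE_I2 M01_integrable_imp_L1_loc[OF ki] ae]) (rule refl)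
  from green_L1[OF W(1) this ki W(1)]
  have "(LINT x|M01. weak_deriv 2 w x * weak_deriv 2 w x) = (LINT x|M01. w x * k x)" .
  also have "(\<lambda>x. w x * k x) = (\<lambda>x. - (1 / c) * (w x * w x / a x))" by (simp add: k_def)
  also have "(LINT x|M01. - (1 / c) * (w x * w x / a x)) = - (1 / c) * (LINT x|M01. w x * w x / a x)"
    by (rule integral_mult_right_zero)
  also have "\<dots> \<le> 0" using w.ip_nonneg[OF H2_0_L2w[OF W(1)]] assms(2) by (simp add: divide_nonneg_pos)
  finally show ?thesis using h2.ip_nonneg[OF W(1)] by (simp add: h2.nrm_def)
qed

text \<open>Riesz for the sum of c times the second derivative form and the weighted inner product;
  it is complete because convergence of second derivatives entails weighted convergence. The weak
  formulation is kept as a third conclusion: for this solution it is Green's formula against every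
  \<open>v\<close> in \<open>H2_0\<close>, not just against test functions.\<close>

theorem resolvent_exists:
  assumes f: "f \<in> L2w a" and c: "0 < c"
  obtains u where "u \<in> domA a" "AE x in M01. u x + c * opA a u x = f x"
    "\<And>v. v \<in> H2_0 \<Longrightarrow> c * (LINT x|M01. weak_deriv 2 u x * weak_deriv 2 v x) = (LINT x|M01. (f x - u x) * v x / a x)"
proof -
  obtain C where C: "0 \<le> C" "\<And>u. u \<in> H2_0 \<Longrightarrow> u \<in> L2w a \<and> w.nrm u \<le> C * h2.nrm u"
    by (rule H2_0_subset_L2w) (rule that)
  let ?h = "\<lambda>u v. LINT x|M01. weak_deriv 2 u x * weak_deriv 2 v x"
  let ?w = "\<lambda>u v. LINT x|M01. u x * v x / a x"
  let ?ip = "\<lambda>u v. c * ?h u v + ?w u v"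
  interpret r: semi_hilbert H2_0 ?ip
  proof
    show "subspace H2_0" by (rule h2.subspace_V)
    fix u v z :: "real \<Rightarrow> real" and b :: real assume uz: "u \<in> H2_0" "z \<in> H2_0"
    show "?ip (u + v) z = ?ip u z + ?ip v z" if "v \<in> H2_0"
      using h2.ip_add[OF uz(1) that uz(2)] w.ip_add[of u v z] uz that C(2) by (simp add: algebra_simps)
    show "?ip (b *\<^sub>R u) z = b * ?ip u z"
      using h2.ip_scale[OF uz, of b] w.ip_scale[of u z b] uz C(2) by (simp add: algebra_simps)
  next
    show "?ip u v = ?ip v u" if "u \<in> H2_0" "v \<in> H2_0" for u v
      using h2.ip_sym[OF that] w.ip_sym[of u v] that C(2) by simp
    show "0 \<le> ?ip u u" if "u \<in> H2_0" for u
      using h2.ip_nonneg[OF that] w.ip_nonneg[of u] that C(2) c by simp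
  next
    fix X :: "nat \<Rightarrow> real \<Rightarrow> real"
    assume X: "\<And>n. X n \<in> H2_0"
      and cauchy: "\<And>e. 0 < e \<Longrightarrow> \<exists>M. \<forall>m\<ge>M. \<forall>n\<ge>M. sqrt (?ip (X m - X n) (X m - X n)) < e"
    have eq: "?ip y y = c * (h2.nrm y)\<^sup>2 + (w.nrm y)\<^sup>2" if "y \<in> H2_0" for y
      using h2.nrm_sq[OF that] w.nrm_sq[of y] C(2)[OF that] by simp
    have le: "sqrt c * h2.nrm y \<le> sqrt (?ip y y)" if "y \<in> H2_0" for y
    proof -
      have "sqrt c * h2.nrm y = sqrt (c * (h2.nrm y)\<^sup>2)" using h2.nrm_nonneg[OF that] by (simp add: real_sqrt_mult)
      then show ?thesis unfolding eq[OF that] by simp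
    qed
    obtain y where y: "y \<in> H2_0" "(\<lambda>n. h2.nrm (X n - y)) \<longlonglongrightarrow> 0"
    proof (rule h2.complete_nrm[OF X])
      fix e :: real assume e: "0 < e"
      then have "0 < sqrt c * e" using c by simp
      from cauchy[OF this]
      obtain M where M: "\<And>m n. M \<le> m \<Longrightarrow> M \<le> n \<Longrightarrow> sqrt (?ip (X m - X n) (X m - X n)) < sqrt c * e"
        by blast
      have "h2.nrm (X m - X n) < e" if "M \<le> m" "M \<le> n" for m n
      proof -
        have "sqrt c * h2.nrm (X m - X n) < sqrt c * e"
          using le[OF h2.V_diff[OF X X], of m n] M[OF that] by (rule order_le_less_trans)
        then show ?thesis using c by simp
      qed
      then show "\<exists>M. \<forall>m\<ge>M. \<forall>n\<ge>M. h2.nrm (X m - X n) < e" by blast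
    qed blast
    have wlim: "(\<lambda>n. w.nrm (X n - y)) \<longlonglongrightarrow> 0"
    proof (rule Lim_null_comparison)
      show "(\<lambda>n. C * h2.nrm (X n - y)) \<longlonglongrightarrow> 0" using tendsto_mult[OF tendsto_const y(2), of C] by simp
      show "\<forall>\<^sub>F n in sequentially. norm (w.nrm (X n - y)) \<le> C * h2.nrm (X n - y)"
      proof (intro always_eventually allI)
        fix n
        have "X n - y \<in> H2_0" by (rule h2.V_diff[OF X y(1)])
        then show "norm (w.nrm (X n - y)) \<le> C * h2.nrm (X n - y)" using C(2) w.nrm_nonneg by simp
      qed
    qed
    have "(\<lambda>n. sqrt (c * (h2.nrm (X n - y))\<^sup>2 + (w.nrm (X n - y))\<^sup>2)) \<longlonglongrightarrow> sqrt (c * 0\<^sup>2 + 0\<^sup>2)"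
      by (intro tendsto_intros y(2) wlim)
    then have "(\<lambda>n. sqrt (?ip (X n - y) (X n - y))) \<longlonglongrightarrow> 0"
      unfolding eq[OF h2.V_diff[OF X y(1)]] by simp
    then show "\<exists>y\<in>H2_0. (\<lambda>n. sqrt (?ip (X n - y) (X n - y))) \<longlonglongrightarrow> 0"
      by (rule bexI[OF _ y(1)])
  qed
  obtain u where u: "u \<in> H2_0" "\<And>v. v \<in> H2_0 \<Longrightarrow> ?ip u v = ?w f v"
  proof (rule r.riesz[of "?w f" "w.nrm f"])
    show "?w f (x + y) = ?w f x + ?w f y" if "x \<in> H2_0" "y \<in> H2_0" for x y
      using w.ip_add2[of x y f] that f C(2) by blast
    show "?w f (b *\<^sub>R x) = b * ?w f x" if "x \<in> H2_0" for x b
      using w.ip_scale2[of x f b] that f C(2) by blast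
    show "\<bar>?w f x\<bar> \<le> w.nrm f * r.nrm x" if x: "x \<in> H2_0" for x
    proof -
      have "w.nrm x \<le> r.nrm x"
        unfolding w.nrm_def r.nrm_def using h2.ip_nonneg[OF x] c by simp
      then have "w.nrm f * w.nrm x \<le> w.nrm f * r.nrm x" using w.nrm_nonneg[OF f] by (rule mult_left_mono)
      then show ?thesis using w.cauchy_schwarz[of f x] f C(2)[OF x] by fastforce
    qed
  qed blast
  have uw: "u \<in> L2w a" using C(2) u(1) by blast
  have fu: "f - u \<in> L2w a" by (rule w.V_diff[OF f uw])
  have weak: "c * ?h u v = ?w (f - u) v" if "v \<in> H2_0" for v
    using u(2)[OF that] w.ip_diff[OF f uw, of v] C(2)[OF that] by simp
  \<comment> \<open>The fourth derivative dictated by u + c a u'''' = f.\<close>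
  define k where "k x = (1 / c) * ((f - u) x / a x)" for x
  have z: "(\<lambda>x. (1 / c) * (f - u) x) \<in> L2w a"
    using w.V_scale[OF fu, of "1 / c"] by (simp add: scaleR_fun_def)
  have kL: "k \<in> L1_loc" using divide_a_L1_loc[OF z] by (simp add: k_def[abs_def])
  have "has_weak_deriv 4 u k"
  proof (rule weak_form_imp_weak_deriv4[OF u(1) kL])
    fix \<phi> assume \<phi>: "test_function \<phi>"
    note T = test_function_H2_0[OF \<phi>]
    have "(LINT x|M01. weak_deriv 2 u x * deriv (deriv \<phi>) x) = ?h u \<phi>"
    proof (rule integral_cong_AE)
      show "AE x in M01. weak_deriv 2 u x * deriv (deriv \<phi>) x = weak_deriv 2 u x * weak_deriv 2 \<phi> x"
        using weak_deriv_eq(2)[OF T(2)] by eventually_elim simp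
      show "(\<lambda>x. weak_deriv 2 u x * weak_deriv 2 \<phi> x) \<in> borel_measurable M01"
        by (intro borel_measurable_times weak_deriv_measurable[OF T(2)] weak_deriv_measurable[OF H2_0_representation(2)[OF u(1)]])
      show "(\<lambda>x. weak_deriv 2 u x * deriv (deriv \<phi>) x) \<in> borel_measurable M01"
        by (intro borel_measurable_times borel_measurable_integrable test_integrable test_function_deriv \<phi>
            weak_deriv_measurable[OF H2_0_representation(2)[OF u(1)]])
    qed
    also have "\<dots> = (1 / c) * ?w (f - u) \<phi>" unfolding weak[OF T(1), symmetric] using c by simp
    also have "\<dots> = (LINT x|M01. (1 / c) * ((f - u) x * \<phi> x / a x))"
      by (rule integral_mult_right_zero[symmetric])
    also have "(\<lambda>x. (1 / c) * ((f - u) x * \<phi> x / a x)) = (\<lambda>x. k x * \<phi> x)" by (simp add: k_def)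
    finally show "(LINT x|M01. weak_deriv 2 u x * deriv (deriv \<phi>) x) = (LINT x|M01. k x * \<phi> x)" .
  qed
  moreover have "AE x in M01. a x * k x = (1 / c) * (f - u) x"
    using AE_a_pos by eventually_elim (simp add: k_def)
  ultimately have dom: "u \<in> domA a" "AE x in M01. opA a u x = (1 / c) * (f - u) x"
    using domA_I[OF u(1) _ z] by auto
  have "AE x in M01. u x + c * opA a u x = f x"
    using dom(2) by eventually_elim (use c in \<open>simp add: fun_diff_def\<close>)
  then show ?thesis using that[OF dom(1)] weak by (simp add: fun_diff_def)
qed

text \<open>\<open>u\<close> solves the resolvent equation with right-hand side u + A u, and so does
  the variational solution z. Their difference is null by \<open>resolvent_unique\<close>, and for z
  the formula is the last conclusion of \<open>resolvent_exists\<close>.\<close>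

theorem green:
  assumes u: "u \<in> domA a" and v: "v \<in> H2_0"
  shows "(LINT x|M01. weak_deriv 2 u x * weak_deriv 2 v x) = (LINT x|M01. opA a u x * v x / a x)"
proof -
  note U = domA_D[OF u]
  have f: "u + opA a u \<in> L2w a" using w.V_add H2_0_L2w U by blast
  obtain z where z: "z \<in> domA a" "AE x in M01. z x + 1 * opA a z x = (u + opA a u) x"
    "\<And>v. v \<in> H2_0 \<Longrightarrow> 1 * (LINT x|M01. weak_deriv 2 z x * weak_deriv 2 v x) = (LINT x|M01. ((u + opA a u) x - z x) * v x / a x)"
    by (rule resolvent_exists[OF f zero_less_one]) (rule that)
  note Z = domA_D[OF z(1)]
  have diff: "(\<lambda>x. 1 * u x + (-1) * z x) = u - z" by (simp add: fun_diff_def)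
  have "u - z \<in> domA a" using domA_linear(1)[OF u z(1), of 1 "-1"] unfolding diff .
  moreover have "AE x in M01. (u - z) x + 1 * opA a (u - z) x = 0"
    using domA_linear(2)[OF u z(1), of 1 "-1", unfolded diff] z(2)
    by eventually_elim (simp add: fun_diff_def plus_fun_def)
  ultimately have null: "h2.nrm (u - z) = 0" using resolvent_unique zero_less_one by blast
  have "(LINT x|M01. weak_deriv 2 u x * weak_deriv 2 v x) = (LINT x|M01. weak_deriv 2 z x * weak_deriv 2 v x)"
    using h2.cauchy_schwarz[OF h2.V_diff[OF U(1) Z(1)] v] null h2.ip_diff[OF U(1) Z(1) v] by simp
  also have "\<dots> = (LINT x|M01. (u + opA a u - z) x * v x / a x)"
    using z(3)[OF v] by (simp add: fun_diff_def)
  also have "\<dots> = (LINT x|M01. opA a u x * v x / a x)"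
  proof (rule L2w_ip_cong)
    show "u + opA a u - z \<in> L2w a" using w.V_diff[OF f] H2_0_L2w[OF Z(1)] by blast
    show "AE x in M01. (u + opA a u - z) x = opA a u x"
      using h2_null[OF h2.V_diff[OF U(1) Z(1)] null] by eventually_elim (simp add: fun_diff_def plus_fun_def)
  qed (use U H2_0_L2w[OF v] in auto)
  finally show ?thesis .
qed

end

section \<open>Well-posedness\<close>

lemma eventually_time: "\<forall>\<^sub>F s in at t within {0..}. 0 \<le> (s :: real)"
  by (simp add: eventually_at_filter)

lemma C_time_0_map:
  assumes "C_time 0 V N y"
    and "\<And>x x'. x \<in> V \<Longrightarrow> x' \<in> V \<Longrightarrow> x - x' \<in> V"
    and "\<And>x. x \<in> V \<Longrightarrow> p x \<in> V' \<and> 0 \<le> N' (p x) \<and> N' (p x) \<le> C * N x"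
    and "\<And>x x'. x \<in> V \<Longrightarrow> x' \<in> V \<Longrightarrow> p (x - x') = p x - p x'"
  shows "C_time 0 V' N' (\<lambda>t. p (y t))"
  unfolding C_time.simps
proof (intro allI impI conjI)
  fix t :: real assume t: "0 \<le> t"
  have yV: "y s \<in> V" if "0 \<le> s" for s using assms(1) that by simp
  show "p (y t) \<in> V'" using assms(3) yV[OF t] by blast
  show "((\<lambda>s. N' (p (y s) - p (y t))) \<longlongrightarrow> 0) (at t within {0..})"
  proof (rule Lim_null_comparison)
    have "((\<lambda>s. N (y s - y t)) \<longlongrightarrow> 0) (at t within {0..})" using assms(1) t by simp
    from tendsto_mult[OF tendsto_const this, of C]
    show "((\<lambda>s. C * N (y s - y t)) \<longlongrightarrow> 0) (at t within {0..})" by simp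
    show "\<forall>\<^sub>F s in at t within {0..}. norm (N' (p (y s) - p (y t))) \<le> C * N (y s - y t)"
      using eventually_time
    proof eventually_elim
      case (elim s)
      have "y s - y t \<in> V" using assms(2) yV elim t by blast
      then show ?case using assms(3)[of "y s - y t"] assms(4)[of "y s" "y t"] yV elim t by simp
    qed
  qed
qed

text \<open>Serves to pass from the energy space to its components. The target norm only has to be
  nonnegative and bounded on the image, so \<open>norm_H2w\<close> is covered along with
  \<open>norm_L2w\<close>.\<close>

lemma has_time_derivative_map:
  assumes "has_time_derivative V N y z"
    and V: "subspace V"
    and "\<And>x. x \<in> V \<Longrightarrow> p x \<in> V' \<and> 0 \<le> N' (p x) \<and> N' (p x) \<le> C * N x"
    and diff: "\<And>x x'. x \<in> V \<Longrightarrow> x' \<in> V \<Longrightarrow> p (x - x') = p x - p x'"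
    and scale: "\<And>x c. x \<in> V \<Longrightarrow> p (c *\<^sub>R x) = c *\<^sub>R p x"
  shows "has_time_derivative V' N' (\<lambda>t. p (y t)) (\<lambda>t. p (z t))"
  unfolding has_time_derivative_def
proof (intro allI impI conjI)
  fix t :: real assume t: "0 \<le> t"
  have yV: "y s \<in> V" "z s \<in> V" if "0 \<le> s" for s using assms(1) that by (auto simp: has_time_derivative_def)
  show "p (y t) \<in> V'" "p (z t) \<in> V'" using assms(3) yV[OF t] by blast+
  show "((\<lambda>s. N' ((1 / (s - t)) *\<^sub>R (p (y s) - p (y t)) - p (z t))) \<longlongrightarrow> 0) (at t within {0..})"
  proof (rule Lim_null_comparison)
    have "((\<lambda>s. N ((1 / (s - t)) *\<^sub>R (y s - y t) - z t)) \<longlongrightarrow> 0) (at t within {0..})"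
      using assms(1) t by (simp add: has_time_derivative_def)
    from tendsto_mult[OF tendsto_const this, of C]
    show "((\<lambda>s. C * N ((1 / (s - t)) *\<^sub>R (y s - y t) - z t)) \<longlongrightarrow> 0) (at t within {0..})" by simp
    show "\<forall>\<^sub>F s in at t within {0..}. norm (N' ((1 / (s - t)) *\<^sub>R (p (y s) - p (y t)) - p (z t)))
        \<le> C * N ((1 / (s - t)) *\<^sub>R (y s - y t) - z t)"
      using eventually_time
    proof eventually_elim
      case (elim s)
      have 1: "y s - y t \<in> V" using subspace_diff[OF V] yV elim t by blast
      then have 2: "(1 / (s - t)) *\<^sub>R (y s - y t) \<in> V" by (rule subspace_scale[OF V])
      then have 3: "(1 / (s - t)) *\<^sub>R (y s - y t) - z t \<in> V" using subspace_diff[OF V] yV t by blast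
      have "p ((1 / (s - t)) *\<^sub>R (y s - y t) - z t) = (1 / (s - t)) *\<^sub>R (p (y s) - p (y t)) - p (z t)"
        using diff[OF 2 yV(2)[OF t]] scale[OF 1] diff[OF yV(1)[OF elim] yV(1)[OF t]] by simp
      then show ?case using assms(3)[OF 3] by simp
    qed
  qed
qed

section \<open>Curves up to null vectors\<close>

context semi_hilbert
begin

lemma C_time_0_cong:
  assumes "C_time 0 V nrm y" "\<And>t. 0 \<le> t \<Longrightarrow> y' t \<in> V" "\<And>t. 0 \<le> t \<Longrightarrow> eqv nrm (y t) (y' t)"
  shows "C_time 0 V nrm y'"
  unfolding C_time.simps
proof (intro allI impI conjI)
  fix t :: real assume t: "0 \<le> t"
  show "y' t \<in> V" by (rule assms(2)[OF t])
  have yV: "y s \<in> V" "emb (y s) = emb (y' s)" if "0 \<le> s" for s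
    using assms(1) assms(2,3)[OF that] that by (auto simp: eqv_iff)
  have "((\<lambda>s. nrm (y s - y t)) \<longlongrightarrow> 0) (at t within {0..})" using assms(1) t by simp
  then show "((\<lambda>s. nrm (y' s - y' t)) \<longlongrightarrow> 0) (at t within {0..})"
  proof (rule Lim_transform_eventually)
    show "\<forall>\<^sub>F s in at t within {0..}. nrm (y s - y t) = nrm (y' s - y' t)"
      using eventually_time
      by eventually_elim (use yV assms(2) t in \<open>simp add: nrm_emb V_diff emb_diff\<close>)
  qed
qed

lemma has_time_derivative_cong:
  assumes "has_time_derivative V nrm y z"
    and y': "\<And>t. 0 \<le> t \<Longrightarrow> y' t \<in> V" "\<And>t. 0 \<le> t \<Longrightarrow> eqv nrm (y t) (y' t)"
    and z': "\<And>t. 0 \<le> t \<Longrightarrow> z' t \<in> V" "\<And>t. 0 \<le> t \<Longrightarrow> eqv nrm (z t) (z' t)"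
  shows "has_time_derivative V nrm y' z'"
  unfolding has_time_derivative_def
proof (intro allI impI conjI)
  fix t :: real assume t: "0 \<le> t"
  show "y' t \<in> V" "z' t \<in> V" using y' z' t by auto
  have yV: "y s \<in> V" "emb (y s) = emb (y' s)" "z s \<in> V" "emb (z s) = emb (z' s)" if "0 \<le> s" for s
    using assms(1) y'[OF that] z'[OF that] that by (auto simp: has_time_derivative_def eqv_iff)
  have "((\<lambda>s. nrm ((1 / (s - t)) *\<^sub>R (y s - y t) - z t)) \<longlongrightarrow> 0) (at t within {0..})"
    using assms(1) t by (simp add: has_time_derivative_def)
  then show "((\<lambda>s. nrm ((1 / (s - t)) *\<^sub>R (y' s - y' t) - z' t)) \<longlongrightarrow> 0) (at t within {0..})"
  proof (rule Lim_transform_eventually)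
    show "\<forall>\<^sub>F s in at t within {0..}. nrm ((1 / (s - t)) *\<^sub>R (y s - y t) - z t) = nrm ((1 / (s - t)) *\<^sub>R (y' s - y' t) - z' t)"
      using eventually_time
      by eventually_elim (use yV y' z' t in \<open>simp add: nrm_emb V_diff V_scale emb_diff emb_scale\<close>)
  qed
qed

text \<open>A mild solution comes with a derivative supplied by its definition, while continuous
  dependence is stated for an arbitrary one; this identifies the two.\<close>

lemma time_derivative_unique:
  assumes "has_time_derivative V nrm y z" "has_time_derivative V nrm y z'" "0 \<le> t"
  shows "nrm (z t - z' t) = 0"
proof -
  have V: "y s \<in> V" "z s \<in> V" "z' s \<in> V" if "0 \<le> s" for s
    using assms that by (auto simp: has_time_derivative_def)
  let ?q = "\<lambda>s. (1 / (s - t)) *\<^sub>R (y s - y t)"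
  have lim: "((\<lambda>s. nrm (?q s - z t) + nrm (?q s - z' t)) \<longlongrightarrow> 0 + 0) (at t within {0..})"
    using assms by (intro tendsto_add) (auto simp: has_time_derivative_def)
  have ev: "\<forall>\<^sub>F s in at t within {0..}. nrm (z t - z' t) \<le> nrm (?q s - z t) + nrm (?q s - z' t)"
    using eventually_time
  proof eventually_elim
    case (elim s)
    have q: "?q s \<in> V" using V elim assms(3) by (intro V_scale V_diff) auto
    have "nrm (z t - z' t) \<le> nrm (z t - ?q s) + nrm (?q s - z' t)"
      using nrm_triangle[of "z t - ?q s" "?q s - z' t"] q V[OF assms(3)] V_diff by simp
    then show ?case using nrm_minus_commute[OF V(2)[OF assms(3)] q] by simp
  qed
  have nb: "at t within {0..} \<noteq> bot"
  proof -
    have "at_right t \<le> at t within {0..}" using assms(3) by (intro at_le) auto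
    then show ?thesis using trivial_limit_at_right_real[of t] by (metis bot.extremum_uniqueI)
  qed
  have "nrm (z t - z' t) \<le> 0 + 0" by (rule tendsto_lowerbound[OF lim ev nb])
  then show ?thesis using nrm_nonneg[OF V_diff[OF V(2,3)[OF assms(3)]]] by simp
qed

end

section \<open>The matrix operator on the energy space\<close>

context degenerate
begin

sublocale e: semi_hilbert "H0 a" "inner_H0 a"
proof -
  have "inner_H0 a = (\<lambda>U W. (LINT x|M01. weak_deriv 2 (fst U) x * weak_deriv 2 (fst W) x)
      + (LINT x|M01. snd U x * snd W x / a x))"
    by (intro ext) (simp add: inner_H0_def)
  then show "semi_hilbert (H0 a) (inner_H0 a)"
    using semi_hilbert_prod[OF semi_hilbert_H2_0 w.semi_hilbert_axioms] by (simp add: H0_def H2w_eq)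
qed

lemma e_nrm: "e.nrm = norm_H0 a"
  by (intro ext) (simp add: e.nrm_def norm_H0_def)

lemma w_nrm': "w.nrm = norm_L2w a"
  by (intro ext) (rule w_nrm)

lemma H0_iff: "U \<in> H0 a \<longleftrightarrow> fst U \<in> H2_0 \<and> snd U \<in> L2w a"
  by (auto simp: H0_def H2w_eq mem_Times_iff)

lemma e_nrm_sq: "U \<in> H0 a \<Longrightarrow> (e.nrm U)\<^sup>2 = (h2.nrm (fst U))\<^sup>2 + (w.nrm (snd U))\<^sup>2"
  by (simp add: e.nrm_sq h2.nrm_sq w.nrm_sq H0_iff inner_H0_def)

lemma e_nrm_components:
  assumes "U \<in> H0 a"
  shows "h2.nrm (fst U) \<le> e.nrm U" "w.nrm (snd U) \<le> e.nrm U"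
  using e_nrm_sq[OF assms] e.nrm_nonneg[OF assms]
  by (auto intro!: power2_le_imp_le[of _ "e.nrm U"])

lemma h2_null_iff: "u \<in> H2_0 \<Longrightarrow> h2.nrm u = 0 \<longleftrightarrow> (AE x in M01. u x = 0)"
proof
  assume u: "u \<in> H2_0" "AE x in M01. u x = 0"
  have "AE x in M01. weak_deriv 2 u x = weak_deriv 2 (0 *\<^sub>R u) x"
    using u by (intro H2_0_cong(2)[OF h2.V_scale[OF u(1)] H2_0_L2[OF u(1)]]) (simp add: scaleR_fun_def zero_fun_def)
  moreover have "AE x in M01. weak_deriv 2 (0 *\<^sub>R u) x = 0"
    using H2_0_linear(2)[OF u(1) u(1), of 0 0] by (simp add: zero_fun_def)
  ultimately have "AE x in M01. (weak_deriv 2 u x)\<^sup>2 = 0" by eventually_elim simp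
  then show "h2.nrm u = 0" by (simp add: h2_nrm sq_nrm integral_eq_zero_AE)
qed (rule h2_null)

text \<open>Translates the abstract identification into equality almost everywhere. For the first
  component this uses that an element of \<open>H2_0\<close> is controlled by its second
  derivative.\<close>

lemma eqv_H0_iff:
  assumes "U \<in> H0 a" "W \<in> H0 a"
  shows "eqv e.nrm U W \<longleftrightarrow> (AE x in M01. fst U x = fst W x) \<and> (AE x in M01. snd U x = snd W x)"
proof -
  have d: "U - W \<in> H0 a" using e.V_diff assms by blast
  have "eqv e.nrm U W \<longleftrightarrow> (e.nrm (U - W))\<^sup>2 = 0" by (simp add: eqv_def)
  also have "\<dots> \<longleftrightarrow> h2.nrm (fst (U - W)) = 0 \<and> w.nrm (snd (U - W)) = 0"
    unfolding e_nrm_sq[OF d] by (simp add: sum_power2_eq_zero_iff)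
  also have "\<dots> \<longleftrightarrow> (AE x in M01. fst U x = fst W x) \<and> (AE x in M01. snd U x = snd W x)"
    using d h2_null_iff[of "fst (U - W)"] L2w_null[of "snd (U - W)"]
    by (simp add: H0_iff fun_diff_def)
  finally show ?thesis .
qed

lemma dom_matA_iff: "U \<in> dom_matA a \<longleftrightarrow> fst U \<in> domA a \<and> snd U \<in> H2_0"
  by (auto simp: dom_matA_def H2w_eq mem_Times_iff)

lemma op_matA_in:
  assumes "U \<in> dom_matA a" shows "op_matA a U \<in> H0 a"
  using assms w.V_scale[of "opA a (fst U)" "-1"] domA_D(2)[of "fst U"]
  by (auto simp: op_matA_def H0_iff dom_matA_iff scaleR_fun_def fun_Compl_def)

text \<open>The matrix operator is skew: the inner product of B (u, v) with (u, v) is the integral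
  of v'' u'' minus that of (A u) v / a, which is 0 by Green's formula. For the range, eliminating v
  = (u - f1) / h from u - h v = f1 and v + h A u = f2 leaves u + h^2 A u = f1 + h f2.\<close>

sublocale op: dissipative_operator "H0 a" "inner_H0 a" "dom_matA a" "op_matA a"
proof
  have lin: "(\<lambda>x. b * u x + c * v x) = b *\<^sub>R u + c *\<^sub>R v" for b c and u v :: "real \<Rightarrow> real"
    by (simp add: plus_fun_def scaleR_fun_def)
  have zero: "0 \<in> domA a"
  proof -
    \<comment> \<open>The fourth derivative of 0 is picked by choice, so membership of 0 is obtained
      by scaling some resolvent solution by 0.\<close>
    obtain u where u: "u \<in> domA a" using resolvent_exists[OF w.V_0 zero_less_one] by blast
    from domA_linear(1)[OF u u, of 0 0, unfolded lin] show ?thesis by simp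
  qed
  have sub_domA: "subspace (domA a)"
    unfolding subspace_def
    using zero domA_linear(1)[of _ _ 1 1, unfolded lin] domA_linear(1)[of _ _ _ 0, unfolded lin] by simp
  show sub: "subspace (dom_matA a)"
    unfolding dom_matA_def H2w_eq by (intro subspace_Times sub_domA h2.subspace_V)
  show "dom_matA a \<subseteq> H0 a" using domA_D(1) H2_0_L2w by (auto simp: dom_matA_iff H0_iff)
  then have in_H0: "U \<in> H0 a" if "U \<in> dom_matA a" for U using that by blast
  fix U assume U: "U \<in> dom_matA a"
  then have U': "fst U \<in> domA a" "snd U \<in> H2_0" by (auto simp: dom_matA_iff)
  show UH: "op_matA a U \<in> H0 a" by (rule op_matA_in[OF U])
  show "eqv e.nrm (op_matA a (U + W)) (op_matA a U + op_matA a W)" if W: "W \<in> dom_matA a" for W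
  proof -
    have W': "fst W \<in> domA a" using W by (simp add: dom_matA_iff)
    have "AE x in M01. opA a (fst U + fst W) x = opA a (fst U) x + opA a (fst W) x"
      using domA_linear(2)[OF U'(1) W', of 1 1] by (simp add: plus_fun_def)
    then have "AE x in M01. snd (op_matA a (U + W)) x = snd (op_matA a U + op_matA a W) x"
      by eventually_elim (simp add: op_matA_def fun_Compl_def plus_fun_def)
    then show ?thesis
      using eqv_H0_iff[OF op_matA_in[OF subspace_add[OF sub U W]] e.V_add[OF UH op_matA_in[OF W]]]
      by (simp add: op_matA_def)
  qed
  show "eqv e.nrm (op_matA a (c *\<^sub>R U)) (c *\<^sub>R op_matA a U)" for c
  proof -
    have "AE x in M01. opA a (c *\<^sub>R fst U) x = c * opA a (fst U) x"
      using domA_linear(2)[OF U'(1) U'(1), of c 0] by (simp add: scaleR_fun_def)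
    then show ?thesis
      using eqv_H0_iff[OF op_matA_in[OF subspace_scale[OF sub U]] e.V_scale[OF UH]]
      by (simp add: op_matA_def fun_Compl_def) (simp add: scaleR_fun_def)
  qed
  show "W \<in> dom_matA a \<and> eqv e.nrm (op_matA a U) (op_matA a W)" if W: "W \<in> H0 a" "eqv e.nrm U W" for W
  proof -
    have ae: "AE x in M01. fst U x = fst W x" "AE x in M01. snd U x = snd W x"
      using eqv_H0_iff[OF in_H0[OF U] W(1)] W(2) by auto
    have f: "fst W \<in> H2_0" using W(1) by (simp add: H0_iff)
    have s: "snd W \<in> H2_0"
      using H2_0_cong(1)[OF U'(2) _ ae(2)] W(1) by (simp add: H0_iff L2w_def)
    note c = domA_cong[OF U'(1) f ae(1)]
    have Wd: "W \<in> dom_matA a" using c(1) s by (simp add: dom_matA_iff)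
    have "AE x in M01. opA a (fst U) x = opA a (fst W) x" using c(2) by eventually_elim simp
    then show ?thesis
      using Wd eqv_H0_iff[OF UH op_matA_in[OF Wd]] ae(2) by (simp add: op_matA_def fun_Compl_def)
  qed
  show "inner_H0 a (op_matA a U) U \<le> 0"
  proof -
    have "(LINT x|M01. weak_deriv 2 (snd U) x * weak_deriv 2 (fst U) x) = (LINT x|M01. opA a (fst U) x * snd U x / a x)"
      using green[OF U'] by (simp add: mult.commute)
    then show ?thesis by (simp add: inner_H0_def op_matA_def fun_Compl_def)
  qed
next
  fix f :: "(real \<Rightarrow> real) \<times> (real \<Rightarrow> real)" and h :: real
  assume f: "f \<in> H0 a" and h: "0 < h"
  then have f': "fst f \<in> H2_0" "snd f \<in> L2w a" by (auto simp: H0_iff)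
  have "fst f + h *\<^sub>R snd f \<in> L2w a" using f' H2_0_L2w by (intro w.V_add w.V_scale)
  then obtain u where u: "u \<in> domA a" "AE x in M01. u x + h * h * opA a u x = (fst f + h *\<^sub>R snd f) x"
    by (rule resolvent_exists[OF _ mult_pos_pos[OF h h]]) (rule that)
  define v where "v = (1 / h) *\<^sub>R (u - fst f)"
  have v: "v \<in> H2_0" unfolding v_def using domA_D(1)[OF u(1)] f' by (intro h2.V_scale h2.V_diff)
  have uv: "(u, v) \<in> dom_matA a" using u v by (simp add: dom_matA_iff)
  have uvH: "(u, v) \<in> H0 a" using domA_D(1)[OF u(1)] H2_0_L2w[OF v] by (simp add: H0_iff)
  have "eqv e.nrm ((u, v) - h *\<^sub>R op_matA a (u, v)) f"
    unfolding eqv_H0_iff[OF e.V_diff[OF uvH e.V_scale[OF op_matA_in[OF uv]]] f]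
  proof
    show "AE x in M01. fst ((u, v) - h *\<^sub>R op_matA a (u, v)) x = fst f x"
      using h by (intro AE_I2) (simp add: op_matA_def v_def scaleR_fun_def fun_diff_def)
    show "AE x in M01. snd ((u, v) - h *\<^sub>R op_matA a (u, v)) x = snd f x"
      using u(2)
    proof eventually_elim
      case (elim x)
      have "h * (v x + h * opA a u x) = (u x + h * h * opA a u x) - fst f x"
        using h by (simp add: v_def scaleR_fun_def fun_diff_def algebra_simps)
      also have "\<dots> = h * snd f x" using elim by (simp add: plus_fun_def scaleR_fun_def)
      finally have "v x + h * opA a u x = snd f x" using h by simp
      then show ?case by (simp add: op_matA_def scaleR_fun_def fun_diff_def fun_Compl_def)
    qed
  qed
  then show "\<exists>U\<in>dom_matA a. eqv e.nrm (U - h *\<^sub>R op_matA a U) f" using uv by blast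
qed

text \<open>A Poincare inequality: u' is the primitive of u'', hence bounded by its norm. The three
  parts of the squared norm contribute C^2, 1 and 1, whence sqrt (C^2 + 2).\<close>

lemma norm_H2w_bound:
  obtains C where "0 \<le> C" "\<And>u. u \<in> H2_0 \<Longrightarrow> 0 \<le> norm_H2w a u \<and> norm_H2w a u \<le> C * h2.nrm u"
proof -
  obtain C where C: "0 \<le> C" "\<And>u. u \<in> H2_0 \<Longrightarrow> u \<in> L2w a \<and> w.nrm u \<le> C * h2.nrm u"
    by (rule H2_0_subset_L2w) (rule that)
  have "0 \<le> norm_H2w a u \<and> norm_H2w a u \<le> sqrt (C\<^sup>2 + 2) * h2.nrm u" if u: "u \<in> H2_0" for u
  proof -
    let ?g = "weak_deriv 2 u" and ?N = "h2.nrm u"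
    note R = H2_0_representation[OF u]
    have N: "0 \<le> ?N" by (rule h2.nrm_nonneg[OF u])
    have pc: "continuous_on {0..1} (prim ?g)" by (rule prim_continuous[OF Lsq_M01_integrable[OF R(1)]])
    have "(LINT x|M01. (weak_deriv 1 u x)\<^sup>2) = (LINT x|M01. (prim ?g x)\<^sup>2)"
    proof (rule integral_cong_AE)
      show "(\<lambda>x. (weak_deriv 1 u x)\<^sup>2) \<in> borel_measurable M01"
        by (intro borel_measurable_power weak_deriv_measurable[OF R(6)])
      show "(\<lambda>x. (prim ?g x)\<^sup>2) \<in> borel_measurable M01"
        using continuous_Lsq[OF pc] by (intro borel_measurable_power) (simp add: Lsq_def)
      show "AE x in M01. (weak_deriv 1 u x)\<^sup>2 = (prim ?g x)\<^sup>2"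
        using weak_deriv_eq(2)[OF R(6)] by eventually_elim simp
    qed
    also have "\<dots> \<le> (LINT x|M01. ?N\<^sup>2)"
    proof (rule integral_mono)
      show "integrable M01 (\<lambda>x. (prim ?g x)\<^sup>2)" using continuous_Lsq[OF pc] by (simp add: Lsq_def)
      show "integrable M01 (\<lambda>_. ?N\<^sup>2)" by (intro M01_integrable_continuous continuous_intros)
      show "(prim ?g x)\<^sup>2 \<le> ?N\<^sup>2" for x
        using prim_le_nrm[OF R(1), of x] by (intro power2_le_iff_abs_le[THEN iffD2]) (auto simp: h2_nrm sq.nrm_nonneg[OF R(1)])
    qed
    finally have 1: "(LINT x|M01. (weak_deriv 1 u x)\<^sup>2) \<le> ?N\<^sup>2" unfolding M01_integral_const .
    have 2: "(LINT x|M01. (?g x)\<^sup>2) = ?N\<^sup>2"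
      using h2.nrm_sq[OF u] by (simp add: power2_eq_square)
    have "w.nrm u \<le> C * ?N" "0 \<le> w.nrm u" using C(2)[OF u] w.nrm_nonneg by auto
    then have 3: "(norm_L2w a u)\<^sup>2 \<le> (C * ?N)\<^sup>2" unfolding w_nrm by (rule power_mono)
    have "norm_H2w a u \<le> sqrt ((C\<^sup>2 + 2) * ?N\<^sup>2)"
      unfolding norm_H2w_def using 1 2 3 by (intro real_sqrt_le_mono) (simp add: power_mult_distrib algebra_simps)
    moreover have "0 \<le> (LINT x|M01. (weak_deriv 1 u x)\<^sup>2)" "0 \<le> (LINT x|M01. (?g x)\<^sup>2)"
      by (rule Bochner_Integration.integral_nonneg; simp)+
    ultimately show ?thesis using N by (simp add: norm_H2w_def real_sqrt_mult)
  qed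
  then show ?thesis using that[of "sqrt (C\<^sup>2 + 2)"] by simp
qed

lemma project_H2w:
  obtains C where "0 \<le> C"
    "\<And>U. U \<in> H0 a \<Longrightarrow> fst U \<in> H2w a \<and> 0 \<le> norm_H2w a (fst U) \<and> norm_H2w a (fst U) \<le> C * e.nrm U"
proof -
  obtain C where C: "0 \<le> C" "\<And>u. u \<in> H2_0 \<Longrightarrow> 0 \<le> norm_H2w a u \<and> norm_H2w a u \<le> C * h2.nrm u"
    by (rule norm_H2w_bound) (rule that)
  have "fst U \<in> H2w a \<and> 0 \<le> norm_H2w a (fst U) \<and> norm_H2w a (fst U) \<le> C * e.nrm U" if U: "U \<in> H0 a" for U
  proof -
    have f: "fst U \<in> H2_0" using U by (simp add: H0_iff)
    have "C * h2.nrm (fst U) \<le> C * e.nrm U" using e_nrm_components(1)[OF U] C(1) by (rule mult_left_mono)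
    then show ?thesis using C(2)[OF f] f by (auto simp: H2w_eq)
  qed
  then show ?thesis using that C(1) by blast
qed

lemma project_L2w:
  "U \<in> H0 a \<Longrightarrow> snd U \<in> L2w a \<and> 0 \<le> w.nrm (snd U) \<and> w.nrm (snd U) \<le> 1 * e.nrm U"
  using e_nrm_components(2)[of U] by (auto simp: H0_iff w.nrm_nonneg)

section \<open>Mild and classical solutions\<close>

lemma mild_solution_iff:
  "mild_solution a y0 y1 y \<longleftrightarrow>
    (\<exists>S yt. generated_semigroup (H0 a) (inner_H0 a) (dom_matA a) (op_matA a) S \<and>
      has_time_derivative (L2w a) w.nrm y yt \<and>
      (\<forall>t\<ge>0. (y t, yt t) \<in> H0 a \<and> eqv e.nrm (y t, yt t) (S t (y0, y1))))"
proof -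
  have "generated_semigroup (H0 a) (inner_H0 a) (dom_matA a) (op_matA a) S \<longleftrightarrow>
      C0_semigroup (H0 a) e.nrm S \<and> generated_by (H0 a) e.nrm S (dom_matA a) (op_matA a)" for S
    using op.dissipative_operator_axioms
    by (auto simp: generated_semigroup_def generated_semigroup_axioms_def)
  then show ?thesis unfolding mild_solution_def e_nrm w_nrm' by blast
qed

text \<open>Orbits of general data need not be differentiable in the energy space, so the derivative
  of y is sought in the weaker weighted space. With U = X - B X one has S t U = S t X - B (S t X) up
  to null vectors, and its first component is the difference of the two components of the
  differentiable orbit S t X.\<close>

theorem mild_solution_exists:
  assumes U: "(y0, y1) \<in> H0 a"
  shows "\<exists>y. mild_solution a y0 y1 y \<and> C_time 1 (L2w a) (norm_L2w a) y \<and> C_time 0 (H2w a) (norm_H2w a) y"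
proof -
  obtain S where S: "C0_semigroup (H0 a) e.nrm S" "generated_by (H0 a) e.nrm S (dom_matA a) (op_matA a)"
    by (rule op.semigroup_exists)
  interpret g: generated_semigroup "H0 a" "inner_H0 a" "dom_matA a" "op_matA a" S
    by unfold_locales (rule S)+
  let ?U = "(y0, y1)"
  define y where "y t = fst (S t ?U)" for t
  define yt where "yt t = snd (S t ?U)" for t
  have C0: "C_time 0 (H0 a) e.nrm (\<lambda>t. S t ?U)" using g.S_continuous[OF U] g.S_in U by simp
  have yt_c: "C_time 0 (L2w a) w.nrm yt"
    unfolding yt_def[abs_def] by (rule C_time_0_map[OF C0 e.V_diff project_L2w]) auto
  obtain C where C: "\<And>U. U \<in> H0 a \<Longrightarrow> fst U \<in> H2w a \<and> 0 \<le> norm_H2w a (fst U) \<and> norm_H2w a (fst U) \<le> C * e.nrm U"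
    by (rule project_H2w) (rule that)
  have y_c: "C_time 0 (H2w a) (norm_H2w a) y"
    unfolding y_def[abs_def] by (rule C_time_0_map[OF C0 e.V_diff C]) auto
  obtain X where X: "X \<in> dom_matA a" "eqv e.nrm (X - 1 *\<^sub>R op_matA a X) ?U"
    using op.B_range[OF U zero_less_one] by blast
  have XH: "X \<in> H0 a" "op_matA a X \<in> H0 a" using op.D_in X(1) op.B_in by auto
  have split: "fst (S t X) x - snd (S t X) x = y t x \<and> snd (S t X) x - snd (op_matA a (S t X)) x = yt t x"
    if "0 \<le> t" "fst (S t X - op_matA a (S t X)) x = fst (S t ?U) x" "snd (S t X - op_matA a (S t X)) x = snd (S t ?U) x" for t x
    using that by (simp add: y_def yt_def op_matA_def fun_diff_def)
  have ae: "AE x in M01. fst (S t X) x - snd (S t X) x = y t x \<and> snd (S t X) x - snd (op_matA a (S t X)) x = yt t x"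
    if t: "0 \<le> t" for t
  proof -
    note D = g.S_in_D[OF X(1) t]
    have SX: "S t X \<in> H0 a" "op_matA a (S t X) \<in> H0 a" using op.D_in D(1) op.B_in by auto
    have "e.emb ?U = e.emb (X - op_matA a X)" using X(2) XH U by (simp add: e.eqv_iff e.V_diff)
    then have "e.emb (S t ?U) = e.emb (S t (X - op_matA a X))" using t U XH by (intro g.emb_S_cong e.V_diff)
    also have "\<dots> = e.emb (S t X - op_matA a (S t X))"
      using t XH SX D(2) by (simp add: g.emb_S_diff e.emb_diff)
    finally have "eqv e.nrm (S t X - op_matA a (S t X)) (S t ?U)"
      using t U SX by (simp add: e.eqv_iff e.V_diff g.S_in)
    then have "AE x in M01. fst (S t X - op_matA a (S t X)) x = fst (S t ?U) x"
        "AE x in M01. snd (S t X - op_matA a (S t X)) x = snd (S t ?U) x"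
      using eqv_H0_iff[OF e.V_diff[OF SX] g.S_in[OF t U]] by auto
    then show ?thesis by eventually_elim (rule split[OF t])
  qed
  obtain K where K: "0 \<le> K" "\<And>u. u \<in> H2_0 \<Longrightarrow> u \<in> L2w a \<and> w.nrm u \<le> K * h2.nrm u"
    by (rule H2_0_subset_L2w) (rule that)
  \<comment> \<open>Taking the difference of the components is bounded from the energy space into
    the weighted space, because \<open>H2_0\<close> embeds there; this map carries over the
    derivative of the orbit of \<open>X\<close>.\<close>
  have proj: "fst U - snd U \<in> L2w a \<and> 0 \<le> w.nrm (fst U - snd U) \<and> w.nrm (fst U - snd U) \<le> (K + 1) * e.nrm U"
    if U: "U \<in> H0 a" for U
  proof -
    have f: "fst U \<in> H2_0" "fst U \<in> L2w a" "snd U \<in> L2w a" using U K(2) by (auto simp: H0_iff)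
    have d: "fst U - snd U \<in> L2w a" using w.V_diff f by blast
    have "w.nrm (fst U - snd U) \<le> w.nrm (fst U) + w.nrm (snd U)"
      using norm_triangle_ineq4[of "w.emb (fst U)" "w.emb (snd U)"] f d by (simp add: w.nrm_emb w.emb_diff)
    also have "\<dots> \<le> K * e.nrm U + 1 * e.nrm U"
      using K(2)[OF f(1)] mult_left_mono[OF e_nrm_components(1)[OF U] K(1)] e_nrm_components(2)[OF U] by simp
    finally show ?thesis using d w.nrm_nonneg[OF d] by (simp add: algebra_simps)
  qed
  have "has_time_derivative (L2w a) w.nrm (\<lambda>t. fst (S t X) - snd (S t X))
      (\<lambda>t. fst (op_matA a (S t X)) - snd (op_matA a (S t X)))"
    by (rule has_time_derivative_map[OF g.orbit_derivative[OF X(1)] e.subspace_V proj])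
      (auto simp: fun_simps right_diff_distrib)
  then have "has_time_derivative (L2w a) w.nrm y yt"
  proof (rule w.has_time_derivative_cong)
    fix t :: real assume t: "0 \<le> t"
    note D = g.S_in_D[OF X(1) t]
    have SX: "S t X \<in> H0 a" "op_matA a (S t X) \<in> H0 a" using op.D_in D(1) op.B_in by auto
    show yL: "y t \<in> L2w a" "yt t \<in> L2w a"
      using g.S_in[OF t U] K(2) by (auto simp: y_def yt_def H0_iff)
    have eqv_w: "eqv w.nrm p q" if "p \<in> L2w a" "q \<in> L2w a" "AE x in M01. p x = q x" for p q
      using L2w_null[OF w.V_diff[OF that(1,2)]] that(3) by (simp add: eqv_def fun_diff_def)
    show "eqv w.nrm (fst (S t X) - snd (S t X)) (y t)"
    proof (rule eqv_w[OF _ yL(1)])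
      show "fst (S t X) - snd (S t X) \<in> L2w a" using proj SX by blast
      show "AE x in M01. (fst (S t X) - snd (S t X)) x = y t x"
        using ae[OF t] by eventually_elim (simp add: fun_diff_def)
    qed
    \<comment> \<open>The first component of B (S t X) is the second one of S t X, so the derivative
      found is the second component of S t U.\<close>
    show "eqv w.nrm (fst (op_matA a (S t X)) - snd (op_matA a (S t X))) (yt t)"
    proof (rule eqv_w[OF _ yL(2)])
      show "fst (op_matA a (S t X)) - snd (op_matA a (S t X)) \<in> L2w a" using proj SX by blast
      show "AE x in M01. (fst (op_matA a (S t X)) - snd (op_matA a (S t X))) x = yt t x"
        using ae[OF t] by eventually_elim (simp add: fun_diff_def op_matA_def)
    qed
  qed
  note deriv = this
  have "(y t, yt t) = S t ?U" for t by (simp add: y_def yt_def)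
  then have "mild_solution a y0 y1 y"
    unfolding mild_solution_iff using g.generated_semigroup_axioms deriv g.S_in U
    by (intro exI[of _ S] exI[of _ yt]) (simp add: eqv_def e.nrm_zero)
  moreover have "C_time 1 (L2w a) (norm_L2w a) y"
    unfolding One_nat_def C_time.simps(2) using deriv yt_c unfolding w_nrm' by blast
  ultimately show ?thesis using y_c by blast
qed

text \<open>Two mild solutions may rest on different semigroups; uniqueness of the semigroup first
  puts both on one, and contractivity then gives the constant 1. Uniqueness and continuous
  dependence are both read off from this estimate.\<close>

lemma mild_solution_dist:
  assumes "generated_semigroup (H0 a) (inner_H0 a) (dom_matA a) (op_matA a) S"
    and "generated_semigroup (H0 a) (inner_H0 a) (dom_matA a) (op_matA a) R"
    and "U \<in> H0 a" "W \<in> H0 a" "Y \<in> H0 a" "Z \<in> H0 a" "0 \<le> t"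
    and "eqv e.nrm Y (S t U)" "eqv e.nrm Z (R t W)"
  shows "e.nrm (Z - Y) \<le> e.nrm (W - U)"
proof -
  interpret S: generated_semigroup "H0 a" "inner_H0 a" "dom_matA a" "op_matA a" S by fact
  interpret R: generated_semigroup "H0 a" "inner_H0 a" "dom_matA a" "op_matA a" R by fact
  have "e.emb (S t W) = e.emb (R t W)"
    using S.semigroup_unique[OF R.C0 R.generated assms(4,7)] assms S.S_in R.S_in by (simp add: e.eqv_iff)
  then have "e.emb (Z - Y) = e.emb (S t (W - U))"
    using assms S.S_in R.S_in by (simp add: e.eqv_iff e.emb_diff S.emb_S_diff)
  then have "e.nrm (Z - Y) = e.nrm (S t (W - U))"
    using assms S.S_in by (simp add: e.nrm_emb e.V_diff)
  also have "\<dots> \<le> e.nrm (W - U)" using assms by (intro S.S_nrm e.V_diff)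
  finally show ?thesis .
qed

theorem mild_solution_unique:
  assumes U: "(y0, y1) \<in> H0 a" and "mild_solution a y0 y1 y" "mild_solution a y0 y1 z" "0 \<le> t"
  shows "AE x in M01. y t x = z t x"
proof -
  obtain S yt where S: "generated_semigroup (H0 a) (inner_H0 a) (dom_matA a) (op_matA a) S"
    "\<And>t. 0 \<le> t \<Longrightarrow> (y t, yt t) \<in> H0 a \<and> eqv e.nrm (y t, yt t) (S t (y0, y1))"
    using assms(2) unfolding mild_solution_iff by blast
  obtain R zt where R: "generated_semigroup (H0 a) (inner_H0 a) (dom_matA a) (op_matA a) R"
    "\<And>t. 0 \<le> t \<Longrightarrow> (z t, zt t) \<in> H0 a \<and> eqv e.nrm (z t, zt t) (R t (y0, y1))"
    using assms(3) unfolding mild_solution_iff by blast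
  have Y: "(y t, yt t) \<in> H0 a" and Z: "(z t, zt t) \<in> H0 a" using S(2) R(2) assms(4) by auto
  have "e.nrm ((y t, yt t) - (z t, zt t)) \<le> e.nrm ((y0, y1) - (y0, y1))"
    using mild_solution_dist[OF R(1) S(1) U U Z Y assms(4)] S(2) R(2) assms(4) by blast
  also have "\<dots> = 0" by (simp add: e.nrm_zero)
  finally have "eqv e.nrm (y t, yt t) (z t, zt t)"
    using e.nrm_nonneg[OF e.V_diff[OF Y Z]] by (simp add: eqv_def)
  then show ?thesis using eqv_H0_iff[OF Y Z] by simp
qed

text \<open>The energy estimate is uniform in time, and d = e / (C + 1) serves both conclusions: C
  converts the energy norm into \<open>norm_H2w\<close>, while the added 1 makes C / (C + 1) less
  than 1 and keeps d at most e for the velocities.\<close>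

theorem mild_solution_continuous_dependence:
  assumes U: "(y0, y1) \<in> H0 a" and y: "mild_solution a y0 y1 y"
    and yt: "has_time_derivative (L2w a) (norm_L2w a) y yt" and e: "0 < e"
  shows "\<exists>d>0. \<forall>z0 z1 z zt. (z0, z1) \<in> H0 a \<and> mild_solution a z0 z1 z \<and>
     has_time_derivative (L2w a) (norm_L2w a) z zt \<and> norm_H0 a ((z0, z1) - (y0, y1)) < d \<longrightarrow>
     (\<forall>t\<in>{0..T}. norm_H2w a (z t - y t) < e \<and> norm_L2w a (zt t - yt t) < e)"
proof -
  obtain C where C: "0 \<le> C"
    "\<And>U. U \<in> H0 a \<Longrightarrow> fst U \<in> H2w a \<and> 0 \<le> norm_H2w a (fst U) \<and> norm_H2w a (fst U) \<le> C * e.nrm U"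
    by (rule project_H2w) (rule that)
  obtain S yt' where S: "generated_semigroup (H0 a) (inner_H0 a) (dom_matA a) (op_matA a) S"
    "has_time_derivative (L2w a) w.nrm y yt'"
    "\<And>t. 0 \<le> t \<Longrightarrow> (y t, yt' t) \<in> H0 a \<and> eqv e.nrm (y t, yt' t) (S t (y0, y1))"
    using y unfolding mild_solution_iff by blast
  have main: "norm_H2w a (z t - y t) < e \<and> norm_L2w a (zt t - yt t) < e"
    if Z: "(z0, z1) \<in> H0 a" and z: "mild_solution a z0 z1 z"
      and zt: "has_time_derivative (L2w a) (norm_L2w a) z zt"
      and small: "norm_H0 a ((z0, z1) - (y0, y1)) < e / (C + 1)" and t: "0 \<le> t" for z0 z1 z zt t
  proof -
    obtain R zt' where R: "generated_semigroup (H0 a) (inner_H0 a) (dom_matA a) (op_matA a) R"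
      "has_time_derivative (L2w a) w.nrm z zt'"
      "\<And>t. 0 \<le> t \<Longrightarrow> (z t, zt' t) \<in> H0 a \<and> eqv e.nrm (z t, zt' t) (R t (z0, z1))"
      using z unfolding mild_solution_iff by blast
    have yz: "(y t, yt' t) \<in> H0 a" "(z t, zt' t) \<in> H0 a" using S(3) R(3) t by auto
    have "e.nrm ((z t, zt' t) - (y t, yt' t)) \<le> e.nrm ((z0, z1) - (y0, y1))"
      using mild_solution_dist[OF S(1) R(1) U Z yz t] S(3) R(3) t by blast
    also have "\<dots> < e / (C + 1)" using small by (simp add: e_nrm)
    finally have lt: "e.nrm ((z t, zt' t) - (y t, yt' t)) < e / (C + 1)" .
    have d: "(z t, zt' t) - (y t, yt' t) \<in> H0 a" using e.V_diff yz by blast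
    have "norm_H2w a (z t - y t) \<le> C * e.nrm ((z t, zt' t) - (y t, yt' t))" using C(2)[OF d] by simp
    also have "\<dots> \<le> C * (e / (C + 1))" using lt C(1) by (intro mult_left_mono) auto
    also have "\<dots> < e" using C(1) e by (simp add: field_simps)
    finally have 1: "norm_H2w a (z t - y t) < e" .
    have L: "zt t \<in> L2w a" "zt' t \<in> L2w a" "yt t \<in> L2w a" "yt' t \<in> L2w a"
      using zt yt R(2) S(2) t by (auto simp: has_time_derivative_def)
    have "w.emb (zt t) = w.emb (zt' t)" "w.emb (yt t) = w.emb (yt' t)"
      using w.time_derivative_unique[OF _ R(2) t, of zt] w.time_derivative_unique[OF _ S(2) t, of yt] zt yt L
      by (simp_all add: w_nrm' w.emb_eq_iff)
    then have "w.nrm (zt t - yt t) = w.nrm (zt' t - yt' t)"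
      using L by (simp add: w.nrm_emb w.V_diff w.emb_diff)
    also have "\<dots> \<le> e.nrm ((z t, zt' t) - (y t, yt' t))" using e_nrm_components(2)[OF d] by simp
    also have "\<dots> < e / (C + 1)" by (rule lt)
    also have "\<dots> \<le> e" using C(1) e by (simp add: field_simps)
    finally show ?thesis using 1 by (simp add: w_nrm)
  qed
  show ?thesis
    using main e C(1) by (intro exI[of _ "e / (C + 1)"]) auto
qed

text \<open>The orbit stays in the domain and is differentiable in the energy norm. The first
  component of the derivative gives y' in \<open>H2w a\<close>, the second gives y'' = - A y in the
  weighted space, and continuity in the graph norm is continuity of y and of y''.\<close>

theorem classical_solution:
  assumes U: "(y0, y1) \<in> dom_matA a" and y: "mild_solution a y0 y1 y"
  shows "C_time 2 (L2w a) (norm_L2w a) y" "C_time 1 (H2w a) (norm_H2w a) y"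
    "C_time 0 (domA a) (graph_norm_A a) y"
    "\<exists>yt ytt. has_time_derivative (L2w a) (norm_L2w a) y yt \<and> has_time_derivative (L2w a) (norm_L2w a) yt ytt \<and>
      (\<forall>t\<ge>0. AE x in M01. ytt t x + a x * weak_deriv 4 (y t) x = 0)"
proof -
  let ?U = "(y0, y1)"
  obtain S yt where S: "generated_semigroup (H0 a) (inner_H0 a) (dom_matA a) (op_matA a) S"
    "has_time_derivative (L2w a) w.nrm y yt"
    "\<And>t. 0 \<le> t \<Longrightarrow> (y t, yt t) \<in> H0 a \<and> eqv e.nrm (y t, yt t) (S t ?U)"
    using y unfolding mild_solution_iff by blast
  interpret g: generated_semigroup "H0 a" "inner_H0 a" "dom_matA a" "op_matA a" S by (rule S(1))
  \<comment> \<open>The pair agrees with the orbit up to null vectors, so derivative and continuity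
    are transferred to \<open>W\<close> before components are taken.\<close>
  define W where "W t = (y t, yt t)" for t
  have WH: "W t \<in> H0 a" and WS: "e.emb (S t ?U) = e.emb (W t)" and SH: "S t ?U \<in> H0 a" if "0 \<le> t" for t
  proof -
    show "W t \<in> H0 a" "S t ?U \<in> H0 a" using S(3)[OF that] g.S_in[OF that op.D_in[OF U]] by (auto simp: W_def)
    then show "e.emb (S t ?U) = e.emb (W t)" using S(3)[OF that] e.eqv_iff[of "W t" "S t ?U"] by (simp add: W_def)
  qed
  have WD: "W t \<in> dom_matA a" and BW: "e.emb (op_matA a (S t ?U)) = e.emb (op_matA a (W t))" if "0 \<le> t" for t
    using op.emb_B_cong[OF g.S_in_D(1)[OF U that] WH[OF that] WS[OF that]] by auto
  have BWH: "op_matA a (W t) \<in> H0 a" "op_matA a (S t ?U) \<in> H0 a" if "0 \<le> t" for t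
    using op_matA_in WD[OF that] g.S_in_D(1)[OF U that] by auto
  have W': "has_time_derivative (H0 a) e.nrm W (\<lambda>t. op_matA a (W t))"
    by (rule e.has_time_derivative_cong[OF g.orbit_derivative[OF U]])
      (simp_all add: WH WS SH BW BWH e.eqv_iff)
  have "C_time 0 (H0 a) e.nrm (\<lambda>t. op_matA a (S t ?U))"
    using g.orbit_derivative_continuous[OF U] BWH(2) by simp
  then have BWc: "C_time 0 (H0 a) e.nrm (\<lambda>t. op_matA a (W t))"
    by (rule e.C_time_0_cong) (simp_all add: BW BWH e.eqv_iff)
  obtain C where C: "\<And>U. U \<in> H0 a \<Longrightarrow> fst U \<in> H2w a \<and> 0 \<le> norm_H2w a (fst U) \<and> norm_H2w a (fst U) \<le> C * e.nrm U"
    by (rule project_H2w) (rule that)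
  have "has_time_derivative (L2w a) w.nrm (\<lambda>t. snd (W t)) (\<lambda>t. snd (op_matA a (W t)))"
    by (rule has_time_derivative_map[OF W' e.subspace_V project_L2w]) auto
  then have d2: "has_time_derivative (L2w a) w.nrm yt (\<lambda>t. - opA a (y t))"
    by (simp add: W_def op_matA_def)
  have "C_time 0 (L2w a) w.nrm (\<lambda>t. snd (op_matA a (W t)))"
    by (rule C_time_0_map[OF BWc e.V_diff project_L2w]) auto
  then have c2: "C_time 0 (L2w a) w.nrm (\<lambda>t. - opA a (y t))" by (simp only: W_def op_matA_def fst_conv snd_conv)
  have "has_time_derivative (H2w a) (norm_H2w a) (\<lambda>t. fst (W t)) (\<lambda>t. fst (op_matA a (W t)))"
    by (rule has_time_derivative_map[OF W' e.subspace_V C]) auto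
  then have d1: "has_time_derivative (H2w a) (norm_H2w a) y yt" by (simp add: W_def op_matA_def)
  have "C_time 0 (H2w a) (norm_H2w a) (\<lambda>t. fst (op_matA a (W t)))"
    by (rule C_time_0_map[OF BWc e.V_diff C]) auto
  then have c1: "C_time 0 (H2w a) (norm_H2w a) yt" by (simp only: W_def op_matA_def fst_conv snd_conv)
  show "C_time 2 (L2w a) (norm_L2w a) y"
    unfolding numeral_2_eq_2 C_time.simps(2) using S(2) d2 c2 unfolding w_nrm' by blast
  show "C_time 1 (H2w a) (norm_H2w a) y"
    unfolding One_nat_def C_time.simps(2) using d1 c1 by blast
  have ydom: "y t \<in> domA a" if "0 \<le> t" for t using WD[OF that] by (simp add: W_def dom_matA_iff)
  have WC: "C_time 0 (H0 a) e.nrm W"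
    by (rule e.C_time_0_cong[of "\<lambda>t. S t ?U"])
      (use g.S_continuous[OF op.D_in[OF U]] in \<open>simp_all add: WH WS SH e.eqv_iff\<close>)
  obtain K where K: "0 \<le> K" "\<And>u. u \<in> H2_0 \<Longrightarrow> u \<in> L2w a \<and> w.nrm u \<le> K * h2.nrm u"
    by (rule H2_0_subset_L2w) (rule that)
  have projK: "fst U \<in> L2w a \<and> 0 \<le> w.nrm (fst U) \<and> w.nrm (fst U) \<le> K * e.nrm U" if U: "U \<in> H0 a" for U
  proof -
    have f: "fst U \<in> H2_0" using U by (simp add: H0_iff)
    show ?thesis
      using K(2)[OF f] mult_left_mono[OF e_nrm_components(1)[OF U] K(1)] w.nrm_nonneg[of "fst U"] by auto
  qed
  have "C_time 0 (L2w a) w.nrm (\<lambda>t. fst (W t))"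
    by (rule C_time_0_map[OF WC e.V_diff projK]) auto
  then have yc: "C_time 0 (L2w a) w.nrm y" by (simp only: W_def fst_conv)
  show "C_time 0 (domA a) (graph_norm_A a) y"
    unfolding C_time.simps
  proof (intro allI impI conjI)
    fix t :: real assume t: "0 \<le> t"
    show "y t \<in> domA a" by (rule ydom[OF t])
    have "((\<lambda>s. sqrt ((w.nrm (y s - y t))\<^sup>2 + (w.nrm (- opA a (y s) - - opA a (y t)))\<^sup>2)) \<longlongrightarrow> sqrt (0\<^sup>2 + 0\<^sup>2)) (at t within {0..})"
      using yc c2 t by (intro tendsto_intros) simp_all
    then have "((\<lambda>s. sqrt ((w.nrm (y s - y t))\<^sup>2 + (w.nrm (- opA a (y s) - - opA a (y t)))\<^sup>2)) \<longlongrightarrow> 0) (at t within {0..})"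
      by simp
    then show "((\<lambda>s. graph_norm_A a (y s - y t)) \<longlongrightarrow> 0) (at t within {0..})"
    proof (rule Lim_transform_eventually)
      show "\<forall>\<^sub>F s in at t within {0..}. sqrt ((w.nrm (y s - y t))\<^sup>2 + (w.nrm (- opA a (y s) - - opA a (y t)))\<^sup>2) = graph_norm_A a (y s - y t)"
        using eventually_time
      proof eventually_elim
        case (elim s)
        note ys = ydom[OF elim] and yt = ydom[OF t]
        have diff: "(\<lambda>x. 1 * y s x + (-1) * y t x) = y s - y t" by (simp add: fun_diff_def)
        have D: "y s - y t \<in> domA a" using domA_linear(1)[OF ys yt, of 1 "-1"] unfolding diff .
        have A: "opA a (y s) \<in> L2w a" "opA a (y t) \<in> L2w a" "opA a (y s - y t) \<in> L2w a"
          using domA_D(2) ys yt D by auto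
        \<comment> \<open>\<open>weak_deriv 4\<close> is a chosen function, so even the linearity of
          \<open>opA\<close> is available only almost everywhere.\<close>
        have "AE x in M01. (opA a (y s - y t) - (opA a (y s) - opA a (y t))) x = 0"
          using domA_linear(2)[OF ys yt, of 1 "-1", unfolded diff] by eventually_elim (simp add: fun_diff_def)
        then have "w.nrm (opA a (y s - y t) - (opA a (y s) - opA a (y t))) = 0"
          using L2w_null w.V_diff A by blast
        then have "w.emb (opA a (y s - y t)) = w.emb (opA a (y s)) - w.emb (opA a (y t))"
          using A by (simp add: w.emb_eq_iff[symmetric] w.V_diff w.emb_diff)
        then have "w.nrm (opA a (y s - y t)) = w.nrm (opA a (y t) - opA a (y s))"
          using A by (simp add: w.nrm_emb w.V_diff w.emb_diff norm_minus_commute)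
        moreover have "- opA a (y s) - - opA a (y t) = opA a (y t) - opA a (y s)" by simp
        ultimately show ?case by (simp add: graph_norm_A_def w_nrm)
      qed
    qed
  qed
  show "\<exists>yt ytt. has_time_derivative (L2w a) (norm_L2w a) y yt \<and> has_time_derivative (L2w a) (norm_L2w a) yt ytt \<and>
      (\<forall>t\<ge>0. AE x in M01. ytt t x + a x * weak_deriv 4 (y t) x = 0)"
    using S(2) d2 unfolding w_nrm'
    by (intro exI[of _ yt] exI[of _ "\<lambda>t. - opA a (y t)"]) (simp add: fun_Compl_def opA_def)
qed

end

theorem theorem2p2:
  fixes a :: "real \<Rightarrow> real"
  assumes "continuous_on {0..1} a"
    and "a 0 = 0"
    and "\<forall>x\<in>{0<..1}. a x > 0"
    and "\<exists>K\<in>{0<..<2::real}. \<exists>r\<in>{0<..1}. mono_on {0<..r} (\<lambda>x. x powr K / a x)"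
  shows
    "(\<forall>y0 y1. (y0, y1) \<in> H0 a \<longrightarrow>
        (\<exists>y. mild_solution a y0 y1 y \<and>
             C_time 1 (L2w a) (norm_L2w a) y \<and> C_time 0 (H2w a) (norm_H2w a) y) \<and>
        (\<forall>y z. mild_solution a y0 y1 y \<and> mild_solution a y0 y1 z \<longrightarrow>
             (\<forall>t\<ge>0. AE x in M01. y t x = z t x)))
     \<and> (\<forall>y0 y1 y yt T e. (y0, y1) \<in> H0 a \<and> mild_solution a y0 y1 y \<and>
          has_time_derivative (L2w a) (norm_L2w a) y yt \<and> T > 0 \<and> e > 0 \<longrightarrow>
          (\<exists>d>0. \<forall>z0 z1 z zt. (z0, z1) \<in> H0 a \<and> mild_solution a z0 z1 z \<and>
             has_time_derivative (L2w a) (norm_L2w a) z zt \<and>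
             norm_H0 a ((z0, z1) - (y0, y1)) < d \<longrightarrow>
             (\<forall>t\<in>{0..T}. norm_H2w a (z t - y t) < e \<and> norm_L2w a (zt t - yt t) < e)))
     \<and> (\<forall>y0 y1 y. (y0, y1) \<in> dom_matA a \<and> mild_solution a y0 y1 y \<longrightarrow>
          C_time 2 (L2w a) (norm_L2w a) y \<and>
          C_time 1 (H2w a) (norm_H2w a) y \<and>
          C_time 0 (domA a) (graph_norm_A a) y \<and>
          (\<exists>yt ytt. has_time_derivative (L2w a) (norm_L2w a) y yt \<and>
             has_time_derivative (L2w a) (norm_L2w a) yt ytt \<and>
             (\<forall>t\<ge>0. AE x in M01. ytt t x + a x * weak_deriv 4 (y t) x = 0)))"
proof -
  interpret degenerate a by unfold_locales (use assms in auto)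
  show ?thesis
    apply (intro conjI allI impI)
    subgoal for y0 y1 by (rule mild_solution_exists)
    subgoal for y0 y1 y z t by (rule mild_solution_unique) auto
    subgoal for y0 y1 y yt T e by (rule mild_solution_continuous_dependence) auto
    subgoal for y0 y1 y by (rule classical_solution(1)) auto
    subgoal for y0 y1 y by (rule classical_solution(2)) auto
    subgoal for y0 y1 y by (rule classical_solution(3)) auto
    subgoal for y0 y1 y by (rule classical_solution(4)) auto
    done
qed

end
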